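(* Let $r>t\ge1$ be integers and $p\ge1$ be a real number. Let $\mathcal{F},\hat{\mathcal{F}}$ be two nondegenerate families of $r$-graphs such that $\hat{\mathcal{F}}\le_{\mathrm{hom}}\mathcal{F}$. Let $\mathfrak{H}$ be a hereditary family of $\hat{\mathcal{F}}$-free $r$-graphs. Suppose that (i) $\hat{\mathcal{F}}$ is blowup-invariant, and (ii) $\hat{\mathcal{F}}$ is symmetrized-stable with respect to $\mathfrak{H}$. Then for every integer $n\ge1$, $$\mathrm{ex}_{t,p}(n,\hat{\mathcal{F}})=\max\{\|\mathcal{G}\|_{t,p}:\mathcal{G}\in\mathfrak{H}\text{ and }v(\mathcal{G})=n\}.$$ If, in addition, (iii) every member of $\mathfrak{H}$ is $\mathcal{F}$-free, and (iv) both $\hat{\mathcal{F}}$ and $\mathcal{F}$ are $(t,p)$-vertex-extendable with respect to $\mathfrak{H}$, then $\mathcal{F}$ is $(t,p)$-degree-stable with respect to $\mathfrak{H}$.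
   Context: An $r$-graph $\mathcal{H}$ consists of a finite vertex set $V(\mathcal{H})$ (of size $v(\mathcal{H})$) and a collection of $r$-subsets of $V(\mathcal{H})$ (its edges). For a family $\mathcal{F}$ of $r$-graphs, $\mathcal{H}$ is $\mathcal{F}$-free if it contains no member of $\mathcal{F}$ as a (not necessarily induced) subgraph. A family is hereditary if it contains all subgraphs of each of its members. $\mathcal{F}$ is nondegenerate if its Turán density $\pi(\mathcal{F})=\lim_{n\to\infty}\mathrm{ex}(n,\mathcal{F})/\binom{n}{r}$ is positive, where $\mathrm{ex}(n,\mathcal{F})$ is the maximum number of edges of an $n$-vertex $\mathcal{F}$-free $r$-graph. For $T\subset V(\mathcal{H})$, $d_{\mathcal{H}}(T)$ is the number of edges containing $T$, and $L_{\mathcal{H}}(T)$ is the set of $(r-|T|)$-sets $e$ with $T\cup e\in\mathcal{H}$. $\|\mathcal{H}\|_{t,p}:=\sum_{T\in\binom{V(\mathcal{H})}{t}}d_{\mathcal{H}}(T)^p$. The $(t,p)$-degree of a vertex $v$ is $\|\mathcal{H}\|_{t,p}-\|\mathcal{H}-v\|_{t,p}$, where $\mathcal{H}-v$ is obtained by removing $v$ and all edges containing it; $\delta_{t,p}(\mathcal{H})$ is the minimum $(t,p)$-degree. $\mathrm{ex}_{t,p}(n,\mathcal{F})$ is the maximum of $\|\mathcal{H}\|_{t,p}$ over $n$-vertex $\mathcal{F}$-free $r$-graphs $\mathcal{H}$, and $\mathrm{exdeg}_{t,p}(n,\mathcal{F}):=(t+p(r-t))\cdot\mathrm{ex}_{t,p}(n,\mathcal{F})/n$.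 A homomorphism from $\mathcal{H}$ to $\mathcal{G}$ is a map $\phi:V(\mathcal{H})\to V(\mathcal{G})$ with $\phi(e)\in\mathcal{G}$ for all $e\in\mathcal{H}$; $\mathcal{H}$ is $\mathcal{G}$-colorable if one exists. $\hat{\mathcal{F}}\le_{\mathrm{hom}}\mathcal{F}$ means that for every $\hat F\in\hat{\mathcal{F}}$ there is $F\in\mathcal{F}$ that is $\hat F$-colorable. A blowup of $\mathcal{G}$ is obtained by replacing each vertex $i$ by a set $V_i$ (the $V_i$ pairwise disjoint) and each edge $\{i_1,\dots,i_r\}$ by the complete $r$-partite $r$-graph with parts $V_{i_1},\dots,V_{i_r}$. $\mathcal{F}$ is blowup-invariant if every blowup of every $\mathcal{F}$-free $r$-graph is $\mathcal{F}$-free. Two vertices $u,v$ are uncovered in $\mathcal{H}$ if no edge contains both, and equivalent if $L_{\mathcal{H}}(\{u\})=L_{\mathcal{H}}(\{v\})$; $\mathcal{H}$ is symmetrized if every two uncovered vertices are equivalent. Let $\mathfrak{H}$ be a hereditary family of $\mathcal{F}$-free $r$-graphs. - $\mathcal{F}$ is symmetrized-stable with respect to $\mathfrak{H}$ if every symmetrized $\mathcal{F}$-free $r$-graph is in $\mathfrak{H}$. - $\mathcal{F}$ is $(t,p)$-degree-stable with respect to $\mathfrak{H}$ if there exist $\varepsilon>0$ and $N_0$ such that every $\mathcal{F}$-free $r$-graph $\mathcal{H}$ on $n\ge N_0$ vertices with $\delta_{t,p}(\mathcal{H})\ge(1-\varepsilon)\mathrm{exdeg}_{t,p}(n,\mathcal{F})$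 is in $\mathfrak{H}$. - $\mathcal{F}$ is $(t,p)$-vertex-extendable with respect to $\mathfrak{H}$ if there exist $\varepsilon>0$ and $N_0$ such that for every $\mathcal{F}$-free $r$-graph $\mathcal{H}$ on $n\ge N_0$ vertices with $\delta_{t,p}(\mathcal{H})\ge(1-\varepsilon)\mathrm{exdeg}_{t,p}(n,\mathcal{F})$: if $\mathcal{H}-v\in\mathfrak{H}$ for some $v\in V(\mathcal{H})$, then $\mathcal{H}\in\mathfrak{H}$. *)

theory Defs
  imports Complex_Main "HOL-Library.Disjoint_Sets"
begin

datatype 'a hgraph = HGraph (verts: "'a set") (edges: "'a set set")

definition rgraph :: "nat \<Rightarrow> 'a hgraph \<Rightarrow> bool" where
  "rgraph r H \<longleftrightarrow> finite (verts H) \<and> (\<forall>e\<in>edges H. e \<subseteq> verts H \<and> card e = r)"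

definition order_of :: "'a hgraph \<Rightarrow> nat" where
  "order_of H = card (verts H)"

definition homomorphism :: "('a \<Rightarrow> 'b) \<Rightarrow> 'a hgraph \<Rightarrow> 'b hgraph \<Rightarrow> bool" where
  "homomorphism \<phi> H G \<longleftrightarrow> \<phi> ` verts H \<subseteq> verts G \<and> (\<forall>e\<in>edges H. \<phi> ` e \<in> edges G)"

definition colorable :: "'a hgraph \<Rightarrow> 'b hgraph \<Rightarrow> bool" where
  "colorable H G \<longleftrightarrow> (\<exists>\<phi>. homomorphism \<phi> H G)"

text \<open>As usual, graphs are regarded up to isomorphism when speaking of subgraphs: a graph
  contains another one if some isomorphic copy of the latter is a (not necessarily induced)
  subgraph of it.\<close>

definition contains :: "'a hgraph \<Rightarrow> 'b hgraph \<Rightarrow> bool" where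
  "contains H F \<longleftrightarrow> (\<exists>\<phi>. inj_on \<phi> (verts F) \<and> homomorphism \<phi> F H)"

definition free :: "'b hgraph set \<Rightarrow> 'a hgraph \<Rightarrow> bool" where
  "free \<F> H \<longleftrightarrow> (\<forall>F\<in>\<F>. \<not> contains H F)"

text \<open>Since \<^const>\<open>contains\<close> is up to isomorphism, hereditary families are closed under
  isomorphism.\<close>

definition hereditary :: "nat \<Rightarrow> 'a hgraph set \<Rightarrow> bool" where
  "hereditary r \<HH> \<longleftrightarrow> (\<forall>G\<in>\<HH>. \<forall>H. rgraph r H \<and> contains G H \<longrightarrow> H \<in> \<HH>)"

definition hom_le :: "'a hgraph set \<Rightarrow> 'b hgraph set \<Rightarrow> bool" (infix "\<le>hom" 50) where
  "\<F>' \<le>hom \<F> \<longleftrightarrow> (\<forall>F'\<in>\<F>'. \<exists>F\<in>\<F>. colorable F F')"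

definition degree :: "'a hgraph \<Rightarrow> 'a set \<Rightarrow> nat" where
  "degree H T = card {e \<in> edges H. T \<subseteq> e}"

definition link :: "nat \<Rightarrow> 'a hgraph \<Rightarrow> 'a set \<Rightarrow> 'a set set" where
  "link r H T = {e. card e = r - card T \<and> T \<union> e \<in> edges H}"

definition remove_vertex :: "'a hgraph \<Rightarrow> 'a \<Rightarrow> 'a hgraph" where
  "remove_vertex H v = HGraph (verts H - {v}) {e \<in> edges H. v \<notin> e}"

definition tp_norm :: "nat \<Rightarrow> real \<Rightarrow> 'a hgraph \<Rightarrow> real" where
  "tp_norm t p H = (\<Sum>T | T \<subseteq> verts H \<and> card T = t. real (degree H T) powr p)"

definition tp_degree :: "nat \<Rightarrow> real \<Rightarrow> 'a hgraph \<Rightarrow> 'a \<Rightarrow> real" where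
  "tp_degree t p H v = tp_norm t p H - tp_norm t p (remove_vertex H v)"

definition min_tp_degree :: "nat \<Rightarrow> real \<Rightarrow> 'a hgraph \<Rightarrow> real" where
  "min_tp_degree t p H = Min (tp_degree t p H ` verts H)"

text \<open>Vertices of the graphs being maximised over, and of the members of the families, are
  natural numbers, so that every finite graph occurs up to isomorphism.
  If no graph on \<open>n\<close> vertices is free (which requires an edgeless forbidden graph), the
  maximum is over the empty set and hence an unspecified constant independent of \<open>n\<close>; this
  still makes the Turan density zero when \<open>r \<ge> 1\<close>, so it never occurs for nondegenerate families.\<close>

definition turan_number :: "nat \<Rightarrow> nat \<Rightarrow> nat hgraph set \<Rightarrow> nat" where
  "turan_number r n \<F> =
     Max ((\<lambda>H. card (edges H)) ` {H :: nat hgraph. rgraph r H \<and> order_of H = n \<and> free \<F> H})"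

definition turan_density :: "nat \<Rightarrow> nat hgraph set \<Rightarrow> real" where
  "turan_density r \<F> = lim (\<lambda>n. real (turan_number r n \<F>) / real (n choose r))"

definition nondegenerate :: "nat \<Rightarrow> nat hgraph set \<Rightarrow> bool" where
  "nondegenerate r \<F> \<longleftrightarrow> turan_density r \<F> > 0"

definition ex_tp :: "nat \<Rightarrow> nat \<Rightarrow> real \<Rightarrow> nat \<Rightarrow> nat hgraph set \<Rightarrow> real" where
  "ex_tp r t p n \<F> =
     Max (tp_norm t p ` {H :: nat hgraph. rgraph r H \<and> order_of H = n \<and> free \<F> H})"

definition exdeg_tp :: "nat \<Rightarrow> nat \<Rightarrow> real \<Rightarrow> nat \<Rightarrow> nat hgraph set \<Rightarrow> real" where
  "exdeg_tp r t p n \<F> = (real t + p * (real r - real t)) * ex_tp r t p n \<F> / real n"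

definition blowup :: "'a hgraph \<Rightarrow> ('a \<Rightarrow> 'b set) \<Rightarrow> 'b hgraph" where
  "blowup G W = HGraph (\<Union>i\<in>verts G. W i)
     {e. \<exists>f\<in>edges G. e \<subseteq> (\<Union>i\<in>f. W i) \<and> (\<forall>i\<in>f. card (e \<inter> W i) = 1)}"

definition blowup_invariant :: "nat \<Rightarrow> nat hgraph set \<Rightarrow> bool" where
  "blowup_invariant r \<F> \<longleftrightarrow>
     (\<forall>(G :: nat hgraph) (W :: nat \<Rightarrow> nat set).
        rgraph r G \<and> free \<F> G \<and> (\<forall>i\<in>verts G. finite (W i)) \<and> disjoint_family_on W (verts G)
        \<longrightarrow> free \<F> (blowup G W))"

definition uncovered :: "'a hgraph \<Rightarrow> 'a \<Rightarrow> 'a \<Rightarrow> bool" where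
  "uncovered H u v \<longleftrightarrow> \<not> (\<exists>e\<in>edges H. u \<in> e \<and> v \<in> e)"

definition equivalent_vertices :: "nat \<Rightarrow> 'a hgraph \<Rightarrow> 'a \<Rightarrow> 'a \<Rightarrow> bool" where
  "equivalent_vertices r H u v \<longleftrightarrow> link r H {u} = link r H {v}"

definition symmetrized :: "nat \<Rightarrow> 'a hgraph \<Rightarrow> bool" where
  "symmetrized r H \<longleftrightarrow>
     (\<forall>u\<in>verts H. \<forall>v\<in>verts H. u \<noteq> v \<and> uncovered H u v \<longrightarrow> equivalent_vertices r H u v)"

definition symmetrized_stable :: "nat \<Rightarrow> nat hgraph set \<Rightarrow> nat hgraph set \<Rightarrow> bool" where
  "symmetrized_stable r \<F> \<HH> \<longleftrightarrow>
     (\<forall>H. rgraph r H \<and> free \<F> H \<and> symmetrized r H \<longrightarrow> H \<in> \<HH>)"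

definition degree_stable ::
  "nat \<Rightarrow> nat \<Rightarrow> real \<Rightarrow> nat hgraph set \<Rightarrow> nat hgraph set \<Rightarrow> bool" where
  "degree_stable r t p \<F> \<HH> \<longleftrightarrow>
     (\<exists>\<epsilon>>0. \<exists>N0. \<forall>H. rgraph r H \<and> free \<F> H \<and> order_of H \<ge> N0
        \<and> min_tp_degree t p H \<ge> (1 - \<epsilon>) * exdeg_tp r t p (order_of H) \<F>
        \<longrightarrow> H \<in> \<HH>)"

definition vertex_extendable ::
  "nat \<Rightarrow> nat \<Rightarrow> real \<Rightarrow> nat hgraph set \<Rightarrow> nat hgraph set \<Rightarrow> bool" where
  "vertex_extendable r t p \<F> \<HH> \<longleftrightarrow>
     (\<exists>\<epsilon>>0. \<exists>N0. \<forall>H. rgraph r H \<and> free \<F> H \<and> order_of H \<ge> N0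
        \<and> min_tp_degree t p H \<ge> (1 - \<epsilon>) * exdeg_tp r t p (order_of H) \<F>
        \<longrightarrow> (\<exists>v\<in>verts H. remove_vertex H v \<in> \<HH>) \<longrightarrow> H \<in> \<HH>)"

text \<open>There are infinitely many \<open>n\<close>-vertex graphs on natural numbers, but they realise only
  finitely many values of the functionals above, so the maxima are genuine.\<close>

lemma card_edges_le:
  assumes "rgraph r H"
  shows "finite (edges H)" "card (edges H) \<le> order_of H choose r"
proof -
  have sub: "edges H \<subseteq> {e. e \<subseteq> verts H \<and> card e = r}" and fin: "finite (verts H)"
    using assms by (auto simp: rgraph_def)
  have fin': "finite {e. e \<subseteq> verts H \<and> card e = r}" using fin by simp
  show "finite (edges H)" using finite_subset[OF sub fin'] .
  show "card (edges H) \<le> order_of H choose r"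
    using card_mono[OF fin' sub] n_subsets[OF fin] by (simp add: order_of_def)
qed

lemma finite_card_edges_values:
  "finite ((\<lambda>H. card (edges H)) ` {H. rgraph r H \<and> order_of H = n \<and> P H})"
  by (rule finite_subset[of _ "{..n choose r}"]) (auto dest: card_edges_le(2))

lemma finite_tp_norm_values:
  "finite (tp_norm t p ` {H. rgraph r H \<and> order_of H = n \<and> P H})"
proof (rule finite_subset)
  let ?B = "n choose r" and ?M = "n choose t"
  let ?g = "\<lambda>c. \<Sum>k\<le>?B. real (c k) * real k powr p"
  show "finite (?g ` ({..?B} \<rightarrow>\<^sub>E {..?M}))"
    by (intro finite_imageI finite_PiE) auto
  show "tp_norm t p ` {H. rgraph r H \<and> order_of H = n \<and> P H} \<subseteq> ?g ` ({..?B} \<rightarrow>\<^sub>E {..?M})"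
  proof (rule image_subsetI)
    fix H :: "'a hgraph" assume "H \<in> {H. rgraph r H \<and> order_of H = n \<and> P H}"
    then have H: "rgraph r H" and n: "order_of H = n" by auto
    let ?S = "{T. T \<subseteq> verts H \<and> card T = t}"
    have fin: "finite (verts H)" using H by (simp add: rgraph_def)
    then have finS: "finite ?S" by simp
    have cS: "card ?S = ?M" using n_subsets[OF fin] n by (simp add: order_of_def)
    have dB: "degree H T \<le> ?B" for T
    proof -
      have "degree H T \<le> card (edges H)"
        unfolding degree_def by (rule card_mono) (use card_edges_le(1)[OF H] in auto)
      then show ?thesis using card_edges_le(2)[OF H] n by simp
    qed
    define c where "c = restrict (\<lambda>k. card {T \<in> ?S. degree H T = k}) {..?B}"
    have "c \<in> {..?B} \<rightarrow>\<^sub>E {..?M}"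
    proof -
      have "card {T \<in> ?S. degree H T = k} \<le> card ?S" for k
        by (rule card_mono[OF finS]) auto
      then show ?thesis using cS by (auto simp: c_def)
    qed
    moreover have "tp_norm t p H = ?g c"
    proof -
      have "tp_norm t p H = (\<Sum>k\<le>?B. \<Sum>T\<in>{T \<in> ?S. degree H T = k}. real (degree H T) powr p)"
        unfolding tp_norm_def by (rule sum.group[symmetric]) (use finS dB in auto)
      also have "\<dots> = ?g c"
        by (rule sum.cong) (auto simp: c_def)
      finally show ?thesis .
    qed
    ultimately show "tp_norm t p H \<in> ?g ` ({..?B} \<rightarrow>\<^sub>E {..?M})" by blast
  qed
qed

end

theory Submission
  imports Defs "HOL-Analysis.Elementary_Metric_Spaces" "HOL-Analysis.Convex" "HOL-Combinatorics.Transposition"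
begin

text \<open>Normalise the norm of an \<open>n\<close>-vertex graph by that of the complete \<open>r\<close>-graph. By Jensen's
  inequality deleting an average vertex does not decrease this density, so the extremal densities
  decrease to a limit, and the degrees sum to at most \<open>t + p (r - t)\<close> times the norm.

  Zykov symmetrization turns every \<open>\<F>'\<close>-free graph into a symmetrized one one vertex at a time
  without decreasing the norm; this gives the formula for the extremal number. Going backwards, a
  graph and its symmetrization step agree outside one vertex, and a graph of almost extremal norm has
  few vertices of low degree; so an induced member of \<open>\<HH>\<close> missing few vertices survives each step:
  all vertices of high degree can be added back by vertex extendability. Hence almost extremal
  \<open>\<F>'\<close>-free graphs are close to \<open>\<HH>\<close>.

  An \<open>\<F>\<close>-free graph need not be \<open>\<F>'\<close>-free, but by supersaturation almost all its induced subgraphs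
  on \<open>m\<close> vertices are, because \<open>\<F>' \<le>hom \<F>\<close>. Deleting vertices greedily, keeping the density large
  and the proportion of bad \<open>m\<close>-sets small, leads to an \<open>m\<close>-vertex induced subgraph that is
  \<open>\<F>'\<close>-free and hence close to \<open>\<HH>\<close>; adding the vertices back in reverse order preserves closeness.
  When the minimum degree is large, no vertex has low degree, and the graph itself is in \<open>\<HH>\<close>.\<close>

subsection \<open>Induced subgraphs\<close>

text \<open>Both backward chains, through clonings and through deletions, are unboundedly long, so
  an error growing at each step would be fatal. The order of quantifiers in \<open>bootstrap\<close>
  prevents this: extendability fixes one radius \<open>\<gamma>0\<close>, and for every target
  \<open>\<gamma>\<close> closeness within \<open>\<gamma>0\<close> already gives closeness within
  \<open>\<gamma>\<close> once the density is nearly extremal. A single step costs one vertex, which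
  in a large graph leads from radius at most \<open>\<gamma>0 / 2\<close> to at most
  \<open>\<gamma>0\<close>, and the error is reset before the next step. This needs near-extremality
  all along each chain. Cloning keeps the norm from falling. Deletion does so for the density only
  on average, and the same deleted vertex has to control the proportion of bad
  \<open>m\<close>-sets, so both are merged into one potential. The chain stops at a constant order
  \<open>m\<close>, where a set is either bad or not, and a large potential rules out the bad ones.
  Members of \<open>\<HH>\<close> are free of both families, so the limiting densities satisfy
  \<open>L' \<le> L\<close>; hence density near \<open>L\<close> suffices for the stability of
  \<open>\<F>'\<close> at the end of the chain.\<close>

definition induced :: "'a hgraph \<Rightarrow> 'a set \<Rightarrow> 'a hgraph" where
  "induced H X = HGraph X {e \<in> edges H. e \<subseteq> X}"

lemma verts_induced [simp]: "verts (induced H X) = X"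
  and edges_induced [simp]: "edges (induced H X) = {e \<in> edges H. e \<subseteq> X}"
  by (simp_all add: induced_def)

lemma rgraphD:
  assumes "rgraph r H"
  shows "finite (verts H)" "finite (edges H)" "e \<in> edges H \<Longrightarrow> e \<subseteq> verts H"
    "e \<in> edges H \<Longrightarrow> card e = r" "e \<in> edges H \<Longrightarrow> finite e"
  using assms card_edges_le(1)[OF assms] by (auto simp: rgraph_def intro: finite_subset)

lemma rgraph_induced:
  assumes "rgraph r H" "X \<subseteq> verts H"
  shows "rgraph r (induced H X)"
  using assms by (auto simp: rgraph_def intro: finite_subset)

lemma remove_vertex_eq_induced:
  assumes "rgraph r H"
  shows "remove_vertex H v = induced H (verts H - {v})"
  using assms by (auto simp: remove_vertex_def induced_def rgraph_def)

lemma induced_induced: "X \<subseteq> Y \<Longrightarrow> induced (induced H Y) X = induced H X"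
  by (auto simp: induced_def)

lemma induced_verts: "rgraph r H \<Longrightarrow> induced H (verts H) = H"
  by (cases H) (auto simp: induced_def rgraph_def)

lemma remove_vertex_induced:
  assumes "rgraph r H" "X \<subseteq> verts H"
  shows "remove_vertex (induced H X) v = induced H (X - {v})"
  using remove_vertex_eq_induced[OF rgraph_induced[OF assms]]
  by (simp add: induced_induced)

lemma contains_subgraph:
  assumes "verts G \<subseteq> verts H" "edges G \<subseteq> edges H"
  shows "contains H G"
  unfolding contains_def homomorphism_def using assms by (intro exI[of _ "\<lambda>x. x"]) auto

lemma contains_trans:
  assumes "rgraph r F" "contains H G" "contains G F"
  shows "contains H F"
proof -
  obtain f g where f: "inj_on f (verts G)" "homomorphism f G H"
    and g: "inj_on g (verts F)" "homomorphism g F G"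
    using assms by (auto simp: contains_def)
  have "inj_on (f \<circ> g) (verts F)"
    using f g by (intro comp_inj_on) (auto simp: homomorphism_def intro: inj_on_subset)
  moreover have "homomorphism (f \<circ> g) F H"
    using f(2) g(2) unfolding homomorphism_def image_comp[symmetric] by blast
  ultimately show ?thesis by (auto simp: contains_def)
qed

lemma free_subgraph:
  assumes "\<forall>F\<in>\<F>. rgraph r F" "free \<F> H" "contains H G"
  shows "free \<F> G"
  using assms contains_trans by (fastforce simp: free_def)

lemma free_induced:
  assumes "\<forall>F\<in>\<F>. rgraph r F" "free \<F> H" "X \<subseteq> verts H"
  shows "free \<F> (induced H X)"
  by (rule free_subgraph[OF assms(1,2)], rule contains_subgraph) (use assms(3) in auto)

lemma hereditary_subgraph:
  assumes "hereditary r \<HH>" "G \<in> \<HH>" "rgraph r H" "verts H \<subseteq> verts G" "edges H \<subseteq> edges G"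
  shows "H \<in> \<HH>"
  using assms contains_subgraph by (fastforce simp: hereditary_def)

lemma hereditary_induced:
  assumes "hereditary r \<HH>" "rgraph r H" "induced H Y \<in> \<HH>" "X \<subseteq> Y" "X \<subseteq> verts H"
  shows "induced H X \<in> \<HH>"
  by (rule hereditary_subgraph[OF assms(1,3)]) (use assms in \<open>auto intro: rgraph_induced\<close>)


subsection \<open>Counting\<close>

lemma card_supersets_le:
  assumes "finite V" "B \<subseteq> V" "card B \<le> k"
  shows "card {e. e \<subseteq> V \<and> card e = k \<and> B \<subseteq> e} \<le> (card V - card B) choose (k - card B)"
proof -
  have fB: "finite B" using assms finite_subset by blast
  have "card {e. e \<subseteq> V \<and> card e = k \<and> B \<subseteq> e} \<le> card {e. e \<subseteq> V - B \<and> card e = k - card B}"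
  proof (rule card_inj_on_le[where f = "\<lambda>e. e - B"])
    show "inj_on (\<lambda>e. e - B) {e. e \<subseteq> V \<and> card e = k \<and> B \<subseteq> e}"
      by (rule inj_onI) blast
    show "(\<lambda>e. e - B) ` {e. e \<subseteq> V \<and> card e = k \<and> B \<subseteq> e} \<subseteq> {e. e \<subseteq> V - B \<and> card e = k - card B}"
      using fB by (auto simp: card_Diff_subset)
    show "finite {e. e \<subseteq> V - B \<and> card e = k - card B}"
      using assms by simp
  qed
  also have "\<dots> = (card V - card B) choose (k - card B)"
    using assms fB by (subst n_subsets) (auto simp: card_Diff_subset)
  finally show ?thesis .
qed

lemma choose_le_power: "n choose k \<le> n ^ k"
  by (cases "k \<le> n") (auto simp: binomial_le_pow binomial_eq_0)

lemma degree_le: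
  assumes "rgraph r H" "T \<subseteq> verts H" "card T \<le> r"
  shows "degree H T \<le> (order_of H - card T) choose (r - card T)"
proof -
  have "degree H T \<le> card {e. e \<subseteq> verts H \<and> card e = r \<and> T \<subseteq> e}"
    unfolding degree_def using rgraphD[OF assms(1)] by (intro card_mono) auto
  with card_supersets_le[OF rgraphD(1)[OF assms(1)] assms(2,3)] show ?thesis
    by (simp add: order_of_def)
qed

lemma degree_le_power:
  assumes "rgraph r H" "card T \<le> r"
  shows "degree H T \<le> order_of H ^ (r - card T)"
proof (cases "T \<subseteq> verts H")
  case True
  have "degree H T \<le> (order_of H - card T) ^ (r - card T)"
    using degree_le[OF assms(1) True assms(2)] choose_le_power le_trans by blast
  also have "\<dots> \<le> order_of H ^ (r - card T)" by (intro power_mono) auto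
  finally show ?thesis .
next
  case False
  then have no: "{e \<in> edges H. T \<subseteq> e} = {}" using rgraphD(3)[OF assms(1)] by blast
  show ?thesis unfolding degree_def no by simp
qed

text \<open>Each of the \<open>s\<close> factors of the falling factorial satisfies
  \<open>(k - a - i) / k \<le> (n - a - i) / n\<close>. Multiplying out the denominators keeps the
  claim meaningful for truncated subtraction and for \<open>k = 0\<close>. It bounds both binomials
  in \<open>complete_norm_ratio\<close>, with \<open>a = 0\<close> and \<open>a = t\<close>.\<close>

lemma choose_ratio:
  fixes k n a s :: nat
  assumes "k \<le> n"
  shows "((k - a) choose s) * n ^ s \<le> ((n - a) choose s) * k ^ s"
proof (induction s)
  case (Suc s)
  have step: "Suc s * (m choose Suc s) = (m choose s) * (m - s)" for m
    by (metis binomial_absorption binomial_absorb_comp mult.commute)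
  have "(k - a - s) * n \<le> (n - a - s) * k"
  proof (cases "a + s \<le> k")
    case True
    then have "(a + s) * k \<le> (a + s) * n" using assms by simp
    then have "int (k - (a + s)) * int n \<le> int (n - (a + s)) * int k"
      using True assms by (simp add: of_nat_diff algebra_simps flip: of_nat_mult of_nat_add)
    then have "(k - (a + s)) * n \<le> (n - (a + s)) * k"
      by (simp flip: of_nat_mult)
    then show ?thesis by simp
  qed simp
  then have "((k - a) choose s) * n ^ s * ((k - a - s) * n) \<le> ((n - a) choose s) * k ^ s * ((n - a - s) * k)"
    using Suc by (rule mult_le_mono[rotated])
  then have "(Suc s * ((k - a) choose Suc s)) * n ^ Suc s \<le> (Suc s * ((n - a) choose Suc s)) * k ^ Suc s"
    unfolding step by (simp add: mult_ac)
  then show ?case unfolding mult.assoc by (simp only: Suc_mult_le_cancel1)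
qed simp

lemma sum_card_swap:
  assumes "finite A" "finite B"
  shows "(\<Sum>x\<in>A. card {y\<in>B. R x y}) = (\<Sum>y\<in>B. card {x\<in>A. R x y})"
  using sum.swap_restrict[OF assms, of "\<lambda>_ _. 1::nat" R] by simp


subsection \<open>Convexity of powers\<close>

text \<open>The derivative of \<open>x powr p\<close> up to the factor \<open>p\<close>. The case \<open>p = 1\<close> is separate
  because \<open>0 powr 0 = 0\<close>.\<close>

definition slope :: "real \<Rightarrow> real \<Rightarrow> real" where
  "slope p x = (if p = 1 then 1 else x powr (p - 1))"

lemma slope_nonneg: "0 \<le> slope p x"
  by (simp add: slope_def)

lemma slope_le: "1 \<le> p \<Longrightarrow> 0 \<le> x \<Longrightarrow> x \<le> y \<Longrightarrow> 0 < y \<Longrightarrow> slope p x \<le> y powr (p - 1)"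
  by (auto simp: slope_def intro: powr_mono2)

lemma slope_mult: "0 \<le> x \<Longrightarrow> 0 < y \<Longrightarrow> slope p (y * x) = y powr (p - 1) * slope p x"
  by (auto simp: slope_def powr_mult)

text \<open>Divided by \<open>a powr p\<close> this is Bernoulli's inequality
  \<open>1 + p * (y - 1) \<le> y powr p\<close> at \<open>y = x / a\<close>, which comes from
  weighted AM-GM for \<open>y powr p\<close> and \<open>1\<close> with weights \<open>1 / p\<close>
  and \<open>1 - 1 / p\<close>. Every use of convexity below rests on it.\<close>

lemma powr_tangent:
  fixes x a p :: real
  assumes "1 \<le> p" "0 \<le> x" "0 \<le> a"
  shows "a powr p + p * slope p a * (x - a) \<le> x powr p"
proof (cases "p = 1 \<or> a = 0")
  case True
  then show ?thesis using assms by (auto simp: slope_def)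
next
  case False
  then have a: "a > 0" and p: "p > 1" using assms by auto
  have ap: "a powr p = a * a powr (p - 1)" using a by (simp add: powr_diff)
  have main: "1 + p * (y - 1) \<le> y powr p" if y: "y > 0" for y :: real
  proof -
    have "(y powr p) powr (1/p) * 1 powr (1 - 1/p) \<le> (1/p) * y powr p + (1 - 1/p) * 1"
      using p y by (intro Youngs_inequality_0) auto
    then have "y \<le> (1/p) * y powr p + (1 - 1/p)" using p y by (simp add: powr_powr)
    then have "p * y \<le> p * ((1/p) * y powr p + (1 - 1/p))" using p by (intro mult_left_mono) auto
    then have "p * y \<le> y powr p + p - 1" using p by (simp add: distrib_left right_diff_distrib)
    then show ?thesis by (simp add: algebra_simps)
  qed
  show ?thesis
  proof (cases "x = 0")
    case True
    have "a powr p - p * a powr (p-1) * a = a powr p * (1 - p)"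
      using ap by (simp add: algebra_simps)
    also have "\<dots> \<le> 0" using p by (simp add: mult_nonneg_nonpos)
    finally show ?thesis using True p by (simp add: slope_def)
  next
    case x: False
    have "a powr p * (1 + p * (x/a - 1)) \<le> a powr p * (x/a) powr p"
      using main[of "x/a"] x assms a by (intro mult_left_mono) auto
    also have "\<dots> = x powr p" using a assms by (simp add: powr_divide)
    also have "a powr p * (1 + p * (x/a - 1)) = a powr p + p * a powr (p - 1) * (x - a)"
      unfolding ap using a by (simp add: field_simps)
    finally show ?thesis using p by (simp add: slope_def)
  qed
qed

text \<open>\<open>slope\<close> is homogeneous of degree \<open>p - 1\<close>, so scaling by
  \<open>N\<close> reduces everything to \<open>[0, 1]\<close>, where compactness gives a modulus of
  continuity independent of \<open>N\<close>. For \<open>1 < p < 2\<close> there is no Lipschitz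
  bound near 0, hence the qualitative form.\<close>

lemma slope_uniform:
  assumes "1 \<le> p" "0 < \<omega>"
  shows "\<exists>\<gamma>>0. \<forall>N a s. 0 < N \<longrightarrow> 0 \<le> s \<longrightarrow> s \<le> a \<longrightarrow> a \<le> N \<longrightarrow> a - s \<le> \<gamma> * N
            \<longrightarrow> slope p a - slope p s \<le> \<omega> * N powr (p - 1)"
proof -
  have "continuous_on {0..1::real} (slope p)"
  proof (cases "p = 1")
    case False
    then have "slope p = (\<lambda>x. x powr (p - 1))" by (auto simp: slope_def)
    moreover have "p > 1" using False assms by simp
    ultimately show ?thesis
      by (simp add: continuous_on_powr' continuous_on_id continuous_on_const)
  qed (simp add: slope_def)
  then have "uniformly_continuous_on {0..1::real} (slope p)"
    by (intro compact_uniformly_continuous) auto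
  then obtain d where d: "d > 0"
    "\<And>x y. x \<in> {0..1} \<Longrightarrow> y \<in> {0..1} \<Longrightarrow> dist y x < d \<Longrightarrow> dist (slope p y) (slope p x) < \<omega>"
    using assms(2) unfolding uniformly_continuous_on_def by metis
  show ?thesis
  proof (intro exI[of _ "d/2"] conjI allI impI)
    show "d/2 > 0" using d by simp
    fix N a s :: real
    assume h: "0 < N" "0 \<le> s" "s \<le> a" "a \<le> N" "a - s \<le> d/2 * N"
    have "a/N - s/N \<le> d/2" using h by (simp add: field_simps)
    then have "dist (s/N) (a/N) < d" using h d(1) by (auto simp: dist_real_def abs_if field_simps)
    then have "dist (slope p (s/N)) (slope p (a/N)) < \<omega>"
      using h by (intro d(2)) auto
    then have "slope p (a/N) - slope p (s/N) \<le> \<omega>" by (auto simp: dist_real_def abs_if split: if_splits)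
    then have "N powr (p-1) * (slope p (a/N) - slope p (s/N)) \<le> N powr (p-1) * \<omega>"
      by (intro mult_left_mono) auto
    then show "slope p a - slope p s \<le> \<omega> * N powr (p - 1)"
      using slope_mult[of "a/N" N p] slope_mult[of "s/N" N p] h by (simp add: algebra_simps)
  qed
qed

lemma powr_jensen:
  fixes x :: "'a \<Rightarrow> real"
  assumes "1 \<le> p" "finite A" "A \<noteq> {}" "\<And>i. i \<in> A \<Longrightarrow> 0 \<le> x i"
  shows "real (card A) * ((\<Sum>i\<in>A. x i) / real (card A)) powr p \<le> (\<Sum>i\<in>A. x i powr p)"
proof -
  define a where "a = (\<Sum>i\<in>A. x i) / real (card A)"
  have cA: "real (card A) > 0" using assms by (simp add: card_gt_0_iff)
  have "0 \<le> a" unfolding a_def using assms by (auto intro!: divide_nonneg_nonneg sum_nonneg)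
  then have "(\<Sum>i\<in>A. a powr p + p * slope p a * (x i - a)) \<le> (\<Sum>i\<in>A. x i powr p)"
    using assms by (intro sum_mono powr_tangent) auto
  also have "(\<Sum>i\<in>A. a powr p + p * slope p a * (x i - a))
      = real (card A) * a powr p + p * slope p a * ((\<Sum>i\<in>A. x i) - real (card A) * a)"
    by (simp add: sum.distrib sum_subtractf flip: sum_distrib_left)
  also have "(\<Sum>i\<in>A. x i) - real (card A) * a = 0" using cA by (simp add: a_def)
  finally show ?thesis by (simp add: a_def)
qed


subsection \<open>The normalised norm\<close>

text \<open>Double counting: an edge containing \<open>T\<close> is avoided by exactly
  \<open>order_of H - r\<close> vertices, all of them outside \<open>T\<close>. With
  \<open>T = {}\<close> this also gives the averaging step for Turan numbers.\<close>

lemma sum_card_avoiding: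
  assumes "rgraph r H" "T \<subseteq> verts H"
  shows "(\<Sum>v\<in>verts H - T. card {e \<in> edges H. T \<subseteq> e \<and> v \<notin> e}) = (order_of H - r) * degree H T"
proof -
  have "(\<Sum>v\<in>verts H - T. card {e \<in> {e \<in> edges H. T \<subseteq> e}. v \<notin> e})
      = (\<Sum>e\<in>{e \<in> edges H. T \<subseteq> e}. card {v \<in> verts H - T. v \<notin> e})"
    using rgraphD[OF assms(1)] by (intro sum_card_swap) auto
  also have "\<dots> = (\<Sum>e\<in>{e \<in> edges H. T \<subseteq> e}. order_of H - r)"
  proof (rule sum.cong[OF refl])
    fix e assume e: "e \<in> {e \<in> edges H. T \<subseteq> e}"
    then have "{v \<in> verts H - T. v \<notin> e} = verts H - e" by auto
    then show "card {v \<in> verts H - T. v \<notin> e} = order_of H - r"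
      using e rgraphD[OF assms(1)] by (simp add: card_Diff_subset order_of_def)
  qed
  finally show ?thesis by (simp add: degree_def conj_assoc mult.commute)
qed

lemma sum_degree:
  assumes "rgraph r H"
  shows "(\<Sum>T | T \<subseteq> verts H \<and> card T = t. degree H T) = card (edges H) * (r choose t)"
proof -
  have "(\<Sum>T | T \<subseteq> verts H \<and> card T = t. card {e \<in> edges H. T \<subseteq> e})
     = (\<Sum>e\<in>edges H. card {T \<in> {T. T \<subseteq> verts H \<and> card T = t}. T \<subseteq> e})"
    using rgraphD[OF assms] by (intro sum_card_swap) auto
  also have "\<dots> = (\<Sum>e\<in>edges H. r choose t)"
  proof (rule sum.cong[OF refl])
    fix e assume e: "e \<in> edges H"
    then have "{T \<in> {T. T \<subseteq> verts H \<and> card T = t}. T \<subseteq> e} = {T. T \<subseteq> e \<and> card T = t}"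
      using rgraphD[OF assms] by blast
    then show "card {T \<in> {T. T \<subseteq> verts H \<and> card T = t}. T \<subseteq> e} = (r choose t)"
      using e rgraphD[OF assms] by (simp add: n_subsets)
  qed
  finally show ?thesis by (simp add: degree_def)
qed

locale tp_setting =
  fixes r t :: nat and p :: real
  assumes t_ge_1: "1 \<le> t" and t_less_r: "t < r" and p_ge_1: "1 \<le> p"
begin

text \<open>The \<open>(t,p)\<close>-norm of the complete \<open>r\<close>-graph on \<open>n\<close> vertices.\<close>

definition complete_norm :: "nat \<Rightarrow> real" where
  "complete_norm n = real (n choose t) * real ((n - t) choose (r - t)) powr p"

definition density :: "'a hgraph \<Rightarrow> real" where
  "density H = tp_norm t p H / complete_norm (order_of H)"

text \<open>The order of growth: \<open>complete_norm n\<close> is of order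
  \<open>n powr exponent\<close>. It is also the factor in \<open>exdeg_tp\<close>, which for a
  nondegenerate family is of order \<open>n powr (exponent - 1)\<close>.\<close>

definition exponent :: real where
  "exponent = real t + p * (real r - real t)"

definition ex_density :: "nat \<Rightarrow> nat hgraph set \<Rightarrow> real" where
  "ex_density n \<F> = ex_tp r t p n \<F> / complete_norm n"

lemma exponent_ge_1: "1 \<le> exponent"
proof -
  have "0 \<le> p * (real r - real t)" using p_ge_1 t_less_r by auto
  then show ?thesis using t_ge_1 by (simp add: exponent_def)
qed

lemma exponent_pos: "0 < exponent"
  using exponent_ge_1 by linarith

lemma exdeg_tp_eq: "exdeg_tp r t p n \<F> = exponent * ex_tp r t p n \<F> / real n"
  by (simp add: exdeg_tp_def exponent_def)

lemma complete_norm_pos: "r \<le> n \<Longrightarrow> 0 < complete_norm n"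
  using t_less_r by (simp add: complete_norm_def zero_less_binomial)

lemma complete_norm_nonneg: "0 \<le> complete_norm n"
  by (simp add: complete_norm_def)

lemma tp_norm_nonneg: "0 \<le> tp_norm t p H"
  by (simp add: tp_norm_def sum_nonneg)

lemma density_nonneg: "0 \<le> density H"
  by (simp add: density_def tp_norm_nonneg complete_norm_nonneg)

lemma tp_norm_eq: "r \<le> order_of H \<Longrightarrow> tp_norm t p H = density H * complete_norm (order_of H)"
  using complete_norm_pos[of "order_of H"] by (simp add: density_def)

lemma ex_tp_eq: "r \<le> n \<Longrightarrow> ex_tp r t p n \<F> = ex_density n \<F> * complete_norm n"
  using complete_norm_pos[of n] by (simp add: ex_density_def)

lemma card_t_subsets:
  assumes "rgraph r H"
  shows "card {T. T \<subseteq> verts H \<and> card T = t} = order_of H choose t"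
    "finite {T. T \<subseteq> verts H \<and> card T = t}"
  using rgraphD(1)[OF assms] by (simp_all add: n_subsets order_of_def)

lemma tp_norm_le_complete_norm:
  assumes "rgraph r H"
  shows "tp_norm t p H \<le> complete_norm (order_of H)"
proof -
  have "tp_norm t p H \<le> (\<Sum>T | T \<subseteq> verts H \<and> card T = t. real ((order_of H - t) choose (r - t)) powr p)"
    unfolding tp_norm_def
  proof (rule sum_mono)
    fix T assume "T \<in> {T. T \<subseteq> verts H \<and> card T = t}"
    then have "degree H T \<le> (order_of H - t) choose (r - t)"
      using degree_le[OF assms, of T] t_less_r by auto
    then show "real (degree H T) powr p \<le> real ((order_of H - t) choose (r - t)) powr p"
      using p_ge_1 by (intro powr_mono2) auto
  qed
  then show ?thesis using card_t_subsets[OF assms] by (simp add: complete_norm_def)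
qed

lemma density_le_1:
  assumes "rgraph r H"
  shows "density H \<le> 1"
  using tp_norm_le_complete_norm[OF assms] complete_norm_nonneg[of "order_of H"]
  unfolding density_def by (intro divide_le_eq_1[THEN iffD2]) (auto simp: less_le)

text \<open>The index set is that of the whole graph, since a \<open>t\<close>-set not inside
  \<open>X\<close> contributes \<open>0 powr p = 0\<close>. In this form the norms of different
  induced subgraphs can be compared summand by summand.\<close>

lemma tp_norm_induced:
  assumes "rgraph r H" "X \<subseteq> verts H"
  shows "tp_norm t p (induced H X)
    = (\<Sum>T | T \<subseteq> verts H \<and> card T = t. real (card {e \<in> edges H. T \<subseteq> e \<and> e \<subseteq> X}) powr p)"
  unfolding tp_norm_def
proof (rule sum.mono_neutral_cong_left)
  show "finite {T. T \<subseteq> verts H \<and> card T = t}" using card_t_subsets[OF assms(1)] by simp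
  show "{T. T \<subseteq> verts (induced H X) \<and> card T = t} \<subseteq> {T. T \<subseteq> verts H \<and> card T = t}"
    using assms by auto
  show "\<forall>T\<in>{T. T \<subseteq> verts H \<and> card T = t} - {T. T \<subseteq> verts (induced H X) \<and> card T = t}.
      real (card {e \<in> edges H. T \<subseteq> e \<and> e \<subseteq> X}) powr p = 0"
  proof
    fix T assume "T \<in> {T. T \<subseteq> verts H \<and> card T = t} - {T. T \<subseteq> verts (induced H X) \<and> card T = t}"
    then have "\<not> T \<subseteq> X" by auto
    then have no: "{e \<in> edges H. T \<subseteq> e \<and> e \<subseteq> X} = {}" by blast
    show "real (card {e \<in> edges H. T \<subseteq> e \<and> e \<subseteq> X}) powr p = 0" unfolding no by simp
  qed
  show "real (degree (induced H X) T) powr p = real (card {e \<in> edges H. T \<subseteq> e \<and> e \<subseteq> X}) powr p" for T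
    by (simp add: degree_def conj_commute conj_left_commute)
qed

text \<open>For a fixed \<open>T\<close>, deleting a vertex outside \<open>T\<close> leaves on
  average the fraction \<open>(n - r) / (n - t)\<close> of the edges containing \<open>T\<close>;
  Jensen over these \<open>n - t\<close> vertices bounds the sum of the powers from below.\<close>

lemma sum_tp_norm_remove:
  assumes H: "rgraph r H" and n: "r \<le> order_of H"
  shows "real (order_of H - t) * (real (order_of H - r) / real (order_of H - t)) powr p * tp_norm t p H
    \<le> (\<Sum>v\<in>verts H. tp_norm t p (induced H (verts H - {v})))"
proof -
  let ?n = "order_of H" and ?S = "{T. T \<subseteq> verts H \<and> card T = t}"
  let ?d = "\<lambda>T v. card {e \<in> edges H. T \<subseteq> e \<and> v \<notin> e}"
  have fin: "finite (verts H)" "finite ?S" using rgraphD[OF H] by auto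
  have norm: "tp_norm t p (induced H (verts H - {v})) = (\<Sum>T\<in>?S. real (?d T v) powr p)" for v
  proof -
    have "{e \<in> edges H. T \<subseteq> e \<and> e \<subseteq> verts H - {v}} = {e \<in> edges H. T \<subseteq> e \<and> v \<notin> e}" for T
      using rgraphD(3)[OF H] by blast
    then show ?thesis by (subst tp_norm_induced[OF H]) auto
  qed
  have "real (?n - t) * (real (?n - r) / real (?n - t)) powr p * tp_norm t p H
    = (\<Sum>T\<in>?S. real (?n - t) * (real (?n - r) / real (?n - t)) powr p * real (degree H T) powr p)"
    by (simp add: tp_norm_def sum_distrib_left)
  also have "\<dots> \<le> (\<Sum>T\<in>?S. \<Sum>v\<in>verts H. real (?d T v) powr p)"
  proof (rule sum_mono)
    fix T assume T: "T \<in> ?S"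
    have c: "card (verts H - T) = ?n - t"
      using T fin by (auto simp: card_Diff_subset order_of_def finite_subset)
    have "real (?n - t) * (real (?n - r) / real (?n - t)) powr p * real (degree H T) powr p
        = real (card (verts H - T)) * ((\<Sum>v\<in>verts H - T. real (?d T v)) / real (card (verts H - T))) powr p"
      using sum_card_avoiding[OF H, of T] T
      by (simp add: c powr_mult[symmetric] flip: of_nat_sum)
    also have "\<dots> \<le> (\<Sum>v\<in>verts H - T. real (?d T v) powr p)"
    proof (rule powr_jensen)
      show "verts H - T \<noteq> {}" using c n t_less_r by (metis card.empty diff_is_0_eq not_less order_less_le_trans)
    qed (use p_ge_1 fin in auto)
    also have "\<dots> \<le> (\<Sum>v\<in>verts H. real (?d T v) powr p)"
      using fin by (intro sum_mono2) auto
    finally show "real (?n - t) * (real (?n - r) / real (?n - t)) powr p * real (degree H T) powr p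
      \<le> (\<Sum>v\<in>verts H. real (?d T v) powr p)" .
  qed
  also have "\<dots> = (\<Sum>v\<in>verts H. \<Sum>T\<in>?S. real (?d T v) powr p)" by (rule sum.swap)
  finally show ?thesis by (simp add: norm)
qed

text \<open>In the complete graph all degrees agree and Jensen is sharp, so this is the equality
  case of \<open>sum_tp_norm_remove\<close>. Dividing one by the other cancels the factor, which is
  why the density does not drop on average under deletion.\<close>

lemma complete_norm_pred:
  assumes "r < n"
  shows "real n * complete_norm (n - 1)
    = real (n - t) * (real (n - r) / real (n - t)) powr p * complete_norm n"
proof -
  have a: "real n * real ((n - 1) choose t) = real (n - t) * real (n choose t)"
    using binomial_absorb_comp[of n t] by (simp flip: of_nat_mult)
  have "(n - t - (r - t)) * ((n - t) choose (r - t)) = (n - t) * ((n - t - 1) choose (r - t))"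
    by (rule binomial_absorb_comp)
  then have "real (n - r) * real ((n - t) choose (r - t)) = real (n - t) * real ((n - 1 - t) choose (r - t))"
    using t_less_r by (simp add: diff_right_commute flip: of_nat_mult)
  then have b: "real ((n - 1 - t) choose (r - t)) = real (n - r) / real (n - t) * real ((n - t) choose (r - t))"
    using assms t_less_r by (simp add: field_simps)
  have "real n * complete_norm (n - 1) = (real n * real ((n - 1) choose t))
      * ((real (n - r) / real (n - t)) powr p * real ((n - t) choose (r - t)) powr p)"
    unfolding complete_norm_def b by (subst powr_mult) simp_all
  then show ?thesis unfolding a complete_norm_def by simp
qed

lemma sum_density_remove:
  assumes H: "rgraph r H" and n: "r < order_of H"
  shows "real (order_of H) * density H \<le> (\<Sum>v\<in>verts H. density (induced H (verts H - {v})))"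
proof -
  let ?n = "order_of H"
  have o: "order_of (induced H (verts H - {v})) = ?n - 1" if "v \<in> verts H" for v
    using that by (simp add: order_of_def)
  have pos: "complete_norm (?n - 1) > 0" "complete_norm ?n > 0"
    using n by (auto intro!: complete_norm_pos)
  have "real ?n * density H * complete_norm (?n - 1)
      = real (?n - t) * (real (?n - r) / real (?n - t)) powr p * complete_norm ?n * density H"
    using complete_norm_pred[OF n] by (simp add: mult_ac)
  also have "\<dots> = real (?n - t) * (real (?n - r) / real (?n - t)) powr p * tp_norm t p H"
    using n by (simp add: tp_norm_eq)
  also have "\<dots> \<le> (\<Sum>v\<in>verts H. tp_norm t p (induced H (verts H - {v})))"
    using sum_tp_norm_remove[OF H] n by simp
  also have "\<dots> = (\<Sum>v\<in>verts H. density (induced H (verts H - {v}))) * complete_norm (?n - 1)"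
    unfolding sum_distrib_right by (rule sum.cong) (use o pos in \<open>auto simp: density_def\<close>)
  finally show ?thesis using pos by simp
qed

text \<open>Bernoulli's inequality at \<open>(n - r) / (n - t)\<close> turns the factor of
  \<open>sum_tp_norm_remove\<close> into \<open>n - exponent\<close>. Consequently
  \<open>exdeg_tp\<close> bounds the average degree of an extremal graph, and a minimum degree near
  it forces a nearly extremal norm.\<close>

lemma sum_tp_degree_le:
  assumes H: "rgraph r H" and n: "r \<le> order_of H"
  shows "(\<Sum>v\<in>verts H. tp_degree t p H v) \<le> exponent * tp_norm t p H"
proof -
  let ?n = "order_of H"
  let ?q = "real (?n - r) / real (?n - t)"
  have nt: "real (?n - t) > 0" using n t_less_r by simp
  have "1 powr p + p * slope p 1 * (?q - 1) \<le> ?q powr p"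
    using p_ge_1 by (intro powr_tangent) auto
  then have "1 + p * (?q - 1) \<le> ?q powr p" by (cases "p = 1") (simp_all add: slope_def)
  then have "real (?n - t) * (1 + p * (?q - 1)) \<le> real (?n - t) * ?q powr p"
    using nt by (intro mult_left_mono) auto
  moreover have "real (?n - t) * (1 + p * (?q - 1)) = real (?n - t) + p * (real (?n - r) - real (?n - t))"
    using nt by (simp add: field_simps)
  moreover have "\<dots> = real ?n - exponent"
    using n t_less_r by (simp add: exponent_def of_nat_diff algebra_simps)
  ultimately have "(real ?n - exponent) * tp_norm t p H \<le> real (?n - t) * ?q powr p * tp_norm t p H"
    using tp_norm_nonneg by (intro mult_right_mono) auto
  also have "\<dots> \<le> (\<Sum>v\<in>verts H. tp_norm t p (induced H (verts H - {v})))"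
    using sum_tp_norm_remove[OF H n] .
  finally have "real ?n * tp_norm t p H - (\<Sum>v\<in>verts H. tp_norm t p (induced H (verts H - {v})))
      \<le> exponent * tp_norm t p H" by (simp add: algebra_simps)
  then show ?thesis
    by (simp add: tp_degree_def sum_subtractf order_of_def remove_vertex_eq_induced[OF H])
qed

section \<open>Growth of the complete norm\<close>

lemma complete_norm_ratio:
  assumes "k \<le> n" "0 < n"
  shows "complete_norm k \<le> (real k / real n) powr exponent * complete_norm n"
proof -
  have ratio: "real ((k - a) choose s) \<le> (real k / real n) ^ s * real ((n - a) choose s)" for a s
    using choose_ratio[OF assms(1), of a s] assms(2)
    by (simp add: power_divide field_simps flip: of_nat_mult of_nat_power)
  show ?thesis
  proof (cases "k = 0")
    case True
    moreover have "0 < t" using t_ge_1 by simp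
    ultimately show ?thesis by (simp add: complete_norm_def binomial_eq_0)
  next
    case False
    define q where "q = real k / real n"
    have q: "q > 0" using False assms by (simp add: q_def)
    have "complete_norm k \<le> (q ^ t * real (n choose t)) * (q ^ (r - t) * real ((n - t) choose (r - t))) powr p"
      unfolding complete_norm_def q_def
      using ratio[of 0 t] ratio[of t "r - t"] p_ge_1
      by (intro mult_mono powr_mono2) auto
    also have "\<dots> = (q ^ t * (q ^ (r - t)) powr p) * complete_norm n"
      using q by (simp add: complete_norm_def powr_mult mult_ac)
    also have "q ^ t * (q ^ (r - t)) powr p = q powr exponent"
      using q t_less_r
      by (simp add: exponent_def powr_add powr_powr of_nat_diff mult.commute flip: powr_realpow)
    finally show ?thesis by (simp add: q_def)
  qed
qed

lemma complete_norm_lower: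
  "\<exists>c>0. \<forall>n\<ge>2 * r. c * real n powr exponent \<le> complete_norm n"
proof (intro exI conjI allI impI)
  \<comment> \<open>For \<open>n \<ge> 2 * r\<close> one has \<open>n - t \<ge> n / 2\<close>,
    whence the \<open>2\<close> in the second factor.\<close>
  let ?c = "(1 / real t) ^ t * ((1 / (2 * real r)) ^ (r - t)) powr p"
  show "0 < ?c" using t_ge_1 t_less_r by simp
  fix n assume n: "2 * r \<le> n"
  have n0: "0 < n" using n t_less_r by simp
  have "(real n / real t) ^ t \<le> real (n choose t)"
    using n t_less_r binomial_ge_n_over_k_pow_k[of t n, where 'a = real] by simp
  moreover have "(real n / (2 * real r)) ^ (r - t) \<le> real ((n - t) choose (r - t))"
  proof -
    have "(real n / (2 * real r)) ^ (r - t) \<le> (real (n - t) / real (r - t)) ^ (r - t)"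
    proof (intro power_mono)
      have "real n / 2 \<le> real (n - t)" using n t_less_r by (simp add: of_nat_diff)
      moreover have "real (r - t) \<le> real r" by simp
      moreover have "0 < real (r - t)" using t_less_r by simp
      ultimately have "(real n / 2) / real r \<le> real (n - t) / real (r - t)"
        by (intro frac_le) auto
      then show "real n / (2 * real r) \<le> real (n - t) / real (r - t)" by simp
    qed simp
    also have "\<dots> \<le> real ((n - t) choose (r - t))"
      using n t_less_r binomial_ge_n_over_k_pow_k[of "r - t" "n - t", where 'a = real] by simp
    finally show ?thesis .
  qed
  ultimately have "(real n / real t) ^ t * ((real n / (2 * real r)) ^ (r - t)) powr p \<le> complete_norm n"
    unfolding complete_norm_def using p_ge_1 by (intro mult_mono powr_mono2) auto
  moreover have "(real n / real t) ^ t * ((real n / (2 * real r)) ^ (r - t)) powr p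
      = ?c * (real n ^ t * (real n ^ (r - t)) powr p)"
    by (simp add: power_divide powr_divide)
  moreover have "real n ^ t * (real n ^ (r - t)) powr p = real n powr exponent"
    using n0 t_less_r
    by (simp add: exponent_def powr_add powr_powr of_nat_diff mult.commute flip: powr_realpow)
  ultimately show "?c * real n powr exponent \<le> complete_norm n" by simp
qed

lemma tp_norm_le_ex:
  fixes H :: "nat hgraph"
  assumes "rgraph r H" "free \<F> H"
  shows "tp_norm t p H \<le> ex_tp r t p (order_of H) \<F>"
  unfolding ex_tp_def using assms by (intro Max_ge finite_tp_norm_values) auto

lemma density_le_ex:
  fixes H :: "nat hgraph"
  assumes "rgraph r H" "free \<F> H"
  shows "density H \<le> ex_density (order_of H) \<F>"
  unfolding ex_density_def density_def
  using tp_norm_le_ex[OF assms] by (intro divide_right_mono complete_norm_nonneg)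

lemma ex_tp_attained:
  assumes "{H :: nat hgraph. rgraph r H \<and> order_of H = n \<and> free \<F> H} \<noteq> {}"
  shows "\<exists>H :: nat hgraph. rgraph r H \<and> order_of H = n \<and> free \<F> H \<and> tp_norm t p H = ex_tp r t p n \<F>"
proof -
  have "ex_tp r t p n \<F> \<in> tp_norm t p ` {H :: nat hgraph. rgraph r H \<and> order_of H = n \<and> free \<F> H}"
    unfolding ex_tp_def using assms by (intro Max_in finite_tp_norm_values) auto
  then show ?thesis by auto
qed

lemma density_remove_vertex:
  assumes "rgraph r H" "r < order_of H"
  shows "\<exists>v\<in>verts H. density H \<le> density (induced H (verts H - {v}))"
proof (rule ccontr)
  assume "\<not> ?thesis"
  then have less: "density (induced H (verts H - {v})) < density H" if "v \<in> verts H" for v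
    using that by force
  have "finite (verts H)" "verts H \<noteq> {}" using rgraphD(1)[OF assms(1)] assms(2) by (auto simp: order_of_def)
  then have "(\<Sum>v\<in>verts H. density (induced H (verts H - {v}))) < (\<Sum>v\<in>verts H. density H)"
    using less by (intro sum_strict_mono) auto
  with sum_density_remove[OF assms] show False by (simp add: order_of_def)
qed

text \<open>An extremal graph has a vertex whose deletion loses no density, so the extremal
  densities decrease from \<open>n = r\<close> on and converge from above. The lower bound
  \<open>c\<close> is a parameter because it is instantiated in two ways: by a positive constant
  coming from nondegeneracy, and by the limit of the other family, which orders the two
  limits.\<close>

lemma ex_density_limit:
  assumes rg: "\<forall>F\<in>\<F>. rgraph r F"
    and ne: "\<And>n. {H :: nat hgraph. rgraph r H \<and> order_of H = n \<and> free \<F> H} \<noteq> {}"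
    and c: "\<And>n. r \<le> n \<Longrightarrow> c \<le> ex_density n \<F>"
  shows "\<exists>L\<ge>c. (\<forall>n\<ge>r. L \<le> ex_density n \<F>) \<and> (\<forall>\<eta>>0. \<exists>N. \<forall>n\<ge>N. ex_density n \<F> \<le> L + \<eta>)"
proof -
  have step: "ex_density (Suc n) \<F> \<le> ex_density n \<F>" if n: "r \<le> n" for n
  proof -
    obtain H :: "nat hgraph" where H: "rgraph r H" "order_of H = Suc n" "free \<F> H" "tp_norm t p H = ex_tp r t p (Suc n) \<F>"
      using ex_tp_attained[OF ne] by blast
    obtain v where v: "v \<in> verts H" "density H \<le> density (induced H (verts H - {v}))"
      using density_remove_vertex[OF H(1)] n H(2) by auto
    have "order_of (induced H (verts H - {v})) = n" using H(2) v(1) by (simp add: order_of_def)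
    then have "density (induced H (verts H - {v})) \<le> ex_density n \<F>"
      using density_le_ex[OF rgraph_induced[OF H(1)] free_induced[OF rg H(3)]] by blast
    moreover have "density H = ex_density (Suc n) \<F>" by (simp add: density_def ex_density_def H)
    ultimately show ?thesis using v(2) by simp
  qed
  have dec: "decseq (\<lambda>n. ex_density (n + r) \<F>)"
    by (rule decseq_SucI) (use step in auto)
  have bd: "\<forall>n. c \<le> ex_density (n + r) \<F>" using c by auto
  obtain L where lim: "(\<lambda>n. ex_density (n + r) \<F>) \<longlonglongrightarrow> L" and L: "\<And>n. L \<le> ex_density (n + r) \<F>"
    using decseq_convergent[OF dec bd] by blast
  show ?thesis
  proof (intro exI[of _ L] conjI allI impI)
    show "c \<le> L" using lim bd by (intro LIMSEQ_le_const) auto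
    show "L \<le> ex_density n \<F>" if "r \<le> n" for n using L[of "n - r"] that by simp
    fix \<eta> :: real assume "0 < \<eta>"
    then obtain N where N: "\<And>n. n \<ge> N \<Longrightarrow> norm (ex_density (n + r) \<F> - L) < \<eta>"
      using LIMSEQ_D[OF lim] by blast
    show "\<exists>N. \<forall>n\<ge>N. ex_density n \<F> \<le> L + \<eta>"
    proof (intro exI[of _ "N + r"] allI impI)
      fix n assume "N + r \<le> n"
      then have "norm (ex_density n \<F> - L) < \<eta>" using N[of "n - r"] by simp
      then show "ex_density n \<F> \<le> L + \<eta>" by (simp add: abs_diff_less_iff)
    qed
  qed
qed

text \<open>The minimum degree is at most the average, which \<open>sum_tp_degree_le\<close> bounds
  in terms of the norm.\<close>

lemma density_ge_of_min_degree:
  assumes H: "rgraph r H" and n: "r \<le> order_of H"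
    and deg: "c * exdeg_tp r t p (order_of H) \<F> \<le> min_tp_degree t p H"
  shows "c * ex_density (order_of H) \<F> \<le> density H"
proof -
  let ?n = "order_of H"
  have n0: "0 < real ?n" using n t_less_r by simp
  have fin: "finite (verts H)" using rgraphD(1)[OF H] .
  have "real ?n * (c * exdeg_tp r t p ?n \<F>) = (\<Sum>v\<in>verts H. c * exdeg_tp r t p ?n \<F>)"
    by (simp add: order_of_def)
  also have "\<dots> \<le> (\<Sum>v\<in>verts H. tp_degree t p H v)"
  proof (rule sum_mono)
    fix v assume "v \<in> verts H"
    then have "min_tp_degree t p H \<le> tp_degree t p H v"
      unfolding min_tp_degree_def using fin by (intro Min_le) auto
    with deg show "c * exdeg_tp r t p ?n \<F> \<le> tp_degree t p H v" by simp
  qed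
  also have "\<dots> \<le> exponent * tp_norm t p H" by (rule sum_tp_degree_le[OF H n])
  finally have "exponent * (c * ex_tp r t p ?n \<F>) \<le> exponent * tp_norm t p H"
    using n0 by (simp add: exdeg_tp_eq mult_ac)
  then have "c * ex_tp r t p ?n \<F> \<le> tp_norm t p H" using exponent_pos by simp
  then have "c * ex_tp r t p ?n \<F> / complete_norm ?n \<le> tp_norm t p H / complete_norm ?n"
    by (intro divide_right_mono complete_norm_nonneg)
  then show ?thesis by (simp add: density_def ex_density_def)
qed

text \<open>Jensen over the \<open>t\<close>-sets: their average degree is the edge density times
  the degree in the complete graph. This transfers positive Turan density to the norm
  densities.\<close>

lemma density_ge_edge_density:
  assumes H: "rgraph r H" and n: "r \<le> order_of H"
  shows "(real (card (edges H)) / real (order_of H choose r)) powr p \<le> density H"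
proof -
  let ?n = "order_of H" and ?S = "{T. T \<subseteq> verts H \<and> card T = t}"
  let ?E = "card (edges H)"
  have cS: "card ?S = ?n choose t" "finite ?S" using card_t_subsets[OF H] .
  have pos: "?n choose t > 0" "(?n - t) choose (r - t) > 0" "?n choose r > 0" "r choose t > 0"
    using n t_less_r by (auto simp: zero_less_binomial)
  have "real (card ?S) * ((\<Sum>T\<in>?S. real (degree H T)) / real (card ?S)) powr p \<le> (\<Sum>T\<in>?S. real (degree H T) powr p)"
  proof (rule powr_jensen)
    show "?S \<noteq> {}" using cS(1) pos(1) by (metis card.empty less_irrefl)
  qed (use p_ge_1 cS in auto)
  also have "(\<Sum>T\<in>?S. real (degree H T)) = real ?E * real (r choose t)"
    using sum_degree[OF H, of t] by (simp flip: of_nat_sum of_nat_mult)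
  finally have le: "real (?n choose t) * (real ?E * real (r choose t) / real (?n choose t)) powr p \<le> tp_norm t p H"
    unfolding tp_norm_def cS by simp
  have "(?n choose r) * (r choose t) = (?n choose t) * ((?n - t) choose (r - t))"
    using choose_mult[of t r ?n] n t_less_r by simp
  then have "real (?n choose r) * real (r choose t) = real (?n choose t) * real ((?n - t) choose (r - t))"
    by (simp flip: of_nat_mult)
  then have "real ?E * real (r choose t) / real (?n choose t)
      = real ?E / real (?n choose r) * real ((?n - t) choose (r - t))"
    using pos by (simp add: field_simps)
  with le have "(real ?E / real (?n choose r)) powr p * complete_norm ?n \<le> tp_norm t p H"
    by (simp add: complete_norm_def powr_mult mult_ac del: times_divide_eq_left times_divide_eq_right)
  then show ?thesis using complete_norm_pos[OF n] by (simp add: density_def pos_le_divide_eq)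
qed

end


subsection \<open>Symmetrization\<close>

text \<open>Replaces the vertex \<open>u\<close> by a copy of \<open>v\<close>.\<close>

definition clone :: "'a hgraph \<Rightarrow> 'a \<Rightarrow> 'a \<Rightarrow> 'a hgraph" where
  "clone H u v = HGraph (verts H)
     ({e \<in> edges H. u \<notin> e} \<union> image (transpose u v) ` {e \<in> edges H. v \<in> e \<and> u \<notin> e})"

lemma verts_clone [simp]: "verts (clone H u v) = verts H"
  by (simp add: clone_def)

lemma order_of_clone [simp]: "order_of (clone H u v) = order_of H"
  by (simp add: order_of_def)

lemma card_transpose_image [simp]: "card (transpose u v ` A) = card A"
  by (simp add: card_image)

lemma transpose_image_image [simp]: "transpose u v ` transpose u v ` A = A"
  by (simp add: image_image)

lemma mem_transpose_image [simp]:
  "u \<in> transpose u v ` A \<longleftrightarrow> v \<in> A" "v \<in> transpose u v ` A \<longleftrightarrow> u \<in> A"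
  by (simp_all add: in_transpose_image_iff)

lemma transpose_image_subset_iff:
  "transpose u v ` A \<subseteq> B \<longleftrightarrow> A \<subseteq> transpose u v ` B"
  by (metis image_mono transpose_image_image)

lemma edges_clone_notin: "u \<notin> e \<Longrightarrow> e \<in> edges (clone H u v) \<longleftrightarrow> e \<in> edges H"
  by (auto simp: clone_def)

lemma edges_clone_in:
  "u \<in> e \<Longrightarrow> e \<in> edges (clone H u v) \<longleftrightarrow> v \<notin> e \<and> transpose u v ` e \<in> edges H"
proof
  assume u: "u \<in> e" and "v \<notin> e \<and> transpose u v ` e \<in> edges H"
  then have "transpose u v ` e \<in> {e \<in> edges H. v \<in> e \<and> u \<notin> e}" by simp
  then have "transpose u v ` transpose u v ` e \<in> image (transpose u v) ` {e \<in> edges H. v \<in> e \<and> u \<notin> e}"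
    by (rule imageI)
  then show "e \<in> edges (clone H u v)" by (simp add: clone_def)
next
  assume u: "u \<in> e" and "e \<in> edges (clone H u v)"
  then obtain f where "e = transpose u v ` f" "f \<in> edges H" "u \<notin> f" by (auto simp: clone_def)
  then show "v \<notin> e \<and> transpose u v ` e \<in> edges H" by simp
qed

lemma rgraph_clone:
  assumes "rgraph r H" "u \<in> verts H" "v \<in> verts H"
  shows "rgraph r (clone H u v)"
proof -
  have "transpose u v ` e \<subseteq> verts H" if "e \<subseteq> verts H" for e
    using image_mono[OF that, of "transpose u v"] assms by simp
  then show ?thesis using assms by (auto simp: rgraph_def clone_def)
qed

text \<open>\<open>clone H u v\<close> is a subgraph of the blowup of \<open>H - u\<close> in which
  \<open>v\<close> becomes the pair \<open>{u, v}\<close> and every other vertex a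
  singleton.\<close>

lemma free_clone:
  fixes H :: "nat hgraph"
  assumes "\<forall>F\<in>\<F>. rgraph r F" "blowup_invariant r \<F>" "rgraph r H" "free \<F> H"
    and uv: "u \<in> verts H" "v \<in> verts H" "u \<noteq> v"
  shows "free \<F> (clone H u v)"
proof -
  let ?G = "induced H (verts H - {u})"
  define W where "W i = (if i = v then {u, v} else {i})" for i
  have Wv: "W v = {u, v}" and Wi: "i \<noteq> v \<Longrightarrow> W i = {i}" and iW: "i \<in> W i" for i
    by (auto simp: W_def)
  have "free \<F> (blowup ?G W)"
  proof -
    have "rgraph r ?G" "free \<F> ?G"
      using rgraph_induced[OF assms(3)] free_induced[OF assms(1,4)] by auto
    moreover have "disjoint_family_on W (verts ?G)"
      unfolding disjoint_family_on_def using uv by (auto simp: W_def)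
    moreover have "\<forall>i\<in>verts ?G. finite (W i)" by (simp add: W_def)
    ultimately show ?thesis using assms(2) unfolding blowup_invariant_def by blast
  qed
  moreover have "contains (blowup ?G W) (clone H u v)"
  proof (rule contains_subgraph)
    show "verts (clone H u v) \<subseteq> verts (blowup ?G W)" proof
      fix x assume x: "x \<in> verts (clone H u v)"
      show "x \<in> verts (blowup ?G W)"
      proof (cases "x = u")
        case True
        then show ?thesis using uv by (auto simp: blowup_def intro!: bexI[of _ v] simp: Wv)
      next
        case False
        then show ?thesis using x iW[of x] by (auto simp: blowup_def)
      qed
    qed
    have edgeI: "e \<in> edges (blowup ?G W)"
      if "f \<in> edges ?G" "e \<subseteq> (\<Union>i\<in>f. W i)" "\<And>i. i \<in> f \<Longrightarrow> card (e \<inter> W i) = 1" for e f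
      unfolding blowup_def using that by auto
    show "edges (clone H u v) \<subseteq> edges (blowup ?G W)"
    proof
      fix e assume e: "e \<in> edges (clone H u v)"
      show "e \<in> edges (blowup ?G W)"
      proof (cases "u \<in> e")
        case False
        then have eH: "e \<in> edges H" using e edges_clone_notin by metis
        have "e \<inter> W i = {i}" if "i \<in> e" for i using that False by (auto simp: W_def)
        then have "card (e \<inter> W i) = 1" if "i \<in> e" for i using that by simp
        moreover have "e \<subseteq> (\<Union>i\<in>e. W i)" using iW by blast
        moreover have "e \<in> edges ?G" using eH False rgraphD(3)[OF assms(3)] by auto
        ultimately show ?thesis by (intro edgeI)
      next
        case True
        let ?f = "transpose u v ` e"
        have f: "v \<notin> e" "?f \<in> edges H" using e edges_clone_in[OF True] by auto
        have fv: "v \<in> ?f" "u \<notin> ?f" using f True by auto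
        have ef: "e = insert u (?f - {v})"
        proof (rule set_eqI)
          fix x
          show "x \<in> e \<longleftrightarrow> x \<in> insert u (?f - {v})"
          proof (cases "x = u \<or> x = v")
            case True
            then show ?thesis using f(1) \<open>u \<in> e\<close> by auto
          next
            case False
            then have "transpose u v x = x" by simp
            then have "x \<in> ?f \<longleftrightarrow> x \<in> e" by (simp only: in_transpose_image_iff)
            then show ?thesis using False by simp
          qed
        qed
        have "card (e \<inter> W i) = 1" if i: "i \<in> ?f" for i
        proof (cases "i = v")
          case True
          then have "e \<inter> W i = {u}" using \<open>u \<in> e\<close> f(1) by (auto simp: Wv)
          then show ?thesis by simp
        next
          case False
          then have "i \<in> e" by (subst ef) (use i in blast)
          then have "e \<inter> W i = {i}" using False by (auto simp: Wi)
          then show ?thesis by simp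
        qed
        moreover have "e \<subseteq> (\<Union>i\<in>?f. W i)"
        proof
          fix x assume "x \<in> e"
          then consider "x = u" | "x \<in> ?f" "x \<noteq> v" by (subst (asm) ef) blast
          then show "x \<in> (\<Union>i\<in>?f. W i)"
          proof cases
            case 1
            then show ?thesis using fv(1) by (intro UN_I[of v]) (auto simp: Wv)
          next
            case 2
            then show ?thesis using iW by (intro UN_I[of x]) auto
          qed
        qed
        moreover have "?f \<in> edges ?G"
          using f(2) fv(2) rgraphD(3)[OF assms(3) f(2)] by (simp del: mem_transpose_image) blast
        ultimately show ?thesis by (intro edgeI)
      qed
    qed
  qed
  ultimately show ?thesis using free_subgraph[OF assms(1)] by blast
qed

lemma induced_clone: "u \<notin> X \<Longrightarrow> induced (clone H u v) X = induced H X"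
  by (auto simp: induced_def clone_def)

text \<open>No edge contains both \<open>u\<close> and \<open>v\<close>. For \<open>T\<close>
  avoiding both, one cloning trades the edges through \<open>u\<close> for copies of those through
  \<open>v\<close> and the other does the reverse, so the changes cancel. For \<open>T\<close>
  through exactly one of them, the copy \<open>u\<close> inherits the degrees of
  \<open>v\<close>.\<close>

lemma degree_clone:
  assumes "rgraph r H" "u \<noteq> v" "uncovered H u v"
  shows "u \<notin> T \<Longrightarrow> v \<notin> T \<Longrightarrow> degree (clone H u v) T + degree (clone H v u) T = 2 * degree H T"
    and "u \<in> T \<Longrightarrow> v \<notin> T \<Longrightarrow> degree (clone H u v) T = degree H (transpose u v ` T)"
    and "u \<notin> T \<Longrightarrow> v \<in> T \<Longrightarrow> degree (clone H u v) T = degree H T"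
    and "u \<in> T \<Longrightarrow> v \<in> T \<Longrightarrow> degree H T = 0"
proof -
  have unc: "e \<in> edges H \<Longrightarrow> u \<in> e \<Longrightarrow> v \<in> e \<Longrightarrow> False" for e
    using assms(3) by (auto simp: uncovered_def)
  have fin: "finite (edges H)" using rgraphD(2)[OF assms(1)] .
  have cl: "degree (clone H x y) T = card {e \<in> edges H. x \<notin> e \<and> T \<subseteq> e}
      + card {e \<in> edges H. y \<in> e \<and> x \<notin> e \<and> transpose x y ` T \<subseteq> e}" for x y T
  proof -
    have "{e \<in> edges (clone H x y). T \<subseteq> e} = {e \<in> edges H. x \<notin> e \<and> T \<subseteq> e}
       \<union> image (transpose x y) ` {e \<in> edges H. y \<in> e \<and> x \<notin> e \<and> transpose x y ` T \<subseteq> e}"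
      by (auto simp: clone_def transpose_image_subset_iff)
    moreover have "card (image (transpose x y) ` {e \<in> edges H. y \<in> e \<and> x \<notin> e \<and> transpose x y ` T \<subseteq> e})
       = card {e \<in> edges H. y \<in> e \<and> x \<notin> e \<and> transpose x y ` T \<subseteq> e}"
      by (rule card_image, rule inj_onI) (metis transpose_image_image)
    moreover have "{e \<in> edges H. x \<notin> e \<and> T \<subseteq> e}
       \<inter> image (transpose x y) ` {e \<in> edges H. y \<in> e \<and> x \<notin> e \<and> transpose x y ` T \<subseteq> e} = {}"
      by auto
    ultimately show ?thesis unfolding degree_def
      using fin by (simp add: card_Un_disjoint)
  qed
  {
    assume T: "u \<notin> T" "v \<notin> T"
    then have tr: "transpose u v ` T = T" "transpose v u ` T = T" by simp_all
    have "degree H T = card {e \<in> edges H. u \<notin> e \<and> T \<subseteq> e} + card {e \<in> edges H. u \<in> e \<and> v \<notin> e \<and> T \<subseteq> e}"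
      unfolding degree_def using fin
      by (subst card_Un_disjoint[symmetric]) (auto intro!: arg_cong[where f = card] dest: unc)
    moreover have "degree H T = card {e \<in> edges H. v \<notin> e \<and> T \<subseteq> e} + card {e \<in> edges H. v \<in> e \<and> u \<notin> e \<and> T \<subseteq> e}"
      unfolding degree_def using fin
      by (subst card_Un_disjoint[symmetric]) (auto intro!: arg_cong[where f = card] dest: unc)
    ultimately show "degree (clone H u v) T + degree (clone H v u) T = 2 * degree H T"
      by (simp add: cl tr)
  }
  {
    assume T: "u \<in> T" "v \<notin> T"
    then have "v \<in> transpose u v ` T" by simp
    then have "{e \<in> edges H. v \<in> e \<and> u \<notin> e \<and> transpose u v ` T \<subseteq> e} = {e \<in> edges H. transpose u v ` T \<subseteq> e}"
      using unc by blast
    moreover have no: "{e \<in> edges H. u \<notin> e \<and> T \<subseteq> e} = {}" using T by auto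
    ultimately show "degree (clone H u v) T = degree H (transpose u v ` T)"
      unfolding cl no by (simp add: degree_def)
  }
  {
    assume T: "u \<notin> T" "v \<in> T"
    then have "u \<in> transpose u v ` T" by simp
    then have no: "{e \<in> edges H. v \<in> e \<and> u \<notin> e \<and> transpose u v ` T \<subseteq> e} = {}" by blast
    moreover have "{e \<in> edges H. u \<notin> e \<and> T \<subseteq> e} = {e \<in> edges H. T \<subseteq> e}" using T unc by blast
    ultimately show "degree (clone H u v) T = degree H T"
      unfolding cl no by (simp add: degree_def)
  }
  {
    assume T: "u \<in> T" "v \<in> T"
    then have no: "{e \<in> edges H. T \<subseteq> e} = {}" using unc by blast
    show "degree H T = 0" unfolding degree_def no by simp
  }
qed

lemma uncovered_commute: "uncovered H u v \<longleftrightarrow> uncovered H v u"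
  by (auto simp: uncovered_def)

text \<open>Only the average of the two clonings is controlled; the better one is chosen later. For
  \<open>T\<close> avoiding both vertices the old degree is the mean of the two new ones, and
  convexity applies. A set \<open>T\<close> through exactly one of them receives its own degree in
  one cloning and that of its mirror image in the other, so summing over \<open>T\<close> together
  with its image under the transposition gives equality.\<close>

lemma (in tp_setting) tp_norm_clone:
  assumes H: "rgraph r H" and uv: "u \<in> verts H" "v \<in> verts H" "u \<noteq> v" "uncovered H u v"
  shows "2 * tp_norm t p H \<le> tp_norm t p (clone H u v) + tp_norm t p (clone H v u)"
proof -
  let ?S = "{T. T \<subseteq> verts H \<and> card T = t}" and ?\<tau> = "image (transpose u v)"
  let ?f = "\<lambda>T. real (degree H T) powr p"
  have "bij_betw ?\<tau> ?S ?S"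
  proof (rule bij_betwI[where g = ?\<tau>])
    show "?\<tau> \<in> ?S \<rightarrow> ?S" "?\<tau> \<in> ?S \<rightarrow> ?S"
      using image_mono[of _ "verts H" "transpose u v"] uv by auto
  qed auto
  then have swap: "(\<Sum>T\<in>?S. ?f (?\<tau> T)) = (\<Sum>T\<in>?S. ?f T)"
    by (rule sum.reindex_bij_betw)
  have unc': "uncovered H v u" using uv uncovered_commute by metis
  note d = degree_clone[OF H uv(3,4)] and d' = degree_clone[OF H uv(3)[symmetric] unc']
  have "2 * tp_norm t p H = (\<Sum>T\<in>?S. ?f T + ?f (?\<tau> T))"
    by (simp add: sum.distrib swap tp_norm_def)
  also have "\<dots> \<le> (\<Sum>T\<in>?S. real (degree (clone H u v) T) powr p + real (degree (clone H v u) T) powr p)"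
  proof (rule sum_mono)
    fix T
    let ?a = "real (degree (clone H u v) T)" and ?b = "real (degree (clone H v u) T)"
    consider "u \<notin> T" "v \<notin> T" | "u \<in> T" "v \<notin> T" | "u \<notin> T" "v \<in> T" | "u \<in> T" "v \<in> T" by blast
    then show "?f T + ?f (?\<tau> T) \<le> ?a powr p + ?b powr p"
    proof cases
      case 1
      then have eq: "?a + ?b = 2 * real (degree H T)"
        using d(1)[of T] by (simp flip: of_nat_add)
      have tau: "?\<tau> T = T" using 1 by simp
      have "?f T + p * slope p (degree H T) * (?a - degree H T) \<le> ?a powr p"
        "?f T + p * slope p (degree H T) * (?b - degree H T) \<le> ?b powr p"
        using p_ge_1 by (auto intro!: powr_tangent)
      then have "2 * ?f T + p * slope p (degree H T) * (?a + ?b - 2 * degree H T) \<le> ?a powr p + ?b powr p"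
        by (simp add: algebra_simps)
      then show ?thesis unfolding tau eq by simp
    next
      case 2
      then show ?thesis using d(2)[of T] d'(3)[of T] by simp
    next
      case 3
      then show ?thesis using d(3)[of T] d'(2)[of T] by (simp add: transpose_commute)
    next
      case 4
      moreover from 4 have "u \<in> ?\<tau> T" "v \<in> ?\<tau> T" by auto
      ultimately show ?thesis using d(4) by simp
    qed
  qed
  finally show ?thesis by (simp add: sum.distrib tp_norm_def)
qed

section \<open>Equivalence classes of vertices under cloning\<close>

lemma equivalent_vertices_iff:
  assumes "1 \<le> r"
  shows "equivalent_vertices r H x y \<longleftrightarrow> (\<forall>A. card A = r - 1 \<longrightarrow> insert x A \<in> edges H \<longleftrightarrow> insert y A \<in> edges H)"
  by (auto simp: equivalent_vertices_def link_def)

lemma insert_edge: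
  assumes "rgraph r H" "1 \<le> r" "insert x A \<in> edges H" "card A = r - 1"
  shows "x \<notin> A"
proof
  assume "x \<in> A"
  then have "insert x A = A" by blast
  then show False using rgraphD(4)[OF assms(1,3)] assms(2,4) by simp
qed

text \<open>Whether \<open>insert x A\<close> is an edge after cloning is decided in
  \<open>H\<close>: directly if \<open>u\<close> is not in \<open>A\<close>, and after transposing
  \<open>u\<close> and \<open>v\<close> otherwise. In the second case, once one of the two sets is
  an edge, neither \<open>x\<close> nor \<open>y\<close> can be \<open>v\<close>, so the
  transposition fixes both.\<close>

lemma equivalent_clone:
  assumes H: "rgraph r H" and r: "1 \<le> r" and uv: "u \<noteq> v"
    and xy: "x \<noteq> u" "y \<noteq> u" "equivalent_vertices r H x y"
  shows "equivalent_vertices r (clone H u v) x y"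
proof -
  have eq: "insert a A \<in> edges H \<longleftrightarrow> insert b A \<in> edges H"
    if "a \<in> {x, y}" "b \<in> {x, y}" "card A = r - 1" for a b A
    using that xy(3) unfolding equivalent_vertices_iff[OF r] by auto
  have main: "insert b A \<in> edges (clone H u v)"
    if ab: "a \<in> {x, y}" "b \<in> {x, y}" and A: "card A = r - 1" and e: "insert a A \<in> edges (clone H u v)" for a b A
  proof (cases "u \<in> A")
    case False
    then have "u \<notin> insert a A" "u \<notin> insert b A" using ab xy by auto
    then show ?thesis using e eq[OF ab A] edges_clone_notin by metis
  next
    case True
    then have v: "v \<notin> insert a A" "transpose u v ` insert a A \<in> edges H"
      using e edges_clone_in[of u "insert a A" H v] by auto
    have tA: "card (transpose u v ` A) = r - 1" using A by simp
    have ta: "transpose u v a = a" using v ab xy by auto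
    then have e1: "insert a (transpose u v ` A) \<in> edges H" using v(2) by simp
    then have e2: "insert b (transpose u v ` A) \<in> edges H" using eq[OF ab tA] by simp
    have "b \<noteq> v"
    proof
      assume "b = v"
      moreover have "v \<in> transpose u v ` A" using True by simp
      ultimately show False using insert_edge[OF H r e2 tA] by simp
    qed
    then have "transpose u v b = b" using ab xy by auto
    then have "transpose u v ` insert b A \<in> edges H" using e2 by simp
    moreover have "v \<notin> insert b A" using v(1) \<open>b \<noteq> v\<close> by simp
    ultimately show ?thesis using edges_clone_in[of u "insert b A" H v] True by simp
  qed
  show ?thesis unfolding equivalent_vertices_iff[OF r] using main by blast
qed

lemma equivalent_clone_self:
  fixes H :: "'a hgraph"
  assumes H: "rgraph r H" and r: "1 \<le> r" and uv: "u \<in> verts H" "v \<in> verts H" "u \<noteq> v"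
  shows "equivalent_vertices r (clone H u v) u v"
proof -
  note C = rgraph_clone[OF H uv(1,2)]
  show ?thesis unfolding equivalent_vertices_iff[OF r]
  proof (intro allI impI)
    fix A :: "'a set" assume A: "card A = r - 1"
    show "insert u A \<in> edges (clone H u v) \<longleftrightarrow> insert v A \<in> edges (clone H u v)"
    proof (cases "u \<in> A \<or> v \<in> A")
      case True
      have "insert u A \<notin> edges (clone H u v)"
      proof
        assume a: "insert u A \<in> edges (clone H u v)"
        then have "u \<notin> A" using insert_edge[OF C r] A by blast
        moreover have "v \<notin> insert u A" using a edges_clone_in[of u "insert u A" H v] by simp
        ultimately show False using True by simp
      qed
      moreover have "insert v A \<notin> edges (clone H u v)"
      proof
        assume a: "insert v A \<in> edges (clone H u v)"
        then have "v \<notin> A" using insert_edge[OF C r] A by blast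
        moreover have "u \<notin> insert v A" using a edges_clone_in[of u "insert v A" H v] by auto
        ultimately show False using True by simp
      qed
      ultimately show ?thesis by simp
    next
      case False
      then have "transpose u v ` insert u A = insert v A" by simp
      then show ?thesis
        using edges_clone_in[of u "insert u A" H v] edges_clone_notin[of u "insert v A" H v] False uv by auto
    qed
  qed
qed

text \<open>The number of these ordered pairs, diagonal included, is the sum of the squares of the
  class sizes. It breaks ties when cloning keeps the norm: moving a vertex into another class at
  least as large as its own increases it.\<close>

definition equiv_pairs :: "nat \<Rightarrow> 'a hgraph \<Rightarrow> ('a \<times> 'a) set" where
  "equiv_pairs r H = {(x, y). x \<in> verts H \<and> y \<in> verts H \<and> equivalent_vertices r H x y}"

lemma finite_equiv_pairs:
  assumes "rgraph r H"
  shows "finite (equiv_pairs r H)" "card (equiv_pairs r H) \<le> order_of H * order_of H"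
proof -
  have sub: "equiv_pairs r H \<subseteq> verts H \<times> verts H" by (auto simp: equiv_pairs_def)
  have fin: "finite (verts H \<times> verts H)" using rgraphD(1)[OF assms] by simp
  show "finite (equiv_pairs r H)" using finite_subset[OF sub fin] .
  show "card (equiv_pairs r H) \<le> order_of H * order_of H"
    using card_mono[OF fin sub] by (simp add: order_of_def card_cartesian_product)
qed

lemma equivalent_vertices_refl: "equivalent_vertices r H x x"
  and equivalent_vertices_sym: "equivalent_vertices r H x y \<Longrightarrow> equivalent_vertices r H y x"
  and equivalent_vertices_trans:
    "equivalent_vertices r H x y \<Longrightarrow> equivalent_vertices r H y z \<Longrightarrow> equivalent_vertices r H x z"
  by (simp_all add: equivalent_vertices_def)

text \<open>The pairs through \<open>u\<close> form a row and a column of the size of its class,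
  overlapping in \<open>(u, u)\<close>; that overlap is the \<open>+ 1\<close>.\<close>

lemma card_equiv_pairs_split:
  assumes H: "rgraph r H" and u: "u \<in> verts H"
  shows "card (equiv_pairs r H) + 1 = card (equiv_pairs r H \<inter> (- {u}) \<times> (- {u}))
     + 2 * card {y \<in> verts H. equivalent_vertices r H u y}"
proof -
  let ?C = "{y \<in> verts H. equivalent_vertices r H u y}"
  let ?P = "equiv_pairs r H \<inter> (- {u}) \<times> (- {u})"
  have fin: "finite ?C" "finite ?P" using rgraphD(1)[OF H] finite_equiv_pairs(1)[OF H] by auto
  have uC: "u \<in> ?C" using u by (simp add: equivalent_vertices_refl)
  have split: "equiv_pairs r H = (?P \<union> {u} \<times> ?C) \<union> (?C - {u}) \<times> {u}"
    using u by (auto simp: equiv_pairs_def intro: equivalent_vertices_sym)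
  have "card ((?P \<union> {u} \<times> ?C) \<union> (?C - {u}) \<times> {u}) = card (?P \<union> {u} \<times> ?C) + card ((?C - {u}) \<times> {u})"
    using fin by (intro card_Un_disjoint) auto
  also have "card (?P \<union> {u} \<times> ?C) = card ?P + card ({u} \<times> ?C)"
    using fin by (intro card_Un_disjoint) auto
  finally have "card (equiv_pairs r H) = card ?P + card ({u} \<times> ?C) + card ((?C - {u}) \<times> {u})"
    by (simp only: split[symmetric])
  moreover have "card ({u} \<times> ?C) = card ?C" "card ((?C - {u}) \<times> {u}) = card ?C - 1"
    using uC fin by (simp_all only: card_cartesian_product card_Diff_singleton) simp_all
  moreover have "card ?C > 0" using uC fin card_gt_0_iff by blast
  ultimately show ?thesis by linarith
qed

text \<open>Pairs avoiding \<open>u\<close> stay equivalent. The new class of \<open>u\<close>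
  contains \<open>u\<close> and the whole old class of \<open>v\<close>, so by \<open>le\<close> it
  is strictly larger than the old class of \<open>u\<close>.\<close>

lemma card_equiv_pairs_clone:
  assumes H: "rgraph r H" and r: "1 \<le> r"
    and uv: "u \<in> verts H" "v \<in> verts H" "u \<noteq> v" "uncovered H u v"
    and neq: "\<not> equivalent_vertices r H u v"
    and le: "card {y \<in> verts H. equivalent_vertices r H u y} \<le> card {y \<in> verts H. equivalent_vertices r H v y}"
  shows "card (equiv_pairs r H) < card (equiv_pairs r (clone H u v))"
proof -
  let ?K = "clone H u v"
  let ?C = "{y \<in> verts H. equivalent_vertices r H v y}"
  let ?C' = "{y \<in> verts ?K. equivalent_vertices r ?K u y}"
  note K = rgraph_clone[OF H uv(1,2)]
  have fin: "finite (verts H)" using rgraphD(1)[OF H] .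
  have "equiv_pairs r H \<inter> (- {u}) \<times> (- {u}) \<subseteq> equiv_pairs r ?K \<inter> (- {u}) \<times> (- {u})"
    using equivalent_clone[OF H r uv(3)] by (auto simp: equiv_pairs_def)
  then have 1: "card (equiv_pairs r H \<inter> (- {u}) \<times> (- {u})) \<le> card (equiv_pairs r ?K \<inter> (- {u}) \<times> (- {u}))"
    using finite_equiv_pairs(1)[OF K] by (intro card_mono) auto
  have u: "u \<notin> ?C" using neq equivalent_vertices_sym[of r H v u] by blast
  have "insert u ?C \<subseteq> ?C'"
  proof
    fix y assume y: "y \<in> insert u ?C"
    show "y \<in> ?C'"
    proof (cases "y = u")
      case True
      then show ?thesis using uv by (simp add: equivalent_vertices_refl)
    next
      case False
      then have yv: "y \<in> verts H" "equivalent_vertices r H v y" using y by auto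
      then have "equivalent_vertices r ?K v y"
        using equivalent_clone[OF H r uv(3), of v y] False uv(3) by auto
      with equivalent_clone_self[OF H r uv(1-3)] have "equivalent_vertices r ?K u y"
        by (rule equivalent_vertices_trans)
      then show ?thesis using yv(1) by simp
    qed
  qed
  then have "card (insert u ?C) \<le> card ?C'" using fin by (intro card_mono) auto
  then have 2: "card ?C + 1 \<le> card ?C'" using u fin by simp
  show ?thesis
    using card_equiv_pairs_split[OF H uv(1)] card_equiv_pairs_split[OF K, of u] uv(1) 1 2 le by simp
qed

text \<open>The two new norms add up to at least twice the old one, so either one of them exceeds it
  or both equal it. In the latter case the vertex with the smaller class is turned into a copy of
  the other.\<close>

lemma (in tp_setting) symmetrization_step:
  assumes H: "rgraph r H" and ns: "\<not> symmetrized r H"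
  shows "\<exists>u\<in>verts H. \<exists>v\<in>verts H. u \<noteq> v \<and>
    (tp_norm t p H < tp_norm t p (clone H u v) \<or>
     tp_norm t p H = tp_norm t p (clone H u v) \<and> card (equiv_pairs r H) < card (equiv_pairs r (clone H u v)))"
proof -
  have r: "1 \<le> r" using t_less_r by simp
  obtain u v where uv: "u \<in> verts H" "v \<in> verts H" "u \<noteq> v" "uncovered H u v" and neq: "\<not> equivalent_vertices r H u v"
    using ns unfolding symmetrized_def by blast
  have vu: "uncovered H v u" using uv(4) by (rule uncovered_commute[THEN iffD1])
  have neq': "\<not> equivalent_vertices r H v u" using neq by (metis equivalent_vertices_sym)
  define better where "better x y \<longleftrightarrow> tp_norm t p H < tp_norm t p (clone H x y) \<or>
     tp_norm t p H = tp_norm t p (clone H x y) \<and> card (equiv_pairs r H) < card (equiv_pairs r (clone H x y))" for x y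
  have "better u v \<or> better v u"
  proof (rule ccontr)
    assume no: "\<not> ?thesis"
    then have eq: "tp_norm t p H = tp_norm t p (clone H u v)" "tp_norm t p H = tp_norm t p (clone H v u)"
      using tp_norm_clone[OF H uv] unfolding better_def by linarith+
    let ?c = "\<lambda>x. card {y \<in> verts H. equivalent_vertices r H x y}"
    show False
    proof (cases "?c u \<le> ?c v")
      case True
      then show False using card_equiv_pairs_clone[OF H r uv neq] eq(1) no by (simp add: better_def)
    next
      case False
      then have "?c v \<le> ?c u" by simp
      then show False
        using card_equiv_pairs_clone[OF H r uv(2,1) uv(3)[symmetric] vu neq'] eq(2) no by (simp add: better_def)
    qed
  qed
  then show ?thesis using uv(1-3) unfolding better_def[symmetric] by metis
qed

text \<open>Zykov symmetrization terminates because each step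
  increases the norm or keeps it and increases the number of pairs of equivalent vertices.\<close>

lemma (in tp_setting) symmetrization_induct:
  fixes H :: "nat hgraph"
  assumes rg: "\<forall>F\<in>\<F>. rgraph r F" and bl: "blowup_invariant r \<F>"
    and H: "rgraph r H" "free \<F> H"
    and base: "\<And>G. rgraph r G \<Longrightarrow> free \<F> G \<Longrightarrow> order_of G = order_of H \<Longrightarrow> symmetrized r G \<Longrightarrow> Q G"
    and step: "\<And>G u v. rgraph r G \<Longrightarrow> free \<F> G \<Longrightarrow> order_of G = order_of H \<Longrightarrow>
      u \<in> verts G \<Longrightarrow> v \<in> verts G \<Longrightarrow> tp_norm t p G \<le> tp_norm t p (clone G u v) \<Longrightarrow>
      Q (clone G u v) \<Longrightarrow> Q G"
  shows "Q H"
proof -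
  let ?n = "order_of H"
  let ?norms = "tp_norm t p ` {G :: nat hgraph. rgraph r G \<and> order_of G = ?n \<and> free \<F> G}"
  \<comment> \<open>The norm is real, but only finitely many values occur at a given order, so the
    number of values above the current one is a natural number that drops with each
    increase.\<close>
  define m1 where "m1 G = card {x \<in> ?norms. tp_norm t p G < x}" for G :: "nat hgraph"
  define m2 where "m2 G = ?n * ?n - card (equiv_pairs r G)" for G :: "nat hgraph"
  have finN: "finite ?norms" by (rule finite_tp_norm_values)
  have "rgraph r G \<longrightarrow> free \<F> G \<longrightarrow> order_of G = ?n \<longrightarrow> Q G" for G
  proof (induction G rule: wf_induct_rule[OF wf_measures[of "[m1, m2]"]])
    case (1 G)
    note IH = this
    show ?case
    proof (intro impI)
      assume G: "rgraph r G" "free \<F> G" "order_of G = ?n"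
      show "Q G"
      proof (cases "symmetrized r G")
        case True
        then show ?thesis using base G by blast
      next
        case False
        then obtain u v where uv: "u \<in> verts G" "v \<in> verts G" "u \<noteq> v"
          and alt: "tp_norm t p G < tp_norm t p (clone G u v) \<or>
            tp_norm t p G = tp_norm t p (clone G u v) \<and> card (equiv_pairs r G) < card (equiv_pairs r (clone G u v))"
          using symmetrization_step[OF G(1)] by blast
        let ?K = "clone G u v"
        have K: "rgraph r ?K" "free \<F> ?K" "order_of ?K = ?n"
          using rgraph_clone[OF G(1) uv(1,2)] free_clone[OF rg bl G(1,2) uv] G(3) by simp_all
        have "(?K, G) \<in> measures [m1, m2]"
        proof (cases "tp_norm t p G < tp_norm t p ?K")
          case True
          have "tp_norm t p ?K \<in> ?norms" using K by blast
          then have "{x \<in> ?norms. tp_norm t p ?K < x} \<subset> {x \<in> ?norms. tp_norm t p G < x}"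
            using True by (intro psubsetI) (force, blast)
          then have "m1 ?K < m1 G" unfolding m1_def using finN by (intro psubset_card_mono) auto
          then show ?thesis by simp
        next
          case False
          then have eq: "tp_norm t p ?K = tp_norm t p G" "card (equiv_pairs r G) < card (equiv_pairs r ?K)"
            using alt by auto
          have "card (equiv_pairs r ?K) \<le> ?n * ?n" using finite_equiv_pairs(2)[OF K(1)] K(3) by simp
          then have "m2 ?K < m2 G" unfolding m2_def using eq(2) by linarith
          moreover have "m1 ?K = m1 G" by (simp add: m1_def eq(1))
          ultimately show ?thesis by simp
        qed
        then have "Q ?K" using IH K by blast
        moreover have "tp_norm t p G \<le> tp_norm t p ?K" using alt by auto
        ultimately show ?thesis using step[OF G uv(1,2)] by blast
      qed
    qed
  qed
  then show ?thesis using H by blast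
qed


subsection \<open>Nondegenerate families\<close>

text \<open>A forbidden graph without edges is contained in every graph with enough vertices. For
  large \<open>n\<close> the maximum in \<open>turan_number\<close> is then over the empty set, an
  unspecified value that does not vary with \<open>n\<close>, and dividing by
  \<open>n choose r\<close> gives density zero.\<close>

lemma nondegenerate_edges:
  assumes nd: "nondegenerate r \<F>" and r: "1 \<le> r" and rg: "\<forall>F\<in>\<F>. rgraph r F" and F: "F \<in> \<F>"
  shows "edges F \<noteq> {}"
proof
  assume e: "edges F = {}"
  have no: "{H :: nat hgraph. rgraph r H \<and> order_of H = n \<and> free \<F> H} = {}" if n: "order_of F \<le> n" for n
  proof -
    have "contains H F" if H: "rgraph r H" "order_of H = n" for H :: "nat hgraph"
    proof -
      have "card (verts F) \<le> card (verts H)" using n H by (simp add: order_of_def)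
      moreover have "finite (verts F)" "finite (verts H)" using rg F H(1) by (auto simp: rgraph_def)
      ultimately obtain f where "f ` verts F \<subseteq> verts H" "inj_on f (verts F)"
        using card_le_inj by metis
      then show ?thesis using e by (auto simp: contains_def homomorphism_def)
    qed
    then show ?thesis using F by (auto simp: free_def)
  qed
  let ?C = "Max ({} :: nat set)"
  have lim: "(\<lambda>n. (real ?C * real r) / real n) \<longlonglongrightarrow> 0" by (rule lim_const_over_n)
  have up: "\<forall>\<^sub>F n in sequentially. real (turan_number r n \<F>) / real (n choose r) \<le> (real ?C * real r) / real n"
  proof (rule eventually_sequentiallyI[of "Suc (order_of F + r)"])
    fix n assume n: "Suc (order_of F + r) \<le> n"
    then have "order_of F \<le> n" by simp
    from no[OF this] have "turan_number r n \<F> = ?C" unfolding turan_number_def by (simp only: image_empty)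
    moreover have "real n / real r \<le> real (n choose r)"
    proof -
      have "real n / real r \<le> (real n / real r) ^ r" using n r by (intro self_le_power) auto
      also have "\<dots> \<le> real (n choose r)"
        using n binomial_ge_n_over_k_pow_k[of r n, where 'a = real] by simp
      finally show ?thesis .
    qed
    then have "real ?C / real (n choose r) \<le> real ?C / (real n / real r)"
      using n r by (intro divide_left_mono mult_pos_pos) (auto simp: zero_less_binomial)
    ultimately show "real (turan_number r n \<F>) / real (n choose r) \<le> (real ?C * real r) / real n"
      by simp
  qed
  have low: "\<forall>\<^sub>F n in sequentially. 0 \<le> real (turan_number r n \<F>) / real (n choose r)" by simp
  have "(\<lambda>n. real (turan_number r n \<F>) / real (n choose r)) \<longlonglongrightarrow> 0"
    by (rule tendsto_sandwich[OF low up tendsto_const lim])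
  then have "turan_density r \<F> = 0" unfolding turan_density_def by (rule limI)
  then show False using nd by (simp add: nondegenerate_def)
qed

lemma nondegenerate_free_graphs:
  assumes "nondegenerate r \<F>" "1 \<le> r" "\<forall>F\<in>\<F>. rgraph r F"
  shows "{H :: nat hgraph. rgraph r H \<and> order_of H = n \<and> free \<F> H} \<noteq> {}"
proof -
  let ?G = "HGraph {..<n} {} :: nat hgraph"
  have "free \<F> ?G"
    using nondegenerate_edges[OF assms] by (fastforce simp: free_def contains_def homomorphism_def)
  then have "?G \<in> {H :: nat hgraph. rgraph r H \<and> order_of H = n \<and> free \<F> H}"
    by (auto simp: rgraph_def order_of_def)
  then show ?thesis by blast
qed

section \<open>Monotonicity of the Turan ratios\<close>

lemma turan_number_attained:
  assumes "{H :: nat hgraph. rgraph r H \<and> order_of H = n \<and> free \<F> H} \<noteq> {}"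
  shows "\<exists>H :: nat hgraph. rgraph r H \<and> order_of H = n \<and> free \<F> H \<and> card (edges H) = turan_number r n \<F>"
proof -
  have "turan_number r n \<F> \<in> (\<lambda>H. card (edges H)) ` {H :: nat hgraph. rgraph r H \<and> order_of H = n \<and> free \<F> H}"
    unfolding turan_number_def using assms by (intro Max_in finite_card_edges_values) auto
  then show ?thesis by auto
qed

lemma turan_number_le:
  fixes H :: "nat hgraph"
  assumes "rgraph r H" "free \<F> H"
  shows "card (edges H) \<le> turan_number r (order_of H) \<F>"
  unfolding turan_number_def using assms by (intro Max_ge finite_card_edges_values) auto

lemma frac_le_cross:
  fixes a b x y c d :: real
  assumes "a * x \<le> b * y" "a * c = b * d" "0 < a" "0 < d" "0 < c"
  shows "x / c \<le> y / d"
proof -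
  have bd: "0 < b * d" using assms by (metis mult_pos_pos)
  then have b: "b \<noteq> 0" by auto
  have "x / c = a * x / (a * c)" using assms(3) by simp
  also have "\<dots> \<le> b * y / (b * d)" unfolding assms(2) using assms(1) bd by (intro divide_right_mono) auto
  finally show ?thesis using b by simp
qed

text \<open>Averaging over vertex deletions shows that the ratios decrease from \<open>n = r\<close>
  on. Hence the limit in \<open>turan_density\<close> exists and lies below every one of
  them.\<close>

lemma turan_density_le:
  assumes nd: "nondegenerate r \<F>" and r: "1 \<le> r" and rg: "\<forall>F\<in>\<F>. rgraph r F" and n: "r \<le> n"
  shows "turan_density r \<F> \<le> real (turan_number r n \<F>) / real (n choose r)"
proof -
  note ne = nondegenerate_free_graphs[OF nd r rg]
  let ?x = "\<lambda>n. real (turan_number r n \<F>) / real (n choose r)"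
  have step: "?x (Suc n) \<le> ?x n" if n: "r \<le> n" for n
  proof -
    obtain H :: "nat hgraph" where H: "rgraph r H" "order_of H = Suc n" "free \<F> H"
      "card (edges H) = turan_number r (Suc n) \<F>"
      using turan_number_attained[OF ne] by blast
    have "(Suc n - r) * card (edges H) = (\<Sum>v\<in>verts H. card {e \<in> edges H. v \<notin> e})"
      using sum_card_avoiding[OF H(1), of "{}"] H(2) by (simp add: degree_def)
    also have "\<dots> \<le> (\<Sum>v\<in>verts H. turan_number r n \<F>)"
    proof (rule sum_mono)
      fix v assume v: "v \<in> verts H"
      let ?G = "induced H (verts H - {v})"
      have "edges ?G = {e \<in> edges H. v \<notin> e}" using rgraphD(3)[OF H(1)] by auto
      moreover have "order_of ?G = n" using H(2) v by (simp add: order_of_def)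
      moreover have "card (edges ?G) \<le> turan_number r (order_of ?G) \<F>"
        by (intro turan_number_le rgraph_induced[OF H(1)] free_induced[OF rg H(3)]) auto
      ultimately show "card {e \<in> edges H. v \<notin> e} \<le> turan_number r n \<F>" by simp
    qed
    finally have "(Suc n - r) * turan_number r (Suc n) \<F> \<le> Suc n * turan_number r n \<F>"
      using H(2,4) by (simp add: order_of_def)
    then have "real ((Suc n - r) * turan_number r (Suc n) \<F>) \<le> real (Suc n * turan_number r n \<F>)"
      by (rule of_nat_mono)
    then have "real (Suc n - r) * real (turan_number r (Suc n) \<F>) \<le> real (Suc n) * real (turan_number r n \<F>)"
      by (simp only: of_nat_mult)
    moreover have "real (Suc n - r) * real (Suc n choose r) = real (Suc n) * real (n choose r)"
      using arg_cong[OF binomial_absorb_comp[of "Suc n" r], of real] by (simp only: of_nat_mult diff_Suc_1)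
    moreover have "real (Suc n - r) > 0" "real (n choose r) > 0" "real (Suc n choose r) > 0"
      using n by (auto simp: zero_less_binomial simp del: binomial_Suc_Suc)
    ultimately show ?thesis by (rule frac_le_cross)
  qed
  have dec: "decseq (\<lambda>n. ?x (n + r))" by (rule decseq_SucI) (use step in auto)
  have "\<forall>i. 0 \<le> ?x (i + r)" by simp
  from decseq_convergent[OF dec this]
  obtain L where lim: "(\<lambda>n. ?x (n + r)) \<longlonglongrightarrow> L" and L: "\<And>n. L \<le> ?x (n + r)" by blast
  have "?x \<longlonglongrightarrow> L" using lim by (rule LIMSEQ_offset)
  then have "turan_density r \<F> = L" unfolding turan_density_def by (rule limI)
  then show ?thesis using L[of "n - r"] n by simp
qed

lemma (in tp_setting) nondegenerate_ex_density:
  assumes nd: "nondegenerate r \<F>" and rg: "\<forall>F\<in>\<F>. rgraph r F"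
  shows "\<exists>c>0. \<forall>n\<ge>r. c \<le> ex_density n \<F>"
proof (intro exI conjI allI impI)
  have r: "1 \<le> r" using t_less_r by simp
  have pos: "0 < turan_density r \<F>" using nd by (simp add: nondegenerate_def)
  show "0 < turan_density r \<F> powr p" using pos by simp
  fix n assume n: "r \<le> n"
  obtain H :: "nat hgraph" where H: "rgraph r H" "order_of H = n" "free \<F> H"
    "card (edges H) = turan_number r n \<F>"
    using turan_number_attained[OF nondegenerate_free_graphs[OF nd r rg]] by blast
  have "turan_density r \<F> powr p \<le> (real (card (edges H)) / real (order_of H choose r)) powr p"
    using turan_density_le[OF nd r rg n] pos p_ge_1 H by (intro powr_mono2) auto
  also have "\<dots> \<le> density H" using density_ge_edge_density[OF H(1)] n H(2) by simp
  also have "\<dots> \<le> ex_density n \<F>" using density_le_ex[OF H(1,3)] H(2) by simp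
  finally show "turan_density r \<F> powr p \<le> ex_density n \<F>" .
qed

lemma (in tp_setting) ex_tp_eq_Max:
  fixes \<F> \<HH> :: "nat hgraph set"
  assumes rg: "\<forall>F\<in>\<F>. rgraph r F" and nd: "nondegenerate r \<F>"
    and HH: "\<forall>H\<in>\<HH>. rgraph r H \<and> free \<F> H"
    and bl: "blowup_invariant r \<F>" and st: "symmetrized_stable r \<F> \<HH>"
  shows "{G \<in> \<HH>. order_of G = n} \<noteq> {}"
    and "ex_tp r t p n \<F> = Max (tp_norm t p ` {G \<in> \<HH>. order_of G = n})"
proof -
  have r: "1 \<le> r" using t_less_r by simp
  obtain H :: "nat hgraph" where H: "rgraph r H" "order_of H = n" "free \<F> H" "tp_norm t p H = ex_tp r t p n \<F>"
    using ex_tp_attained[OF nondegenerate_free_graphs[OF nd r rg]] by blast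
  have "\<exists>G\<in>\<HH>. order_of G = order_of H \<and> tp_norm t p H \<le> tp_norm t p G"
  proof (rule symmetrization_induct[OF rg bl H(1,3), where Q = "\<lambda>H'. \<exists>G\<in>\<HH>. order_of G = order_of H \<and> tp_norm t p H' \<le> tp_norm t p G"])
    fix G :: "nat hgraph" assume G: "rgraph r G" "free \<F> G" "order_of G = order_of H" "symmetrized r G"
    then show "\<exists>G'\<in>\<HH>. order_of G' = order_of H \<and> tp_norm t p G \<le> tp_norm t p G'"
      using st G by (intro bexI[of _ G]) (auto simp: symmetrized_stable_def)
  qed (blast intro: order_trans)
  then obtain G where G: "G \<in> \<HH>" "order_of G = n" "ex_tp r t p n \<F> \<le> tp_norm t p G"
    using H by auto
  then show "{G \<in> \<HH>. order_of G = n} \<noteq> {}" by blast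
  have "{G \<in> \<HH>. order_of G = n} = {G. rgraph r G \<and> order_of G = n \<and> G \<in> \<HH>}" using HH by auto
  then have fin: "finite (tp_norm t p ` {G \<in> \<HH>. order_of G = n})"
    using finite_tp_norm_values[of t p r n "\<lambda>G. G \<in> \<HH>"] by simp
  show "ex_tp r t p n \<F> = Max (tp_norm t p ` {G \<in> \<HH>. order_of G = n})"
  proof (rule antisym)
    have "tp_norm t p G \<le> Max (tp_norm t p ` {G \<in> \<HH>. order_of G = n})"
      using G fin by (intro Max_ge) auto
    then show "ex_tp r t p n \<F> \<le> Max (tp_norm t p ` {G \<in> \<HH>. order_of G = n})" using G(3) by simp
    have "x \<le> ex_tp r t p n \<F>" if x: "x \<in> tp_norm t p ` {G \<in> \<HH>. order_of G = n}" for x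
    proof -
      obtain G' where "G' \<in> \<HH>" "order_of G' = n" "x = tp_norm t p G'" using x by blast
      then show ?thesis using tp_norm_le_ex[of G' \<F>] HH by auto
    qed
    then show "Max (tp_norm t p ` {G \<in> \<HH>. order_of G = n}) \<le> ex_tp r t p n \<F>"
      using G(1,2) fin by (intro Max.boundedI) auto
  qed
qed


subsection \<open>Degrees after deleting few vertices\<close>

lemma powr_convex_comb:
  fixes x y l p :: real
  assumes "1 \<le> p" "0 \<le> x" "0 \<le> y" "0 \<le> l" "l \<le> 1"
  shows "(l * x + (1 - l) * y) powr p \<le> l * x powr p + (1 - l) * y powr p"
proof -
  define m where "m = l * x + (1 - l) * y"
  have m: "0 \<le> m" unfolding m_def using assms by simp
  have "l * (m powr p + p * slope p m * (x - m)) + (1 - l) * (m powr p + p * slope p m * (y - m))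
      \<le> l * x powr p + (1 - l) * y powr p"
    using assms m by (intro add_mono mult_left_mono powr_tangent) auto
  moreover have "l * (m powr p + p * slope p m * (x - m)) + (1 - l) * (m powr p + p * slope p m * (y - m))
      = m powr p + p * slope p m * (l * x + (1 - l) * y - m)" by (simp add: algebra_simps)
  ultimately show ?thesis by (simp add: m_def)
qed

text \<open>\<open>x + b\<close> and \<open>y\<close> lie between \<open>x\<close> and
  \<open>y + b\<close> and have the same sum as these endpoints, so they are convex combinations of
  them with complementary weights \<open>l\<close> and \<open>1 - l\<close>; the two convexity
  inequalities add up.\<close>

lemma powr_increment_mono:
  fixes x y b c p :: real
  assumes "1 \<le> p" "0 \<le> x" "x \<le> y" "0 \<le> b" "b \<le> c"
  shows "(x + b) powr p - x powr p \<le> (y + c) powr p - y powr p"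
proof -
  have "(x + b) powr p + y powr p \<le> x powr p + (y + b) powr p"
  proof (cases "y + b - x = 0")
    case True
    then have "b = 0" "y = x" using assms by auto
    then show ?thesis by simp
  next
    case False
    then have pos: "y + b - x > 0" using assms by linarith
    define l where "l = b / (y + b - x)"
    have l: "0 \<le> l" "l \<le> 1" "l * (y + b - x) = b" using assms pos by (auto simp: l_def)
    have "(l * x + (1 - l) * (y + b)) powr p \<le> l * x powr p + (1 - l) * (y + b) powr p"
      using assms l by (intro powr_convex_comb) auto
    moreover have "l * x + (1 - l) * (y + b) = y" using l(3) by (simp add: algebra_simps)
    moreover have "((1 - l) * x + (1 - (1 - l)) * (y + b)) powr p \<le> (1 - l) * x powr p + (1 - (1 - l)) * (y + b) powr p"
      using assms l by (intro powr_convex_comb) auto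
    moreover have "(1 - l) * x + (1 - (1 - l)) * (y + b) = x + b" using l(3) by (simp add: algebra_simps)
    ultimately have "y powr p + (x + b) powr p
       \<le> (l * x powr p + (1 - l) * (y + b) powr p) + ((1 - l) * x powr p + (1 - (1 - l)) * (y + b) powr p)"
      by simp
    also have "\<dots> = x powr p + (y + b) powr p" by (simp add: algebra_simps)
    finally show ?thesis by simp
  qed
  moreover have "(y + b) powr p \<le> (y + c) powr p" using assms by (intro powr_mono2) auto
  ultimately show ?thesis by linarith
qed

lemma card_split:
  assumes "finite E"
  shows "card {e \<in> E. P e} = card {e \<in> E. P e \<and> Q e} + card {e \<in> E. P e \<and> \<not> Q e}"
proof -
  have "{e \<in> E. P e} = {e \<in> E. P e \<and> Q e} \<union> {e \<in> E. P e \<and> \<not> Q e}" by blast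
  also have "card \<dots> = card {e \<in> E. P e \<and> Q e} + card {e \<in> E. P e \<and> \<not> Q e}"
    using assms by (intro card_Un_disjoint) auto
  finally show ?thesis .
qed

context tp_setting
begin

lemma tp_degree_induced:
  assumes H: "rgraph r H" and X: "X \<subseteq> verts H"
  shows "tp_degree t p (induced H X) x = (\<Sum>T | T \<subseteq> verts H \<and> card T = t.
     real (card {e \<in> edges H. T \<subseteq> e \<and> e \<subseteq> X}) powr p
     - real (card {e \<in> edges H. T \<subseteq> e \<and> e \<subseteq> X - {x}}) powr p)"
proof -
  have X': "X - {x} \<subseteq> verts H" using X by auto
  show ?thesis unfolding tp_degree_def remove_vertex_induced[OF H X]
    tp_norm_induced[OF H X] tp_norm_induced[OF H X'] by (rule sum_subtractf[symmetric])
qed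

lemma tp_degree_whole:
  assumes H: "rgraph r H"
  shows "tp_degree t p H x = (\<Sum>T | T \<subseteq> verts H \<and> card T = t.
     real (card {e \<in> edges H. T \<subseteq> e}) powr p
     - real (card {e \<in> edges H. T \<subseteq> e \<and> x \<notin> e}) powr p)"
proof -
  have eq: "{e \<in> edges H. T \<subseteq> e \<and> e \<subseteq> verts H} = {e \<in> edges H. T \<subseteq> e}"
     "{e \<in> edges H. T \<subseteq> e \<and> e \<subseteq> verts H - {x}} = {e \<in> edges H. T \<subseteq> e \<and> x \<notin> e}" for T
    using rgraphD(3)[OF H] by blast+
  show ?thesis using tp_degree_induced[OF H order_refl, of x]
    unfolding induced_verts[OF H] eq .
qed

text \<open>Degrees in subgraphs are smaller because \<open>X \<mapsto> \<parallel>H[X]\<parallel>\<close> is supermodular.\<close>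

lemma tp_degree_induced_le:
  assumes H: "rgraph r H" and X: "X \<subseteq> verts H"
  shows "tp_degree t p (induced H X) x \<le> tp_degree t p H x"
  unfolding tp_degree_induced[OF H X] tp_degree_whole[OF H]
proof (rule sum_mono)
  fix T
  have fin: "finite (edges H)" using rgraphD(2)[OF H] .
  let ?s = "card {e \<in> edges H. T \<subseteq> e \<and> e \<subseteq> X - {x}}" and ?b = "card {e \<in> edges H. T \<subseteq> e \<and> e \<subseteq> X \<and> x \<in> e}"
  let ?s' = "card {e \<in> edges H. T \<subseteq> e \<and> x \<notin> e}" and ?b' = "card {e \<in> edges H. T \<subseteq> e \<and> x \<in> e}"
  have eq: "{e \<in> edges H. (T \<subseteq> e \<and> e \<subseteq> X) \<and> x \<notin> e} = {e \<in> edges H. T \<subseteq> e \<and> e \<subseteq> X - {x}}"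
    "{e \<in> edges H. (T \<subseteq> e \<and> e \<subseteq> X) \<and> x \<in> e} = {e \<in> edges H. T \<subseteq> e \<and> e \<subseteq> X \<and> x \<in> e}" by blast+
  have 1: "card {e \<in> edges H. T \<subseteq> e \<and> e \<subseteq> X} = ?b + ?s"
    using card_split[OF fin, of "\<lambda>e. T \<subseteq> e \<and> e \<subseteq> X" "\<lambda>e. x \<in> e"] unfolding eq .
  have 2: "card {e \<in> edges H. T \<subseteq> e} = ?b' + ?s'" using fin by (rule card_split)
  have "?s \<le> ?s'" "?b \<le> ?b'" using fin by (auto intro!: card_mono)
  then have "(real ?s + real ?b) powr p - real ?s powr p \<le> (real ?s' + real ?b') powr p - real ?s' powr p"
    using p_ge_1 by (intro powr_increment_mono) auto
  then show "real (card {e \<in> edges H. T \<subseteq> e \<and> e \<subseteq> X}) powr p - real ?s powr p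
     \<le> real (card {e \<in> edges H. T \<subseteq> e}) powr p - real ?s' powr p"
    unfolding 1 2 by (simp add: add.commute)
qed

text \<open>The vertices go one at a time. Each costs its degree in what is left, which by
  supermodularity is at most its degree in \<open>H\<close>.\<close>

lemma tp_norm_remove_set:
  assumes H: "rgraph r H" and Z: "finite Z" "Z \<subseteq> verts H"
  shows "tp_norm t p H - (\<Sum>v\<in>Z. tp_degree t p H v) \<le> tp_norm t p (induced H (verts H - Z))"
  using Z
proof (induction Z rule: finite_induct)
  case empty
  then show ?case using induced_verts[OF H] by simp
next
  case (insert v Z)
  have eq: "verts H - insert v Z = verts H - Z - {v}" by blast
  have "tp_norm t p (induced H (verts H - insert v Z))
      = tp_norm t p (induced H (verts H - Z)) - tp_degree t p (induced H (verts H - Z)) v"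
    unfolding tp_degree_def eq by (simp add: remove_vertex_induced[OF H])
  moreover have "tp_degree t p (induced H (verts H - Z)) v \<le> tp_degree t p H v"
    by (rule tp_degree_induced_le[OF H]) auto
  ultimately show ?case using insert by simp
qed

section \<open>Loss of degree in a large induced subgraph\<close>

lemma sum_card_containing:
  assumes H: "rgraph r H"
  shows "(\<Sum>T | T \<subseteq> verts H \<and> card T = t. card {e \<in> edges H. T \<subseteq> e \<and> P e}) = card {e \<in> edges H. P e} * (r choose t)"
proof -
  let ?G = "HGraph (verts H) {e \<in> edges H. P e}"
  have "rgraph r ?G" using H by (auto simp: rgraph_def)
  from sum_degree[OF this, of t] show ?thesis
    by (simp add: degree_def conj_commute conj_left_commute)
qed

lemma card_edges_meeting:
  assumes H: "rgraph r H" and Y: "finite Y" "Y \<inter> T = {}" and T: "finite T" "card T < r"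
  shows "card {e \<in> edges H. T \<subseteq> e \<and> Y \<inter> e \<noteq> {}} \<le> card Y * order_of H ^ (r - card T - 1)"
proof -
  have "{e \<in> edges H. T \<subseteq> e \<and> Y \<inter> e \<noteq> {}} = (\<Union>y\<in>Y. {e \<in> edges H. insert y T \<subseteq> e})" by blast
  then have "card {e \<in> edges H. T \<subseteq> e \<and> Y \<inter> e \<noteq> {}} \<le> (\<Sum>y\<in>Y. degree H (insert y T))"
    using card_UN_le[OF Y(1)] by (simp add: degree_def)
  also have "\<dots> \<le> (\<Sum>y\<in>Y. order_of H ^ (r - card T - 1))"
  proof (rule sum_mono)
    fix y assume "y \<in> Y"
    then have "y \<notin> T" using Y(2) by blast
    then have "card (insert y T) = Suc (card T)" using T(1) by simp
    then show "degree H (insert y T) \<le> order_of H ^ (r - card T - 1)"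
      using degree_le_power[OF H, of "insert y T"] T(2) by simp
  qed
  finally show ?thesis by simp
qed

text \<open>In the main case \<open>T\<close> lies in \<open>X - {x}\<close>. With the abbreviations
  of the proof, the tangent at \<open>a\<close> bounds the first difference by
  \<open>p * (slope p a * b)\<close>, and the tangent at \<open>s\<close> bounds the second from
  below by \<open>p * (slope p s * (b - c))\<close>. What remains, up to the factor
  \<open>p\<close>, is \<open>slope p a * c\<close>, caused by edges through \<open>x\<close>
  leaving \<open>X\<close>, plus the difference of the slopes times \<open>b - c\<close>, which is
  small because \<open>a\<close> and \<open>s\<close> differ by few edges. In the other cases the
  tangent at \<open>a\<close> is enough.\<close>

lemma degree_loss_term:
  fixes H :: "'a hgraph"
  assumes H: "rgraph r H" and X: "X \<subseteq> verts H" "x \<in> X" and T: "T \<subseteq> verts H" "card T = t"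
    and n: "0 < order_of H"
    and unif: "\<And>a s. 0 \<le> s \<Longrightarrow> s \<le> a \<Longrightarrow> a \<le> real (order_of H) ^ (r - t) \<Longrightarrow> a - s \<le> \<gamma> * real (order_of H) ^ (r - t)
      \<Longrightarrow> slope p a - slope p s \<le> \<omega> * (real (order_of H) ^ (r - t)) powr (p - 1)"
    and small: "real (card (verts H - X)) + 1 \<le> \<gamma> * real (order_of H)" and \<omega>: "0 < \<omega>"
  shows "(real (card {e \<in> edges H. T \<subseteq> e}) powr p - real (card {e \<in> edges H. T \<subseteq> e \<and> x \<notin> e}) powr p)
     - (real (card {e \<in> edges H. T \<subseteq> e \<and> e \<subseteq> X}) powr p
     - real (card {e \<in> edges H. T \<subseteq> e \<and> e \<subseteq> X - {x}}) powr p)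
     \<le> p * (real (order_of H) ^ (r - t)) powr (p - 1) *
       (real (card {e \<in> edges H. T \<subseteq> e \<and> x \<in> e \<and> \<not> e \<subseteq> X}) + \<omega> * real (card {e \<in> edges H. T \<subseteq> e \<and> x \<in> e}))"
proof -
  let ?n = "order_of H"
  have fin: "finite (edges H)" "finite (verts H)" using rgraphD[OF H] by auto
  define N where "N = real ?n ^ (r - t)"
  have N: "0 < N" using n by (simp add: N_def)
  define a where "a = real (card {e \<in> edges H. T \<subseteq> e})"
  define s' where "s' = real (card {e \<in> edges H. T \<subseteq> e \<and> x \<notin> e})"
  define a' where "a' = real (card {e \<in> edges H. T \<subseteq> e \<and> e \<subseteq> X})"
  define s where "s = real (card {e \<in> edges H. T \<subseteq> e \<and> e \<subseteq> X - {x}})"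
  define b where "b = real (card {e \<in> edges H. T \<subseteq> e \<and> x \<in> e})"
  define c where "c = real (card {e \<in> edges H. T \<subseteq> e \<and> x \<in> e \<and> \<not> e \<subseteq> X})"
  have nonneg: "0 \<le> a" "0 \<le> s'" "0 \<le> a'" "0 \<le> s" "0 \<le> b" "0 \<le> c"
    by (simp_all add: a_def s'_def a'_def s_def b_def c_def)
  have "degree H T \<le> ?n ^ (r - t)" using degree_le_power[OF H, of T] T t_less_r by simp
  then have aN: "a \<le> N" unfolding a_def N_def degree_def by (simp flip: of_nat_power)
  have slope_a: "slope p a \<le> N powr (p - 1)" "0 \<le> slope p a"
    using p_ge_1 nonneg aN N by (auto intro: slope_le slope_nonneg)
  have \<omega>b: "0 \<le> N powr (p - 1) * (\<omega> * b)" using \<omega> nonneg by simp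
  have tangent_a: "a powr p - y powr p \<le> p * (slope p a * (a - y))" if "0 \<le> y" for y
    using powr_tangent[OF p_ge_1 that nonneg(1)] by (simp add: algebra_simps)
  have mono: "p * (slope p a * c) \<le> p * (N powr (p - 1) * c)"
    using p_ge_1 slope_a nonneg by (intro mult_left_mono mult_right_mono) auto
  have goal: "a powr p - s' powr p - (a' powr p - s powr p) \<le> p * (N powr (p - 1) * c + N powr (p - 1) * (\<omega> * b))"
  proof (cases "x \<in> T")
    case True
    have no: "{e \<in> edges H. T \<subseteq> e \<and> x \<notin> e} = {}" "{e \<in> edges H. T \<subseteq> e \<and> e \<subseteq> X - {x}} = {}"
      using True by blast+
    have zero: "s' = 0" "s = 0" unfolding s'_def s_def no by simp_all
    have "{e \<in> edges H. T \<subseteq> e \<and> x \<in> e \<and> \<not> e \<subseteq> X} = {e \<in> edges H. T \<subseteq> e \<and> \<not> e \<subseteq> X}"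
      using True by blast
    then have "a = a' + c" unfolding a_def a'_def c_def
      using card_split[OF fin(1), of "\<lambda>e. T \<subseteq> e" "\<lambda>e. e \<subseteq> X"] by simp
    then have "a powr p - a' powr p \<le> p * (slope p a * c)" using tangent_a[OF nonneg(3)] by simp
    also note mono
    also have "p * (N powr (p - 1) * c) \<le> p * (N powr (p - 1) * c + N powr (p - 1) * (\<omega> * b))"
      using p_ge_1 \<omega>b by (intro mult_left_mono) auto
    finally show ?thesis by (simp add: zero)
  next
    case xT: False
    have ab: "a = b + s'" unfolding a_def b_def s'_def
      using card_split[OF fin(1), of "\<lambda>e. T \<subseteq> e" "\<lambda>e. x \<in> e"] by simp
    show ?thesis
    proof (cases "T \<subseteq> X")
      case False
      have no: "{e \<in> edges H. T \<subseteq> e \<and> e \<subseteq> X} = {}" "{e \<in> edges H. T \<subseteq> e \<and> e \<subseteq> X - {x}} = {}"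
        using False by blast+
      have zero: "a' = 0" "s = 0" unfolding a'_def s_def no by simp_all
      have "{e \<in> edges H. T \<subseteq> e \<and> x \<in> e \<and> \<not> e \<subseteq> X} = {e \<in> edges H. T \<subseteq> e \<and> x \<in> e}"
        using False by blast
      then have "c = b" unfolding c_def b_def by simp
      then have "a powr p - s' powr p \<le> p * (slope p a * c)" using tangent_a[OF nonneg(2)] ab by simp
      also note mono
      also have "p * (N powr (p - 1) * c) \<le> p * (N powr (p - 1) * c + N powr (p - 1) * (\<omega> * b))"
        using p_ge_1 \<omega>b by (intro mult_left_mono) auto
      finally show ?thesis by (simp add: zero)
    next
      case True
      have eq: "{e \<in> edges H. (T \<subseteq> e \<and> e \<subseteq> X) \<and> x \<notin> e} = {e \<in> edges H. T \<subseteq> e \<and> e \<subseteq> X - {x}}"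
        "{e \<in> edges H. (T \<subseteq> e \<and> e \<subseteq> X) \<and> x \<in> e} = {e \<in> edges H. (T \<subseteq> e \<and> x \<in> e) \<and> e \<subseteq> X}"
        "{e \<in> edges H. (T \<subseteq> e \<and> x \<in> e) \<and> \<not> e \<subseteq> X} = {e \<in> edges H. T \<subseteq> e \<and> x \<in> e \<and> \<not> e \<subseteq> X}" by blast+
      have a': "a' = (b - c) + s" and cb: "c \<le> b"
        unfolding a'_def s_def b_def c_def
        using card_split[OF fin(1), of "\<lambda>e. T \<subseteq> e \<and> e \<subseteq> X" "\<lambda>e. x \<in> e"]
          card_split[OF fin(1), of "\<lambda>e. T \<subseteq> e \<and> x \<in> e" "\<lambda>e. e \<subseteq> X"] unfolding eq by simp_all
      \<comment> \<open>An edge not inside \<open>X - {x}\<close> leaves \<open>X\<close> or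
        contains \<open>x\<close>; this additional vertex is what the \<open>+ 1\<close> in
        \<open>small\<close> pays for.\<close>
      let ?Y = "insert x (verts H - X)"
      have "a - s = real (card {e \<in> edges H. T \<subseteq> e \<and> \<not> e \<subseteq> X - {x}})" unfolding a_def s_def
        using card_split[OF fin(1), of "\<lambda>e. T \<subseteq> e" "\<lambda>e. e \<subseteq> X - {x}"] by simp
      also have "{e \<in> edges H. T \<subseteq> e \<and> \<not> e \<subseteq> X - {x}} = {e \<in> edges H. T \<subseteq> e \<and> ?Y \<inter> e \<noteq> {}}"
        using rgraphD(3)[OF H] by blast
      also have "real (card \<dots>) \<le> real (card ?Y * ?n ^ (r - t - 1))"
      proof -
        have "finite T" using T(1) fin(2) finite_subset by blast
        moreover have "?Y \<inter> T = {}" using True xT by blast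
        ultimately show ?thesis
          using card_edges_meeting[OF H, of ?Y T] fin T(2) t_less_r by (simp del: of_nat_mult)
      qed
      also have "\<dots> = real (card ?Y) * real ?n ^ (r - t - 1)" by simp
      also have "\<dots> \<le> (\<gamma> * real ?n) * real ?n ^ (r - t - 1)"
      proof (rule mult_right_mono)
        have "card ?Y \<le> card (verts H - X) + 1" using fin card_insert_le_m1 by (simp add: card_insert_if)
        then show "real (card ?Y) \<le> \<gamma> * real ?n" using small by linarith
      qed simp
      also have "\<dots> = \<gamma> * N"
      proof -
        have "r - t = Suc (r - t - 1)" using t_less_r by simp
        then have "real ?n ^ (r - t) = real ?n * real ?n ^ (r - t - 1)" by (metis power_Suc)
        then show ?thesis by (simp add: N_def)
      qed
      finally have close: "a - s \<le> \<gamma> * N" .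
      have sa: "s \<le> a" unfolding s_def a_def using fin by (auto intro!: card_mono)
      have diff: "slope p a - slope p s \<le> \<omega> * N powr (p - 1)"
        using unif[of s a] nonneg sa aN close by (simp add: N_def)
      have "s powr p + p * slope p s * (a' - s) \<le> a' powr p"
        using p_ge_1 nonneg by (intro powr_tangent)
      then have low: "p * (slope p s * (b - c)) \<le> a' powr p - s powr p" using a' by simp
      have up: "a powr p - s' powr p \<le> p * (slope p a * b)" using tangent_a[OF nonneg(2)] ab by simp
      have "(slope p a - slope p s) * (b - c) \<le> (\<omega> * N powr (p - 1)) * (b - c)"
        using diff cb by (intro mult_right_mono) auto
      also have "\<dots> \<le> (\<omega> * N powr (p - 1)) * b" using nonneg \<omega> by (intro mult_left_mono) auto
      finally have "(slope p a - slope p s) * (b - c) \<le> N powr (p - 1) * (\<omega> * b)" by (simp add: mult_ac)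
      then have "p * (slope p a * c + (slope p a - slope p s) * (b - c)) \<le> p * (N powr (p - 1) * c + N powr (p - 1) * (\<omega> * b))"
        using p_ge_1 slope_a nonneg by (intro mult_left_mono add_mono mult_right_mono) auto
      moreover have "p * (slope p a * b) - p * (slope p s * (b - c)) = p * (slope p a * c + (slope p a - slope p s) * (b - c))"
        by (simp add: algebra_simps)
      ultimately show ?thesis using low up by linarith
    qed
  qed
  then show ?thesis
    unfolding a_def s'_def a'_def s_def b_def c_def N_def by (simp add: distrib_left mult.assoc)
qed

text \<open>Summed over \<open>T\<close>, the edges through \<open>x\<close> leaving
  \<open>X\<close> count at most \<open>card (verts H - X) * n ^ (r - 2)\<close> up to the factor
  \<open>r choose t\<close>, a small fraction of \<open>n ^ (r - 1)\<close>; the count of all edges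
  through \<open>x\<close> is damped by \<open>\<omega>\<close>. The power is right because
  \<open>(r - t) * (p - 1) + (r - 1) = exponent - 1\<close>.\<close>

lemma degree_loss:
  assumes "0 < \<kappa>"
  shows "\<exists>\<gamma>>0. \<exists>N. \<forall>(H :: 'a hgraph) X x. rgraph r H \<longrightarrow> N \<le> order_of H \<longrightarrow> X \<subseteq> verts H \<longrightarrow> x \<in> X \<longrightarrow>
     real (card (verts H - X)) \<le> \<gamma> * real (order_of H) \<longrightarrow>
     tp_degree t p H x - tp_degree t p (induced H X) x \<le> \<kappa> * real (order_of H) powr (exponent - 1)"
proof -
  define C where "C = p * real (r choose t)"
  have C: "0 < C" unfolding C_def using p_ge_1 t_less_r by (auto intro!: mult_pos_pos simp: zero_less_binomial)
  \<comment> \<open>Each of the two error terms is allowed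
    \<open>C * \<omega> = \<kappa> / 2\<close>.\<close>
  define \<omega> where "\<omega> = \<kappa> / (2 * C)"
  have \<omega>: "0 < \<omega>" using C assms by (simp add: \<omega>_def)
  obtain \<gamma>1 where \<gamma>1: "0 < \<gamma>1"
    and unif: "\<And>N a s. 0 < N \<Longrightarrow> 0 \<le> s \<Longrightarrow> s \<le> a \<Longrightarrow> a \<le> N \<Longrightarrow> a - s \<le> \<gamma>1 * N
            \<Longrightarrow> slope p a - slope p s \<le> \<omega> * N powr (p - 1)"
    using slope_uniform[OF p_ge_1 \<omega>] by blast
  \<comment> \<open>The bound \<open>\<gamma>1 / 2\<close> leaves room for one more vertex in
    \<open>small1\<close>; the bound \<open>\<omega>\<close> controls the edges through
    \<open>x\<close> leaving \<open>X\<close>.\<close>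
  define \<gamma> where "\<gamma> = min (\<gamma>1 / 2) \<omega>"
  have "0 < \<gamma>" using \<gamma>1 \<omega> by (simp add: \<gamma>_def)
  moreover have "tp_degree t p H x - tp_degree t p (induced H X) x \<le> \<kappa> * real (order_of H) powr (exponent - 1)"
    if H: "rgraph r H" and nN: "nat \<lceil>2 / \<gamma>1\<rceil> + 1 \<le> order_of H" and X: "X \<subseteq> verts H" "x \<in> X"
      and small: "real (card (verts H - X)) \<le> \<gamma> * real (order_of H)" for H :: "'a hgraph" and X x
  proof -
    let ?n = "order_of H" and ?S = "{T. T \<subseteq> verts H \<and> card T = t}"
    let ?Y = "verts H - X"
    have fin: "finite (edges H)" "finite (verts H)" using rgraphD[OF H] by auto
    have n0: "0 < ?n" using nN by simp
    have "2 / \<gamma>1 \<le> real ?n" using nN by linarith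
    then have "1 \<le> \<gamma>1 / 2 * real ?n" using \<gamma>1 by (simp add: field_simps)
    moreover have "\<gamma> * real ?n \<le> \<gamma>1 / 2 * real ?n" by (intro mult_right_mono) (auto simp: \<gamma>_def)
    ultimately have small1: "real (card ?Y) + 1 \<le> \<gamma>1 * real ?n" using small by linarith
    define N where "N = real ?n ^ (r - t)"
    have N: "0 < N" using n0 by (simp add: N_def)
    let ?c = "\<lambda>T. card {e \<in> edges H. T \<subseteq> e \<and> x \<in> e \<and> \<not> e \<subseteq> X}" and ?b = "\<lambda>T. card {e \<in> edges H. T \<subseteq> e \<and> x \<in> e}"
    have r2: "r - 1 = Suc (r - 2)" using t_ge_1 t_less_r by simp
    have c1: "card {e \<in> edges H. x \<in> e \<and> \<not> e \<subseteq> X} \<le> card ?Y * ?n ^ (r - 2)"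
    proof -
      have "{e \<in> edges H. x \<in> e \<and> \<not> e \<subseteq> X} = {e \<in> edges H. {x} \<subseteq> e \<and> ?Y \<inter> e \<noteq> {}}"
        using rgraphD(3)[OF H] by blast
      moreover have "?Y \<inter> {x} = {}" using X by blast
      ultimately show ?thesis
        using card_edges_meeting[OF H, of ?Y "{x}"] fin t_ge_1 t_less_r by (simp add: numeral_2_eq_2)
    qed
    have b1: "card {e \<in> edges H. x \<in> e} \<le> ?n ^ (r - 1)"
      using degree_le_power[OF H, of "{x}"] t_ge_1 t_less_r by (simp add: degree_def)
    have cY: "real (card {e \<in> edges H. x \<in> e \<and> \<not> e \<subseteq> X}) \<le> \<omega> * real ?n ^ (r - 1)"
    proof -
      have "real (card {e \<in> edges H. x \<in> e \<and> \<not> e \<subseteq> X}) \<le> real (card ?Y * ?n ^ (r - 2))"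
        using c1 by (rule of_nat_mono)
      also have "\<dots> = real (card ?Y) * real ?n ^ (r - 2)" by simp
      also have "\<dots> \<le> (\<gamma> * real ?n) * real ?n ^ (r - 2)" using small by (intro mult_right_mono) auto
      also have "\<dots> = \<gamma> * real ?n ^ (r - 1)" by (simp only: r2 power_Suc mult.assoc)
      also have "\<dots> \<le> \<omega> * real ?n ^ (r - 1)" by (intro mult_right_mono) (auto simp: \<gamma>_def)
      finally show ?thesis .
    qed
    have "real (card {e \<in> edges H. x \<in> e}) \<le> real (?n ^ (r - 1))" using b1 by (rule of_nat_mono)
    then have "\<omega> * real (card {e \<in> edges H. x \<in> e}) \<le> \<omega> * real ?n ^ (r - 1)"
      using \<omega> by (intro mult_left_mono) auto
    with cY have total: "real (card {e \<in> edges H. x \<in> e \<and> \<not> e \<subseteq> X}) + \<omega> * real (card {e \<in> edges H. x \<in> e})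
       \<le> 2 * \<omega> * real ?n ^ (r - 1)" by linarith
    have "tp_degree t p H x - tp_degree t p (induced H X) x
      = (\<Sum>T\<in>?S. (real (card {e \<in> edges H. T \<subseteq> e}) powr p - real (card {e \<in> edges H. T \<subseteq> e \<and> x \<notin> e}) powr p)
     - (real (card {e \<in> edges H. T \<subseteq> e \<and> e \<subseteq> X}) powr p
     - real (card {e \<in> edges H. T \<subseteq> e \<and> e \<subseteq> X - {x}}) powr p))"
      unfolding tp_degree_induced[OF H X(1)] tp_degree_whole[OF H] by (rule sum_subtractf[symmetric])
    also have "\<dots> \<le> (\<Sum>T\<in>?S. p * N powr (p - 1) * (real (?c T) + \<omega> * real (?b T)))"
    proof (rule sum_mono)
      fix T assume "T \<in> ?S"
      then have T: "T \<subseteq> verts H" "card T = t" by auto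
      show "(real (card {e \<in> edges H. T \<subseteq> e}) powr p - real (card {e \<in> edges H. T \<subseteq> e \<and> x \<notin> e}) powr p)
         - (real (card {e \<in> edges H. T \<subseteq> e \<and> e \<subseteq> X}) powr p
         - real (card {e \<in> edges H. T \<subseteq> e \<and> e \<subseteq> X - {x}}) powr p)
        \<le> p * N powr (p - 1) * (real (?c T) + \<omega> * real (?b T))"
        unfolding N_def
        by (rule degree_loss_term[OF H X T n0 unif[OF N[unfolded N_def]] small1 \<omega>])
    qed
    also have "\<dots> = p * N powr (p - 1) * ((\<Sum>T\<in>?S. real (?c T)) + \<omega> * (\<Sum>T\<in>?S. real (?b T)))"
      by (simp add: sum_distrib_left sum.distrib distrib_left)
    also have "(\<Sum>T\<in>?S. real (?c T)) = real (card {e \<in> edges H. x \<in> e \<and> \<not> e \<subseteq> X}) * real (r choose t)"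
      using arg_cong[OF sum_card_containing[OF H, of "\<lambda>e. x \<in> e \<and> \<not> e \<subseteq> X"], of real] by simp
    also have "(\<Sum>T\<in>?S. real (?b T)) = real (card {e \<in> edges H. x \<in> e}) * real (r choose t)"
      using arg_cong[OF sum_card_containing[OF H, of "\<lambda>e. x \<in> e"], of real] by simp
    also have "p * N powr (p - 1) * (real (card {e \<in> edges H. x \<in> e \<and> \<not> e \<subseteq> X}) * real (r choose t)
        + \<omega> * (real (card {e \<in> edges H. x \<in> e}) * real (r choose t)))
      = C * N powr (p - 1) * (real (card {e \<in> edges H. x \<in> e \<and> \<not> e \<subseteq> X}) + \<omega> * real (card {e \<in> edges H. x \<in> e}))"
      by (simp add: C_def algebra_simps)
    also have "\<dots> \<le> C * N powr (p - 1) * (2 * \<omega> * real ?n ^ (r - 1))"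
      using total C by (intro mult_left_mono) auto
    also have "\<dots> = \<kappa> * (N powr (p - 1) * real ?n ^ (r - 1))" using C by (simp add: \<omega>_def)
    also have "N powr (p - 1) * real ?n ^ (r - 1) = real ?n powr (exponent - 1)"
    proof -
      have "N powr (p - 1) * real ?n ^ (r - 1) = real ?n powr (real (r - t) * (p - 1)) * real ?n powr (real (r - 1))"
        using n0 by (simp add: N_def powr_powr flip: powr_realpow)
      also have "\<dots> = real ?n powr (real (r - t) * (p - 1) + real (r - 1))" by (simp add: powr_add)
      also have "real (r - t) * (p - 1) + real (r - 1) = exponent - 1"
        using t_ge_1 t_less_r by (simp add: exponent_def of_nat_diff algebra_simps)
      finally show ?thesis .
    qed
    finally show ?thesis .
  qed
  ultimately show ?thesis by blast
qed

end


subsection \<open>Stability from vertex extendability\<close>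

text \<open>Distance is counted in missing vertices rather than edges: this is what vertex
  extendability can repair, one vertex at a time.\<close>

definition close_to :: "'a hgraph set \<Rightarrow> real \<Rightarrow> 'a hgraph \<Rightarrow> bool" where
  "close_to \<HH> \<gamma> H \<longleftrightarrow>
     (\<exists>W\<subseteq>verts H. real (card (verts H - W)) \<le> \<gamma> * real (order_of H) \<and> induced H W \<in> \<HH>)"

text \<open>A second-order expansion with explicit error: for \<open>y = D * \<zeta>\<close> the
  chain is \<open>exp (- y) \<le> 1 / (1 + y) \<le> 1 - y + y * y\<close>.\<close>

lemma one_minus_powr_le:
  fixes \<zeta> D :: real
  assumes "0 \<le> \<zeta>" "\<zeta> \<le> 1" "0 \<le> D"
  shows "(1 - \<zeta>) powr D \<le> 1 - D * \<zeta> + (D * \<zeta>)\<^sup>2"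
proof -
  define y where "y = D * \<zeta>"
  have y: "0 \<le> y" using assms by (simp add: y_def)
  have "(1 - \<zeta>) powr D \<le> exp (- \<zeta>) powr D"
    using assms exp_ge_add_one_self[of "- \<zeta>"] by (intro powr_mono2) auto
  also have "\<dots> = exp (- y)" by (simp add: powr_def y_def)
  also have "\<dots> \<le> 1 / (1 + y)"
    using y exp_ge_add_one_self[of y] by (simp add: exp_minus field_simps)
  also have "\<dots> \<le> 1 - y + y\<^sup>2"
  proof -
    have "1 \<le> (1 - y + y\<^sup>2) * (1 + y)"
      using y by (simp add: algebra_simps power2_eq_square)
    then show ?thesis using y by (simp add: pos_divide_le_eq)
  qed
  finally show ?thesis by (simp add: y_def)
qed

text \<open>Instantiated for both families, with limits \<open>L\<close> and \<open>L'\<close>.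
  Blowup invariance, assumed for only one of them, is therefore a hypothesis of
  \<open>close_to_of_symmetrized_stable\<close> instead.\<close>

locale tp_limit = tp_setting +
  fixes \<F> :: "nat hgraph set" and L :: real
  assumes family: "\<forall>F\<in>\<F>. rgraph r F"
    and L_pos: "0 < L" and L_le: "r \<le> n \<Longrightarrow> L \<le> ex_density n \<F>"
    and L_limit: "0 < \<eta> \<Longrightarrow> \<exists>N. \<forall>n\<ge>N. ex_density n \<F> \<le> L + \<eta>"
begin

lemma exdeg_eq: "r \<le> n \<Longrightarrow> exdeg_tp r t p n \<F> = exponent * ex_density n \<F> * complete_norm n / real n"
  by (simp add: exdeg_tp_eq ex_tp_eq)

lemma exdeg_nonneg: "r \<le> n \<Longrightarrow> 0 \<le> exdeg_tp r t p n \<F>"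
  using L_le[of n] L_pos exponent_pos complete_norm_nonneg[of n] by (simp add: exdeg_eq)

text \<open>Otherwise remove a set \<open>Z\<close> of about \<open>\<gamma>' * n\<close> such
  vertices, a fraction \<open>\<zeta>\<close>, and let \<open>y = exponent * \<zeta>\<close>. The
  remaining norm is at least about \<open>1 - (1 - \<alpha>) * y\<close> times the extremal one, yet
  with so few vertices it is at most about \<open>1 - y + y * y\<close> times it. For small
  \<open>y\<close> these contradict each other.\<close>

lemma few_low_degree_vertices:
  assumes \<alpha>: "0 < \<alpha>" "\<alpha> \<le> 1" and \<gamma>: "0 < \<gamma>"
  shows "\<exists>\<epsilon>>0. \<exists>N. \<forall>H :: nat hgraph. rgraph r H \<longrightarrow> free \<F> H \<longrightarrow> N \<le> order_of H \<longrightarrow> (1 - \<epsilon>) * L \<le> density H \<longrightarrow>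
    real (card {v \<in> verts H. tp_degree t p H v < (1 - \<alpha>) * exdeg_tp r t p (order_of H) \<F>}) \<le> \<gamma> * real (order_of H)"
proof -
  define D where "D = exponent"
  have D: "1 \<le> D" using exponent_ge_1 by (simp add: D_def)
  \<comment> \<open>\<open>D * \<gamma>' \<le> \<alpha> / 2\<close> keeps the quadratic error
    \<open>y * y\<close> below half of the gain \<open>\<alpha> * y\<close>;
    \<open>\<gamma>' \<le> 1 / 2\<close> leaves at least half of the vertices, so that the limit
    \<open>L\<close> still governs what is left.\<close>
  define \<gamma>' where "\<gamma>' = min \<gamma> (min (\<alpha> / (2 * D)) (1 / 2))"
  have \<gamma>': "0 < \<gamma>'" "\<gamma>' \<le> \<gamma>" "\<gamma>' \<le> 1 / 2" "D * \<gamma>' \<le> \<alpha> / 2"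
  proof -
    show "0 < \<gamma>'" "\<gamma>' \<le> \<gamma>" using \<alpha> \<gamma> D by (auto simp: \<gamma>'_def)
    show "\<gamma>' \<le> 1 / 2" unfolding \<gamma>'_def by (intro min.coboundedI2 order_refl)
    have "D * \<gamma>' \<le> D * (\<alpha> / (2 * D))" using D by (intro mult_left_mono) (auto simp: \<gamma>'_def)
    then show "D * \<gamma>' \<le> \<alpha> / 2" using D by simp
  qed
  \<comment> \<open>The gain left after the quadratic error is at least
    \<open>\<alpha> * D * \<gamma>' / 4 = 4 * \<epsilon>\<close>, while the deviations from the
    limit cost at most \<open>3 * \<epsilon>\<close>.\<close>
  define \<epsilon> where "\<epsilon> = \<alpha> * D * \<gamma>' / 16"
  have \<epsilon>: "0 < \<epsilon>" using \<alpha> D \<gamma>' by (simp add: \<epsilon>_def)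
  obtain N1 where N1: "\<And>n. N1 \<le> n \<Longrightarrow> ex_density n \<F> \<le> L + \<epsilon> * L"
    using L_limit[of "\<epsilon> * L"] \<epsilon> L_pos by auto
  \<comment> \<open>\<open>N1\<close> and \<open>r\<close> are doubled because the vertex set may be
    halved; \<open>2 / \<gamma>'\<close> makes rounding down to \<open>z\<close> lose at most
    half.\<close>
  define N where "N = 2 * N1 + 2 * r + nat \<lceil>2 / \<gamma>'\<rceil> + 1"
  have "real (card {v \<in> verts H. tp_degree t p H v < (1 - \<alpha>) * exdeg_tp r t p (order_of H) \<F>}) \<le> \<gamma> * real (order_of H)"
    if H: "rgraph r H" "free \<F> H" and nN: "N \<le> order_of H" and dens: "(1 - \<epsilon>) * L \<le> density H" for H :: "nat hgraph"
  proof (rule ccontr)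
    let ?n = "order_of H"
    let ?Z = "{v \<in> verts H. tp_degree t p H v < (1 - \<alpha>) * exdeg_tp r t p ?n \<F>}"
    assume "\<not> ?thesis"
    then have many: "\<gamma> * real ?n < real (card ?Z)" by simp
    have fin: "finite (verts H)" using rgraphD(1)[OF H(1)] .
    have n: "2 * r \<le> ?n" "2 * N1 \<le> ?n" "0 < ?n" "2 / \<gamma>' \<le> real ?n"
      using nN unfolding N_def by linarith+
    define z where "z = nat \<lfloor>\<gamma>' * real ?n\<rfloor>"
    have z: "real z \<le> \<gamma>' * real ?n" "\<gamma>' * real ?n - 1 < real z"
      using \<gamma>'(1) unfolding z_def by (auto simp: of_nat_nat)
    have "\<gamma>' * real ?n \<le> \<gamma> * real ?n" using \<gamma>'(2) by (intro mult_right_mono) auto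
    then have "z \<le> card ?Z" using many z(1) by linarith
    then obtain Z where Z: "Z \<subseteq> ?Z" "card Z = z" "finite Z"
      by (rule obtain_subset_with_card_n)
    have ZV: "Z \<subseteq> verts H" using Z(1) by blast
    define \<zeta> where "\<zeta> = real z / real ?n"
    have \<zeta>: "0 \<le> \<zeta>" "\<zeta> \<le> \<gamma>'" "\<gamma>' / 2 \<le> \<zeta>"
    proof -
      show "0 \<le> \<zeta>" "\<zeta> \<le> \<gamma>'" using z(1) n(3) by (auto simp: \<zeta>_def pos_divide_le_eq)
      have "2 \<le> \<gamma>' * real ?n" using n(4) \<gamma>'(1) by (simp add: field_simps)
      then have "\<gamma>' / 2 * real ?n \<le> real z" using z(2) by linarith
      then show "\<gamma>' / 2 \<le> \<zeta>" using n(3) by (simp add: \<zeta>_def pos_le_divide_eq)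
    qed
    define y where "y = D * \<zeta>"
    have y: "0 \<le> y" "y \<le> \<alpha> / 2" "D * \<gamma>' / 2 \<le> y"
    proof -
      show "0 \<le> y" using D \<zeta> by (simp add: y_def)
      have "y \<le> D * \<gamma>'" using \<zeta>(2) D by (simp add: y_def)
      then show "y \<le> \<alpha> / 2" using \<gamma>'(4) by linarith
      have "D * (\<gamma>' / 2) \<le> y" unfolding y_def using \<zeta>(3) D by (intro mult_left_mono) auto
      then show "D * \<gamma>' / 2 \<le> y" by simp
    qed
    let ?M = "complete_norm ?n"
    have M: "0 < ?M" using n(1) by (intro complete_norm_pos) simp
    have LM: "0 < L * ?M" using L_pos M by simp
    have zn: "real z \<le> real ?n / 2"
    proof -
      have "\<gamma>' * real ?n \<le> 1 / 2 * real ?n" using \<gamma>'(3) by (intro mult_right_mono) auto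
      then show ?thesis using z(1) by linarith
    qed
    have norm: "(1 - \<epsilon>) * (L * ?M) \<le> tp_norm t p H"
    proof -
      have "(1 - \<epsilon>) * L * ?M \<le> density H * ?M" using dens M by (intro mult_right_mono) auto
      then show ?thesis using tp_norm_eq[of H] n(1) by (simp add: mult.assoc)
    qed
    have deg: "(\<Sum>v\<in>Z. tp_degree t p H v) \<le> y * (1 - \<alpha>) * (1 + \<epsilon>) * (L * ?M)"
    proof -
      have "(\<Sum>v\<in>Z. tp_degree t p H v) \<le> (\<Sum>v\<in>Z. (1 - \<alpha>) * exdeg_tp r t p ?n \<F>)"
        using Z(1) by (intro sum_mono) auto
      also have "\<dots> = y * (1 - \<alpha>) * (ex_density ?n \<F> * ?M)"
        using n(1) Z(2) by (simp add: exdeg_eq y_def \<zeta>_def D_def)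
      also have "\<dots> \<le> y * (1 - \<alpha>) * ((L + \<epsilon> * L) * ?M)"
        using N1[of ?n] n(2) y(1) \<alpha>(2) M by (intro mult_left_mono mult_right_mono) auto
      finally show ?thesis by (simp add: algebra_simps)
    qed
    have up: "tp_norm t p (induced H (verts H - Z)) \<le> (1 + \<epsilon>) * (1 - y + y\<^sup>2) * (L * ?M)"
    proof -
      have ord: "order_of (induced H (verts H - Z)) = ?n - z"
        using Z(2,3) ZV by (simp add: order_of_def card_Diff_subset)
      have nz: "real (?n - z) = real ?n - real z" using zn by (simp add: of_nat_diff)
      have r: "r \<le> ?n - z" "N1 \<le> ?n - z" using zn n(1,2) by linarith+
      have q: "real (?n - z) / real ?n = 1 - \<zeta>" using n(3) nz by (simp add: \<zeta>_def diff_divide_distrib)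
      have "tp_norm t p (induced H (verts H - Z)) \<le> ex_tp r t p (?n - z) \<F>"
        using tp_norm_le_ex[OF rgraph_induced[OF H(1)] free_induced[OF family H(2)], of "verts H - Z"] ord by auto
      also have "\<dots> = ex_density (?n - z) \<F> * complete_norm (?n - z)" using r(1) by (rule ex_tp_eq)
      also have "\<dots> \<le> (L + \<epsilon> * L) * ((1 - y + y\<^sup>2) * ?M)"
      proof (rule mult_mono)
        show "ex_density (?n - z) \<F> \<le> L + \<epsilon> * L" using N1 r(2) by blast
        have "complete_norm (?n - z) \<le> (1 - \<zeta>) powr D * ?M"
          using complete_norm_ratio[of "?n - z" ?n] n(3) by (simp add: q D_def)
        also have "\<dots> \<le> (1 - y + y\<^sup>2) * ?M"
          using one_minus_powr_le[of \<zeta> D] \<zeta> \<gamma>' D M by (intro mult_right_mono) (auto simp: y_def)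
        finally show "complete_norm (?n - z) \<le> (1 - y + y\<^sup>2) * ?M" .
      qed (use L_pos \<epsilon> complete_norm_nonneg in auto)
      finally show ?thesis by (simp add: algebra_simps)
    qed
    have "(1 - \<epsilon>) * (L * ?M) - y * (1 - \<alpha>) * (1 + \<epsilon>) * (L * ?M) \<le> (1 + \<epsilon>) * (1 - y + y\<^sup>2) * (L * ?M)"
      using tp_norm_remove_set[OF H(1) Z(3) ZV] norm deg up by linarith
    then have "((1 - \<epsilon>) - y * (1 - \<alpha>) * (1 + \<epsilon>)) * (L * ?M) \<le> ((1 + \<epsilon>) * (1 - y + y\<^sup>2)) * (L * ?M)"
      by (simp only: left_diff_distrib)
    then have "(1 - \<epsilon>) - y * (1 - \<alpha>) * (1 + \<epsilon>) \<le> (1 + \<epsilon>) * (1 - y + y\<^sup>2)"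
      using LM by (simp only: mult_le_cancel_right)
    then have "\<alpha> * y - y\<^sup>2 \<le> \<epsilon> * (2 - \<alpha> * y + y\<^sup>2)"
      by (simp add: algebra_simps)
    also have "\<dots> \<le> \<epsilon> * 3"
    proof (rule mult_left_mono)
      have "y\<^sup>2 \<le> 1" using y \<alpha> by (simp add: power_le_one)
      moreover have "0 \<le> \<alpha> * y" using y \<alpha> by simp
      ultimately show "2 - \<alpha> * y + y\<^sup>2 \<le> 3" by linarith
    qed (use \<epsilon> in simp)
    finally have 1: "\<alpha> * y - y\<^sup>2 \<le> 3 * \<epsilon>" by simp
    have "y * y \<le> (\<alpha> / 2) * y" using y by (intro mult_right_mono) auto
    then have 2: "\<alpha> / 2 * y \<le> \<alpha> * y - y\<^sup>2" by (simp add: power2_eq_square)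
    have "\<alpha> / 2 * (D * \<gamma>' / 2) \<le> \<alpha> / 2 * y" using y \<alpha> by (intro mult_left_mono) auto
    then have "4 * \<epsilon> \<le> \<alpha> / 2 * y" by (simp add: \<epsilon>_def)
    then show False using 1 2 \<epsilon> by linarith
  qed
  with \<epsilon> show ?thesis by (intro exI[of _ \<epsilon>] conjI exI[of _ N] allI impI)
qed

lemma exdeg_lower:
  "\<exists>c>0. \<forall>n\<ge>2 * r. c * real n powr (exponent - 1) \<le> exdeg_tp r t p n \<F>"
proof -
  obtain c where c: "0 < c" "\<And>n. 2 * r \<le> n \<Longrightarrow> c * real n powr exponent \<le> complete_norm n"
    using complete_norm_lower by blast
  have "exponent * L * c * real n powr (exponent - 1) \<le> exdeg_tp r t p n \<F>" if n: "2 * r \<le> n" for n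
  proof -
    have n0: "0 < n" using n t_less_r by simp
    have "exponent * L * c * real n powr (exponent - 1) = exponent * L * (c * real n powr exponent) / real n"
      using n0 by (simp add: powr_diff)
    also have "\<dots> \<le> exponent * ex_density n \<F> * complete_norm n / real n"
    proof (intro divide_right_mono mult_mono)
      show "L \<le> ex_density n \<F>" using L_le[of n] n by simp
      then show "0 \<le> exponent * ex_density n \<F>" using L_pos exponent_pos by simp
    qed (use c n exponent_pos L_pos in auto)
    finally show ?thesis using n by (simp add: exdeg_eq)
  qed
  moreover have "0 < exponent * L * c" using exponent_pos L_pos c by simp
  ultimately show ?thesis by blast
qed

text \<open>\<open>complete_norm n / n\<close> does not decrease because the exponent is at least 1,
  and the densities eventually lie between \<open>L\<close> and \<open>(1 + \<eta>) * L\<close>. The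
  point is that extendability measures degrees in a subgraph against the threshold for its own
  order, while degrees are known relative to the order of the whole graph.\<close>

lemma exdeg_almost_mono:
  assumes "0 < \<eta>"
  shows "\<exists>N. \<forall>k\<ge>N. \<forall>n\<ge>k. exdeg_tp r t p k \<F> \<le> (1 + \<eta>) * exdeg_tp r t p n \<F>"
proof -
  obtain N where N: "\<And>n. N \<le> n \<Longrightarrow> ex_density n \<F> \<le> L + \<eta> * L"
    using L_limit[of "\<eta> * L"] assms L_pos by auto
  have "exdeg_tp r t p k \<F> \<le> (1 + \<eta>) * exdeg_tp r t p n \<F>" if k: "N + r \<le> k" "k \<le> n" for k n
  proof -
    have k0: "0 < k" "r \<le> k" "0 < n" "r \<le> n" using k t_less_r by auto
    have "(real k / real n) powr exponent \<le> (real k / real n) powr 1"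
      using k0 k exponent_ge_1 by (intro powr_mono') auto
    then have "(real k / real n) powr exponent * complete_norm n \<le> real k / real n * complete_norm n"
      using complete_norm_nonneg[of n] k0 by (intro mult_right_mono) auto
    then have "complete_norm k \<le> real k / real n * complete_norm n"
      using complete_norm_ratio[OF k(2) k0(3)] by linarith
    then have ratio: "complete_norm k / real k \<le> complete_norm n / real n"
      using k0 by (simp add: field_simps)
    have "exdeg_tp r t p k \<F> = exponent * (ex_density k \<F> * (complete_norm k / real k))"
      using k0 by (simp add: exdeg_eq)
    also have "\<dots> \<le> exponent * ((L + \<eta> * L) * (complete_norm n / real n))"
      using N[of k] k ratio exponent_pos L_pos assms complete_norm_nonneg[of k]
      by (intro mult_left_mono mult_mono) auto
    also have "\<dots> = (1 + \<eta>) * (exponent * (L * (complete_norm n / real n)))" by (simp add: algebra_simps)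
    also have "\<dots> \<le> (1 + \<eta>) * (exponent * (ex_density n \<F> * (complete_norm n / real n)))"
      using L_le[OF k0(4)] exponent_pos assms complete_norm_nonneg[of n]
      by (intro mult_left_mono mult_right_mono) auto
    also have "\<dots> = (1 + \<eta>) * exdeg_tp r t p n \<F>" using k0 by (simp add: exdeg_eq)
    finally show ?thesis .
  qed
  then show ?thesis by blast
qed

text \<open>A rough closeness to \<open>\<HH>\<close> of a graph with almost extremal norm improves itself: starting
  from a large induced member of \<open>\<HH>\<close>, vertex extendability allows adding back all vertices
  whose degree is not too low.\<close>

lemma bootstrap:
  assumes her: "hereditary r \<HH>" and ext: "vertex_extendable r t p \<F> \<HH>"
  shows "\<exists>\<gamma>0>0. \<forall>\<gamma>>0. \<exists>\<epsilon>>0. \<exists>N. \<forall>H :: nat hgraph. rgraph r H \<longrightarrow> free \<F> H \<longrightarrow> N \<le> order_of H \<longrightarrow>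
     (1 - \<epsilon>) * L \<le> density H \<longrightarrow> close_to \<HH> \<gamma>0 H \<longrightarrow>
     close_to \<HH> \<gamma> H \<and> ((1 - \<epsilon>) * exdeg_tp r t p (order_of H) \<F> \<le> min_tp_degree t p H \<longrightarrow> H \<in> \<HH>)"
proof -
  obtain \<epsilon>0 N0 where \<epsilon>0: "0 < \<epsilon>0" and ext1: "\<forall>H. rgraph r H \<and> free \<F> H \<and> order_of H \<ge> N0
        \<and> min_tp_degree t p H \<ge> (1 - \<epsilon>0) * exdeg_tp r t p (order_of H) \<F>
        \<longrightarrow> (\<exists>v\<in>verts H. remove_vertex H v \<in> \<HH>) \<longrightarrow> H \<in> \<HH>"
    using ext unfolding vertex_extendable_def by (elim exE conjE)
  have ext0: "H \<in> \<HH>" if "rgraph r H" "free \<F> H" "N0 \<le> order_of H"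
    "(1 - \<epsilon>0) * exdeg_tp r t p (order_of H) \<F> \<le> min_tp_degree t p H"
    "v \<in> verts H" "remove_vertex H v \<in> \<HH>" for H :: "nat hgraph" and v
    by (rule ext1[rule_format]) (use that in \<open>auto intro: bexI[of _ v]\<close>)
  define \<epsilon>1 where "\<epsilon>1 = min \<epsilon>0 1"
  have \<epsilon>1: "0 < \<epsilon>1" "\<epsilon>1 \<le> \<epsilon>0" "\<epsilon>1 \<le> 1" using \<epsilon>0 by (auto simp: \<epsilon>1_def)
  obtain c where c: "0 < c" and exdeg_c: "\<And>n. 2 * r \<le> n \<Longrightarrow> c * real n powr (exponent - 1) \<le> exdeg_tp r t p n \<F>"
    using exdeg_lower by blast
  \<comment> \<open>The tolerance \<open>\<epsilon>1\<close> is split in three: one half defines low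
    degree (\<open>\<alpha>\<close>), one quarter is lost on passing to an induced subgraph, one
    quarter on comparing thresholds of different orders.\<close>
  have "0 < \<epsilon>1 / 4 * c" using \<epsilon>1 c by simp
  from degree_loss[OF this, where 'a = nat] obtain \<gamma>1 N1 where \<gamma>1: "0 < \<gamma>1"
    and loss: "\<forall>(H :: nat hgraph) X x. rgraph r H \<longrightarrow> N1 \<le> order_of H \<longrightarrow> X \<subseteq> verts H \<longrightarrow> x \<in> X \<longrightarrow>
     real (card (verts H - X)) \<le> \<gamma>1 * real (order_of H) \<longrightarrow>
     tp_degree t p H x - tp_degree t p (induced H X) x \<le> \<epsilon>1 / 4 * c * real (order_of H) powr (exponent - 1)"
    by (elim exE conjE)
  obtain N2 where N2: "\<And>k n. N2 \<le> k \<Longrightarrow> k \<le> n \<Longrightarrow> exdeg_tp r t p k \<F> \<le> (1 + \<epsilon>1 / 4) * exdeg_tp r t p n \<F>"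
    using exdeg_almost_mono[of "\<epsilon>1 / 4"] \<epsilon>1 by auto
  \<comment> \<open>At most \<open>\<gamma>0 * n\<close> vertices are outside \<open>W\<close> and
    at most as many have low degree, so \<open>2 * \<gamma>0 \<le> \<gamma>1\<close> is what
    \<open>loss\<close> demands; \<open>\<gamma>0 \<le> 1 / 4\<close> keeps at least half of the
    vertices. No target \<open>\<gamma>\<close> has entered yet.\<close>
  define \<gamma>0 where "\<gamma>0 = min (\<gamma>1 / 2) (1 / 4)"
  have \<gamma>0: "0 < \<gamma>0" "2 * \<gamma>0 \<le> \<gamma>1" "\<gamma>0 \<le> 1 / 4" using \<gamma>1 by (auto simp: \<gamma>0_def)
  have "\<exists>\<epsilon>>0. \<exists>N. \<forall>H :: nat hgraph. rgraph r H \<longrightarrow> free \<F> H \<longrightarrow> N \<le> order_of H \<longrightarrow>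
     (1 - \<epsilon>) * L \<le> density H \<longrightarrow> close_to \<HH> \<gamma>0 H \<longrightarrow>
     close_to \<HH> \<gamma> H \<and> ((1 - \<epsilon>) * exdeg_tp r t p (order_of H) \<F> \<le> min_tp_degree t p H \<longrightarrow> H \<in> \<HH>)"
    if \<gamma>: "0 < \<gamma>" for \<gamma>
  proof -
    define \<gamma>' where "\<gamma>' = min \<gamma> \<gamma>0"
    have \<gamma>': "0 < \<gamma>'" "\<gamma>' \<le> \<gamma>" "\<gamma>' \<le> \<gamma>0" using \<gamma> \<gamma>0 by (auto simp: \<gamma>'_def)
    define \<alpha> where "\<alpha> = \<epsilon>1 / 2"
    have \<alpha>: "0 < \<alpha>" "\<alpha> \<le> 1" using \<epsilon>1 by (auto simp: \<alpha>_def)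
    obtain \<epsilon>2 N3 where \<epsilon>2: "0 < \<epsilon>2"
      and few: "\<forall>H :: nat hgraph. rgraph r H \<longrightarrow> free \<F> H \<longrightarrow> N3 \<le> order_of H \<longrightarrow> (1 - \<epsilon>2) * L \<le> density H \<longrightarrow>
       real (card {v \<in> verts H. tp_degree t p H v < (1 - \<alpha>) * exdeg_tp r t p (order_of H) \<F>}) \<le> \<gamma>' * real (order_of H)"
      using few_low_degree_vertices[OF \<alpha> \<gamma>'(1)] by (elim exE conjE)
    define \<epsilon> where "\<epsilon> = min \<epsilon>2 \<alpha>"
    have \<epsilon>: "0 < \<epsilon>" "\<epsilon> \<le> \<epsilon>2" "\<epsilon> \<le> \<alpha>" using \<epsilon>2 \<alpha> by (auto simp: \<epsilon>_def)
    define N where "N = N3 + N1 + 2 * (N0 + N2 + r)"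
    have "close_to \<HH> \<gamma> H \<and> ((1 - \<epsilon>) * exdeg_tp r t p (order_of H) \<F> \<le> min_tp_degree t p H \<longrightarrow> H \<in> \<HH>)"
      if H: "rgraph r H" "free \<F> H" and nN: "N \<le> order_of H" and dens: "(1 - \<epsilon>) * L \<le> density H"
        and cl: "close_to \<HH> \<gamma>0 H" for H :: "nat hgraph"
    proof -
      let ?n = "order_of H"
      have n: "N3 \<le> ?n" "N1 \<le> ?n" "2 * (N0 + N2 + r) \<le> ?n" using nN by (auto simp: N_def)
      have fin: "finite (verts H)" using rgraphD(1)[OF H(1)] .
      have ed: "0 \<le> exdeg_tp r t p ?n \<F>" using n(3) by (intro exdeg_nonneg) simp
      define Z where "Z = {v \<in> verts H. tp_degree t p H v < (1 - \<alpha>) * exdeg_tp r t p ?n \<F>}"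
      have "(1 - \<epsilon>2) * L \<le> (1 - \<epsilon>) * L" using \<epsilon>(2) L_pos by (intro mult_right_mono) auto
      then have Z: "real (card Z) \<le> \<gamma>' * real ?n" using few[rule_format, OF H n(1)] dens by (simp add: Z_def)
      obtain W where W: "W \<subseteq> verts H" "real (card (verts H - W)) \<le> \<gamma>0 * real ?n" "induced H W \<in> \<HH>"
        using cl unfolding close_to_def by blast
      \<comment> \<open>Heredity drops the low degree vertices from \<open>W\<close>; the high
        degree ones can then return in any order. Every intermediate set avoids \<open>Z\<close> and
        misses few vertices, so all its vertices, not just the new one, keep the degree that
        extendability asks for.\<close>
      have extend: "induced H ((W - Z) \<union> Y) \<in> \<HH>" if "finite Y" "Y \<subseteq> verts H - Z" for Y
        using that
      proof (induction Y rule: finite_induct)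
        case empty
        then show ?case using hereditary_induced[OF her H(1) W(3), of "W - Z"] W(1) by auto
      next
        case (insert y Y)
        define X where "X = (W - Z) \<union> insert y Y"
        let ?G = "induced H X"
        have IH: "induced H ((W - Z) \<union> Y) \<in> \<HH>" using insert by blast
        have "?G \<in> \<HH>"
        proof (cases "y \<in> W - Z")
          case True
          then have "(W - Z) \<union> insert y Y = (W - Z) \<union> Y" by blast
          then show ?thesis using IH by (simp add: X_def)
        next
          case False
          have X: "X \<subseteq> verts H" "X \<inter> Z = {}" "y \<in> X" using insert.prems W(1) unfolding X_def by auto
          have missing: "real (card (verts H - X)) \<le> 2 * \<gamma>0 * real ?n"
          proof -
            have "card (verts H - X) \<le> card ((verts H - W) \<union> Z)"
              using fin by (intro card_mono) (auto simp: Z_def X_def)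
            also have "\<dots> \<le> card (verts H - W) + card Z" by (rule card_Un_le)
            finally have "real (card (verts H - X)) \<le> real (card (verts H - W)) + real (card Z)" by simp
            moreover have "\<gamma>' * real ?n \<le> \<gamma>0 * real ?n" using \<gamma>'(3) by (intro mult_right_mono) auto
            ultimately show ?thesis using W(2) Z by linarith
          qed
          have ordG: "order_of ?G = card X" by (simp add: order_of_def)
          have Xn: "card X \<le> ?n" using X(1) fin by (simp add: order_of_def card_mono)
          have finX: "finite X" by (rule finite_subset[OF X(1) fin])
          have "card (verts H - X) = ?n - card X"
            unfolding order_of_def using finX X(1) by (rule card_Diff_subset)
          then have "real ?n - real (card X) \<le> 2 * \<gamma>0 * real ?n" using missing Xn by (simp add: of_nat_diff)
          moreover have "2 * \<gamma>0 * real ?n \<le> 1 / 2 * real ?n" using \<gamma>0(3) by (intro mult_right_mono) auto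
          ultimately have "real ?n / 2 \<le> real (card X)" by linarith
          then have "real ?n \<le> real (2 * card X)" by simp
          then have "?n \<le> 2 * card X" by (simp only: of_nat_le_iff)
          with n(3) have "2 * (N0 + N2 + r) \<le> 2 * card X" by (rule order_trans)
          then have k: "N0 + N2 + r \<le> card X" by (simp only: mult_le_cancel1)
          have "2 * \<gamma>0 * real ?n \<le> \<gamma>1 * real ?n" using \<gamma>0(2) by (intro mult_right_mono) auto
          then have missing1: "real (card (verts H - X)) \<le> \<gamma>1 * real ?n" using missing by linarith
          have edk: "0 \<le> exdeg_tp r t p (card X) \<F>" using k by (intro exdeg_nonneg) simp
          have deg: "(1 - \<epsilon>0) * exdeg_tp r t p (card X) \<F> \<le> tp_degree t p ?G x" if x: "x \<in> X" for x
          proof -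
            have "(1 - \<epsilon>0) * exdeg_tp r t p (card X) \<F> \<le> (1 - \<epsilon>1) * exdeg_tp r t p (card X) \<F>"
              using \<epsilon>1(2) edk by (intro mult_right_mono) auto
            also have "\<dots> \<le> (1 - \<epsilon>1) * ((1 + \<epsilon>1 / 4) * exdeg_tp r t p ?n \<F>)"
              using N2[of "card X" ?n] k Xn \<epsilon>1(3) by (intro mult_left_mono) auto
            also have "\<dots> = (1 - 3 * \<epsilon>1 / 4 - \<epsilon>1\<^sup>2 / 4) * exdeg_tp r t p ?n \<F>"
              by (simp add: field_simps power2_eq_square)
            also have "\<dots> \<le> (1 - 3 * \<epsilon>1 / 4) * exdeg_tp r t p ?n \<F>"
              using ed by (intro mult_right_mono) auto
            also have "\<dots> = (1 - \<alpha>) * exdeg_tp r t p ?n \<F> - \<epsilon>1 / 4 * exdeg_tp r t p ?n \<F>"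
              by (simp add: \<alpha>_def algebra_simps)
            also have "\<dots> \<le> (1 - \<alpha>) * exdeg_tp r t p ?n \<F> - \<epsilon>1 / 4 * (c * real ?n powr (exponent - 1))"
              using exdeg_c[of ?n] n(3) \<epsilon>1 by (intro diff_left_mono mult_left_mono) auto
            also have "\<dots> \<le> tp_degree t p H x - (tp_degree t p H x - tp_degree t p ?G x)"
            proof (rule diff_mono)
              have "x \<in> verts H" "x \<notin> Z" using x X by blast+
              then show "(1 - \<alpha>) * exdeg_tp r t p ?n \<F> \<le> tp_degree t p H x" by (auto simp: Z_def)
              show "tp_degree t p H x - tp_degree t p ?G x \<le> \<epsilon>1 / 4 * (c * real ?n powr (exponent - 1))"
                using loss[rule_format, OF H(1) n(2) X(1) x missing1] by (simp add: mult.assoc)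
            qed
            finally show ?thesis by simp
          qed
          have "(1 - \<epsilon>0) * exdeg_tp r t p (order_of ?G) \<F> \<le> min_tp_degree t p ?G"
            unfolding min_tp_degree_def ordG verts_induced using deg X(3) finX by (intro Min.boundedI) auto
          moreover have "remove_vertex ?G y \<in> \<HH>"
          proof -
            have "X - {y} = (W - Z) \<union> Y" using False insert.hyps unfolding X_def by blast
            then show ?thesis using remove_vertex_induced[OF H(1) X(1)] IH by simp
          qed
          ultimately show ?thesis
            using ext0[OF rgraph_induced[OF H(1) X(1)] free_induced[OF family H(2) X(1)], of y] k X(3) ordG by simp
        qed
        then show ?case by (simp only: X_def)
      qed
      have HZ: "induced H (verts H - Z) \<in> \<HH>"
      proof -
        have "(W - Z) \<union> (verts H - Z) = verts H - Z" using W(1) by blast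
        then show ?thesis using extend[of "verts H - Z"] fin by simp
      qed
      have "close_to \<HH> \<gamma> H"
        unfolding close_to_def
      proof (intro exI[of _ "verts H - Z"] conjI)
        have "verts H - (verts H - Z) = Z" by (auto simp: Z_def)
        moreover have "\<gamma>' * real ?n \<le> \<gamma> * real ?n" using \<gamma>'(2) by (intro mult_right_mono) auto
        ultimately show "real (card (verts H - (verts H - Z))) \<le> \<gamma> * real ?n" using Z by simp
      qed (use HZ in auto)
      moreover have "H \<in> \<HH>" if min: "(1 - \<epsilon>) * exdeg_tp r t p ?n \<F> \<le> min_tp_degree t p H"
      proof -
        have "tp_degree t p H v \<ge> (1 - \<alpha>) * exdeg_tp r t p ?n \<F>" if v: "v \<in> verts H" for v
        proof -
          have "(1 - \<alpha>) * exdeg_tp r t p ?n \<F> \<le> (1 - \<epsilon>) * exdeg_tp r t p ?n \<F>"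
            using \<epsilon>(3) ed by (intro mult_right_mono) auto
          also have "\<dots> \<le> min_tp_degree t p H" by (rule min)
          also have "\<dots> \<le> tp_degree t p H v" unfolding min_tp_degree_def using fin v by (intro Min_le) auto
          finally show ?thesis .
        qed
        then have "Z = {}" by (force simp: Z_def)
        then show ?thesis using HZ induced_verts[OF H(1)] by simp
      qed
      ultimately show ?thesis by blast
    qed
    with \<epsilon>(1) show ?thesis by (intro exI[of _ \<epsilon>] conjI exI[of _ N] allI impI) simp_all
  qed
  then show ?thesis using \<gamma>0(1) by (rule_tac exI[of _ \<gamma>0]) simp
qed

text \<open>The radius is reset to \<open>\<gamma>' \<le> \<gamma>0 / 2\<close> after each step,
  which leaves room for the vertex \<open>u\<close> lost when a cloning is undone. The norm bound is
  a premise inside the induction predicate: it passes from a graph to its clone, so the induction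
  hypothesis applies to the clone.\<close>

lemma close_to_of_symmetrized_stable:
  assumes her: "hereditary r \<HH>" and ext: "vertex_extendable r t p \<F> \<HH>"
    and bl: "blowup_invariant r \<F>" and st: "symmetrized_stable r \<F> \<HH>" and \<gamma>: "0 < \<gamma>"
  shows "\<exists>\<epsilon>>0. \<exists>N. \<forall>H :: nat hgraph. rgraph r H \<longrightarrow> free \<F> H \<longrightarrow> N \<le> order_of H \<longrightarrow>
     (1 - \<epsilon>) * L \<le> density H \<longrightarrow> close_to \<HH> \<gamma> H"
proof -
  obtain \<gamma>0 where \<gamma>0: "0 < \<gamma>0" and boot: "\<forall>\<gamma>>0. \<exists>\<epsilon>>0. \<exists>N. \<forall>H :: nat hgraph. rgraph r H \<longrightarrow> free \<F> H \<longrightarrow> N \<le> order_of H \<longrightarrow>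
     (1 - \<epsilon>) * L \<le> density H \<longrightarrow> close_to \<HH> \<gamma>0 H \<longrightarrow>
     close_to \<HH> \<gamma> H \<and> ((1 - \<epsilon>) * exdeg_tp r t p (order_of H) \<F> \<le> min_tp_degree t p H \<longrightarrow> H \<in> \<HH>)"
    using bootstrap[OF her ext] by (elim exE conjE)
  define \<gamma>' where "\<gamma>' = min \<gamma> (\<gamma>0 / 2)"
  have \<gamma>': "0 < \<gamma>'" "\<gamma>' \<le> \<gamma>" "\<gamma>' \<le> \<gamma>0 / 2" using \<gamma> \<gamma>0 by (auto simp: \<gamma>'_def)
  obtain \<epsilon> N where \<epsilon>: "0 < \<epsilon>" and up0: "\<forall>H :: nat hgraph. rgraph r H \<longrightarrow> free \<F> H \<longrightarrow> N \<le> order_of H \<longrightarrow>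
     (1 - \<epsilon>) * L \<le> density H \<longrightarrow> close_to \<HH> \<gamma>0 H \<longrightarrow>
     close_to \<HH> \<gamma>' H \<and> ((1 - \<epsilon>) * exdeg_tp r t p (order_of H) \<F> \<le> min_tp_degree t p H \<longrightarrow> H \<in> \<HH>)"
    using boot[rule_format, OF \<gamma>'(1)] by (elim exE conjE)
  have up: "close_to \<HH> \<gamma>' H" if "rgraph r H" "free \<F> H" "N \<le> order_of H" "(1 - \<epsilon>) * L \<le> density H"
    "close_to \<HH> \<gamma>0 H" for H :: "nat hgraph"
    using up0[rule_format, OF that] by (rule conjunct1)
  have "close_to \<HH> \<gamma> H" if H: "rgraph r H" "free \<F> H" and nN: "N + r + nat \<lceil>2 / \<gamma>0\<rceil> + 1 \<le> order_of H"
    and dens: "(1 - \<epsilon>) * L \<le> density H" for H :: "nat hgraph"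
  proof -
    let ?n = "order_of H"
    have n: "N \<le> ?n" "2 / \<gamma>0 \<le> real ?n" "r \<le> ?n" using nN by linarith+
    have n1: "1 \<le> \<gamma>0 / 2 * real ?n" using n(2) \<gamma>0 by (simp add: field_simps)
    have "(1 - \<epsilon>) * L * complete_norm ?n \<le> tp_norm t p H \<longrightarrow> close_to \<HH> \<gamma>' H"
    proof (rule symmetrization_induct[OF family bl H,
        where Q = "\<lambda>G. (1 - \<epsilon>) * L * complete_norm ?n \<le> tp_norm t p G \<longrightarrow> close_to \<HH> \<gamma>' G"]; intro impI)
      fix G :: "nat hgraph"
      assume "rgraph r G" "free \<F> G" "symmetrized r G"
      then have G: "rgraph r G" "G \<in> \<HH>" using st by (auto simp: symmetrized_stable_def)
      show "close_to \<HH> \<gamma>' G" unfolding close_to_def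
        using G induced_verts[OF G(1)] \<gamma>' by (intro exI[of _ "verts G"]) simp
    next
      fix G :: "nat hgraph" and u v
      let ?K = "clone G u v"
      assume G: "rgraph r G" "free \<F> G" "order_of G = ?n" and uv: "u \<in> verts G" "v \<in> verts G"
        and le: "tp_norm t p G \<le> tp_norm t p ?K"
        and IH: "(1 - \<epsilon>) * L * complete_norm ?n \<le> tp_norm t p ?K \<longrightarrow> close_to \<HH> \<gamma>' ?K"
        and normG: "(1 - \<epsilon>) * L * complete_norm ?n \<le> tp_norm t p G"
      have "close_to \<HH> \<gamma>' ?K" by (rule IH[rule_format]) (use normG le in linarith)
      then obtain W where W: "W \<subseteq> verts G" "real (card (verts G - W)) \<le> \<gamma>' * real ?n" "induced ?K W \<in> \<HH>"
        unfolding close_to_def by (auto simp: G(3))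
      have fin: "finite (verts G)" using rgraphD(1)[OF G(1)] .
      have "induced ?K (W - {u}) \<in> \<HH>"
        using hereditary_induced[OF her rgraph_clone[OF G(1) uv] W(3), of "W - {u}"] W(1) by auto
      then have "induced G (W - {u}) \<in> \<HH>" by (simp add: induced_clone)
      moreover have "real (card (verts G - (W - {u}))) \<le> \<gamma>0 * real (order_of G)"
      proof -
        have "card (verts G - (W - {u})) \<le> card (insert u (verts G - W))"
          using fin by (intro card_mono) auto
        also have "\<dots> \<le> card (verts G - W) + 1" using fin by (simp add: card_insert_if)
        finally have "real (card (verts G - (W - {u}))) \<le> real (card (verts G - W)) + 1" by linarith
        moreover have "\<gamma>' * real ?n \<le> \<gamma>0 / 2 * real ?n" using \<gamma>'(3) by (intro mult_right_mono) auto
        ultimately show ?thesis using W(2) n1 G(3) by simp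
      qed
      ultimately have "close_to \<HH> \<gamma>0 G" unfolding close_to_def using W(1) by (intro exI[of _ "W - {u}"]) auto
      moreover have "(1 - \<epsilon>) * L \<le> density G"
        using normG complete_norm_pos[OF n(3)] by (simp add: density_def G(3) pos_le_divide_eq)
      ultimately show "close_to \<HH> \<gamma>' G" using up[OF G(1,2)] n(1) G(3) by simp
    qed
    moreover have "(1 - \<epsilon>) * L * complete_norm ?n \<le> tp_norm t p H"
      using dens complete_norm_pos[OF n(3)] by (simp add: density_def pos_le_divide_eq)
    ultimately have "close_to \<HH> \<gamma>' H" by blast
    then obtain W where W: "W \<subseteq> verts H" "real (card (verts H - W)) \<le> \<gamma>' * real ?n" "induced H W \<in> \<HH>"
      unfolding close_to_def by blast
    have "\<gamma>' * real ?n \<le> \<gamma> * real ?n" using \<gamma>'(2) by (intro mult_right_mono) auto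
    then show ?thesis unfolding close_to_def using W by (intro exI[of _ W]) auto
  qed
  with \<epsilon> show ?thesis
    by (intro exI[of _ \<epsilon>] conjI exI[of _ "N + r + nat \<lceil>2 / \<gamma>0\<rceil> + 1"] allI impI)
qed

end


subsection \<open>Supersaturation\<close>

text \<open>A theorem of Erdos; \<open>A\<close> is a multipartite hypergraph with parts indexed by \<open>I\<close>.\<close>

lemma dense_contains_box:
  fixes I :: "'i set"
  assumes "finite I" and s: "1 \<le> s"
  shows "\<forall>\<alpha>>0. \<exists>N. \<forall>(V :: 'v set) A. finite V \<longrightarrow> N \<le> card V \<longrightarrow> A \<subseteq> (I \<rightarrow>\<^sub>E V) \<longrightarrow>
    \<alpha> * real (card V) ^ card I \<le> real (card A) \<longrightarrow>
    (\<exists>Q. (\<forall>i\<in>I. Q i \<subseteq> V \<and> card (Q i) = s) \<and> PiE I Q \<subseteq> A)"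
  using assms(1)
proof (induction I rule: finite_induct)
  case empty
  show ?case
  proof (intro allI impI exI[of _ 0])
    fix \<alpha> :: real and V :: "'v set" and A :: "('i \<Rightarrow> 'v) set"
    assume "0 < \<alpha>" "A \<subseteq> ({} \<rightarrow>\<^sub>E V)" "\<alpha> * real (card V) ^ card {} \<le> real (card A)"
    then have "A \<noteq> {}" by auto
    with \<open>A \<subseteq> ({} \<rightarrow>\<^sub>E V)\<close> show "\<exists>Q. (\<forall>i\<in>{}. Q i \<subseteq> V \<and> card (Q i) = s) \<and> PiE {} Q \<subseteq> A" by auto
  qed
next
  case (insert j I)
  show ?case
  proof (intro allI impI)
    fix \<alpha> :: real assume \<alpha>: "0 < \<alpha>"
    \<comment> \<open>A proportion \<open>\<alpha> / 2\<close> of the partial tuples has at least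
      \<open>\<alpha> / 2 * n\<close> extensions, hence each of these admits at least
      \<open>(\<alpha> / (2 * s)) ^ s * n ^ s\<close> sets of \<open>s\<close> extensions.\<close>
    define \<alpha>' where "\<alpha>' = (\<alpha> / 2) * (\<alpha> / (2 * real s)) ^ s"
    have \<alpha>': "0 < \<alpha>'" using \<alpha> s by (simp add: \<alpha>'_def)
    obtain N' where N': "\<forall>(V :: 'v set) A. finite V \<longrightarrow> N' \<le> card V \<longrightarrow> A \<subseteq> (I \<rightarrow>\<^sub>E V) \<longrightarrow>
      \<alpha>' * real (card V) ^ card I \<le> real (card A) \<longrightarrow>
      (\<exists>Q. (\<forall>i\<in>I. Q i \<subseteq> V \<and> card (Q i) = s) \<and> PiE I Q \<subseteq> A)"
      using insert.IH[rule_format, OF \<alpha>'] by (elim exE)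
    let ?N = "N' + s + nat \<lceil>2 * real s / \<alpha>\<rceil>"
    show "\<exists>N. \<forall>(V :: 'v set) A. finite V \<longrightarrow> N \<le> card V \<longrightarrow> A \<subseteq> (insert j I \<rightarrow>\<^sub>E V) \<longrightarrow>
      \<alpha> * real (card V) ^ card (insert j I) \<le> real (card A) \<longrightarrow>
      (\<exists>Q. (\<forall>i\<in>insert j I. Q i \<subseteq> V \<and> card (Q i) = s) \<and> PiE (insert j I) Q \<subseteq> A)"
    proof (rule exI[of _ ?N], intro allI impI)
      fix V :: "'v set" and A :: "('i \<Rightarrow> 'v) set"
      assume V: "finite V" "?N \<le> card V" and A: "A \<subseteq> (insert j I \<rightarrow>\<^sub>E V)"
        and dense: "\<alpha> * real (card V) ^ card (insert j I) \<le> real (card A)"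
      let ?n = "card V" and ?Z = "I \<rightarrow>\<^sub>E V"
      define nb where "nb z = {v \<in> V. z(j := v) \<in> A}" for z
      have n: "N' \<le> ?n" "s \<le> ?n" "2 * real s / \<alpha> \<le> real ?n" using V(2) by linarith+
      have n0: "0 < ?n" using n(2) s by simp
      have half: "real s \<le> \<alpha> / 2 * real ?n" using n(3) \<alpha> by (simp add: field_simps)
      have finZ: "finite ?Z" using insert.hyps(1) V(1) by (intro finite_PiE) auto
      have cZ: "card ?Z = ?n ^ card I" using insert.hyps(1) by (simp add: card_PiE)
      have finA: "finite A" using A insert.hyps(1) V(1) by (auto intro: finite_subset finite_PiE)
      have nbV: "nb z \<subseteq> V" "finite (nb z)" "card (nb z) \<le> ?n" for z
        using V(1) by (auto simp: nb_def intro: card_mono)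
      have "A \<subseteq> (\<lambda>(z, v). z(j := v)) ` (SIGMA z:?Z. nb z)"
      proof
        fix f assume f: "f \<in> A"
        then have fE: "f \<in> insert j I \<rightarrow>\<^sub>E V" using A by blast
        have "f(j := undefined) \<in> ?Z" using fE insert.hyps(2) by (auto simp: PiE_def extensional_def)
        moreover have "f j \<in> nb (f(j := undefined))" using f fE by (auto simp: nb_def)
        ultimately show "f \<in> (\<lambda>(z, v). z(j := v)) ` (SIGMA z:?Z. nb z)"
          by (intro image_eqI[of _ _ "(f(j := undefined), f j)"]) auto
      qed
      then have "card A \<le> card (SIGMA z:?Z. nb z)"
        using finZ nbV(2) by (intro surj_card_le) auto
      also have "\<dots> = (\<Sum>z\<in>?Z. card (nb z))" using finZ nbV(2) by (intro card_SigmaI) auto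
      finally have "real (card A) \<le> real (\<Sum>z\<in>?Z. card (nb z))" by (rule of_nat_mono)
      then have cA: "real (card A) \<le> (\<Sum>z\<in>?Z. real (card (nb z)))" by simp
      define Good where "Good = {z \<in> ?Z. \<alpha> / 2 * real ?n \<le> real (card (nb z))}"
      have GZ: "Good \<subseteq> ?Z" "finite Good" using finZ by (auto simp: Good_def)
      have "(\<Sum>z\<in>?Z. real (card (nb z))) \<le> (\<Sum>z\<in>?Z. \<alpha> / 2 * real ?n + (if z \<in> Good then real ?n else 0))"
      proof (rule sum_mono)
        fix z assume z: "z \<in> ?Z"
        have "real (card (nb z)) \<le> real ?n" using nbV(3) by simp
        moreover have "0 \<le> \<alpha> / 2 * real ?n" using \<alpha> by simp
        moreover have "z \<notin> Good \<Longrightarrow> real (card (nb z)) \<le> \<alpha> / 2 * real ?n" using z by (auto simp: Good_def)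
        ultimately show "real (card (nb z)) \<le> \<alpha> / 2 * real ?n + (if z \<in> Good then real ?n else 0)" by auto
      qed
      also have "\<dots> = real (card ?Z) * (\<alpha> / 2 * real ?n) + (\<Sum>z\<in>?Z. if z \<in> Good then real ?n else 0)"
        by (simp add: sum.distrib)
      also have "(\<Sum>z\<in>?Z. if z \<in> Good then real ?n else 0) = real (card Good) * real ?n"
      proof -
        have "(\<Sum>z\<in>?Z. if z \<in> Good then real ?n else 0) = (\<Sum>z\<in>?Z \<inter> Good. real ?n)"
          using finZ by (rule sum.inter_restrict[symmetric])
        moreover have "?Z \<inter> Good = Good" using GZ(1) by blast
        ultimately show ?thesis by simp
      qed
      finally have "real (card A) \<le> real (card ?Z) * (\<alpha> / 2 * real ?n) + real (card Good) * real ?n"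
        using cA by linarith
      moreover have "\<alpha> * (real ?n * real ?n ^ card I) \<le> real (card A)" using dense insert.hyps by simp
      ultimately have "(\<alpha> / 2 * real ?n ^ card I) * real ?n \<le> real (card Good) * real ?n"
        by (simp add: cZ algebra_simps)
      then have good: "\<alpha> / 2 * real ?n ^ card I \<le> real (card Good)"
        using n0 by (simp only: mult_le_cancel_right)
      define P where "P = {Q. Q \<subseteq> V \<and> card Q = s}"
      have finP: "finite P" "card P = ?n choose s" using V(1) by (simp_all add: P_def n_subsets)
      \<comment> \<open>Counting pairs of an \<open>s\<close>-set \<open>Q\<close> and a partial
        tuple all of whose extensions by \<open>Q\<close> lie in \<open>A\<close> yields one
        \<open>Q0\<close> serving densely many partial tuples; the induction hypothesis for those
        provides the remaining sides of the box.\<close>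
      define B where "B Q = {z \<in> ?Z. Q \<subseteq> nb z}" for Q
      have "(\<Sum>Q\<in>P. card (B Q)) = (\<Sum>z\<in>?Z. card {Q \<in> P. Q \<subseteq> nb z})"
        unfolding B_def using finP(1) finZ by (rule sum_card_swap)
      also have "\<dots> = (\<Sum>z\<in>?Z. card (nb z) choose s)"
      proof (rule sum.cong[OF refl])
        fix z assume "z \<in> ?Z"
        have "{Q \<in> P. Q \<subseteq> nb z} = {Q. Q \<subseteq> nb z \<and> card Q = s}" using nbV(1) by (auto simp: P_def)
        then show "card {Q \<in> P. Q \<subseteq> nb z} = (card (nb z) choose s)" using nbV(2) by (simp add: n_subsets)
      qed
      also have "real \<dots> \<ge> (\<Sum>z\<in>Good. (\<alpha> / 2 * real ?n / real s) ^ s)"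
      proof -
        have "(\<Sum>z\<in>Good. (\<alpha> / 2 * real ?n / real s) ^ s) \<le> (\<Sum>z\<in>Good. real (card (nb z) choose s))"
        proof (rule sum_mono)
          fix z assume "z \<in> Good"
          then have z: "\<alpha> / 2 * real ?n \<le> real (card (nb z))" by (simp add: Good_def)
          then have "s \<le> card (nb z)" using half by linarith
          have "(\<alpha> / 2 * real ?n / real s) ^ s \<le> (real (card (nb z)) / real s) ^ s"
            using z \<alpha> by (intro power_mono divide_right_mono) auto
          also have "\<dots> \<le> real (card (nb z) choose s)"
            using binomial_ge_n_over_k_pow_k[OF \<open>s \<le> card (nb z)\<close>, where 'a = real] by simp
          finally show "(\<alpha> / 2 * real ?n / real s) ^ s \<le> real (card (nb z) choose s)" .
        qed
        also have "\<dots> \<le> (\<Sum>z\<in>?Z. real (card (nb z) choose s))" using finZ GZ by (intro sum_mono2) auto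
        finally show ?thesis by simp
      qed
      finally have e1: "real (card Good) * (\<alpha> / 2 * real ?n / real s) ^ s \<le> real (\<Sum>Q\<in>P. card (B Q))" by simp
      have e2: "\<alpha> / 2 * real ?n ^ card I * (\<alpha> / 2 * real ?n / real s) ^ s
          \<le> real (card Good) * (\<alpha> / 2 * real ?n / real s) ^ s"
        using good \<alpha> by (intro mult_right_mono) auto
      have e3: "\<alpha> / 2 * real ?n ^ card I * (\<alpha> / 2 * real ?n / real s) ^ s = real (?n ^ s) * (\<alpha>' * real ?n ^ card I)"
        by (simp add: \<alpha>'_def power_mult_distrib power_divide)
      have "real (?n ^ s) * (\<alpha>' * real ?n ^ card I) \<le> real (\<Sum>Q\<in>P. card (B Q))"
        using order_trans[OF e2 e1] unfolding e3 .
      then have big: "real (?n ^ s) * (\<alpha>' * real ?n ^ card I) \<le> (\<Sum>Q\<in>P. real (card (B Q)))"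
        by (simp only: of_nat_sum)
      have "\<exists>Q\<in>P. \<alpha>' * real ?n ^ card I \<le> real (card (B Q))"
      proof (rule ccontr)
        assume "\<not> ?thesis"
        then have less: "Q \<in> P \<Longrightarrow> real (card (B Q)) < \<alpha>' * real ?n ^ card I" for Q by force
        have "card P > 0" using finP(2) n(2) by (simp add: zero_less_binomial)
        then have "P \<noteq> {}" by auto
        then have "(\<Sum>Q\<in>P. real (card (B Q))) < (\<Sum>Q\<in>P. \<alpha>' * real ?n ^ card I)"
          using finP(1) less by (intro sum_strict_mono) auto
        also have "\<dots> = real (?n choose s) * (\<alpha>' * real ?n ^ card I)" using finP(2) by simp
        also have "\<dots> \<le> real (?n ^ s) * (\<alpha>' * real ?n ^ card I)"
          using choose_le_power[of ?n s] \<alpha>' by (intro mult_right_mono of_nat_mono) auto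
        finally show False using big by simp
      qed
      then obtain Q0 where Q0: "Q0 \<subseteq> V" "card Q0 = s" "\<alpha>' * real ?n ^ card I \<le> real (card (B Q0))"
        by (auto simp: P_def)
      have "B Q0 \<subseteq> ?Z" by (auto simp: B_def)
      from N'[rule_format, OF V(1) n(1) this Q0(3)]
      obtain Q where Q: "\<forall>i\<in>I. Q i \<subseteq> V \<and> card (Q i) = s" "PiE I Q \<subseteq> B Q0" by (elim exE conjE)
      let ?Q = "Q(j := Q0)"
      have "PiE (insert j I) ?Q \<subseteq> A"
      proof
        fix f assume f: "f \<in> PiE (insert j I) ?Q"
        have "f(j := undefined) \<in> PiE I Q"
        proof (rule PiE_I)
          fix i assume i: "i \<in> I"
          then have "i \<noteq> j" using insert.hyps(2) by blast
          moreover have "f i \<in> ?Q i" using f i by blast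
          ultimately show "(f(j := undefined)) i \<in> Q i" by simp
        next
          fix i assume i: "i \<notin> I"
          then show "(f(j := undefined)) i = undefined" using f by (cases "i = j") (auto simp: PiE_def extensional_def)
        qed
        then have "Q0 \<subseteq> nb (f(j := undefined))" using Q(2) by (auto simp: B_def)
        moreover have "f j \<in> Q0" using PiE_mem[OF f, of j] by simp
        ultimately have "(f(j := undefined))(j := f j) \<in> A" unfolding nb_def by blast
        then show "f \<in> A" by simp
      qed
      moreover have "\<forall>i\<in>insert j I. ?Q i \<subseteq> V \<and> card (?Q i) = s" using Q(1) Q0 by simp
      ultimately show "\<exists>Q. (\<forall>i\<in>insert j I. Q i \<subseteq> V \<and> card (Q i) = s) \<and> PiE (insert j I) Q \<subseteq> A"
        by (intro exI[of _ ?Q] conjI)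
    qed
  qed
qed

text \<open>Extensional maps, so that embeddings are tuples indexed by the vertices of
  \<open>G\<close> and \<open>dense_contains_box\<close> applies to them directly.\<close>

definition embeddings :: "'a hgraph \<Rightarrow> 'b hgraph \<Rightarrow> ('a \<Rightarrow> 'b) set" where
  "embeddings G H = {\<phi> \<in> verts G \<rightarrow>\<^sub>E verts H. inj_on \<phi> (verts G) \<and> homomorphism \<phi> G H}"

text \<open>A box of embeddings is a blowup of \<open>G\<close> inside \<open>H\<close>, and each
  side has room for all vertices of \<open>F\<close>. Disjointness of the sides is a consequence: a
  shared vertex would permit a choice that is not injective. The \<open>Suc\<close> keeps the sides
  nonempty and finite even if \<open>F\<close> has no vertices.\<close>

lemma contains_of_box:
  assumes G: "rgraph r G" and F: "rgraph r F" and col: "colorable F G"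
    and Q: "\<And>i. i \<in> verts G \<Longrightarrow> Q i \<subseteq> verts H \<and> card (Q i) = Suc (card (verts F))"
    and box: "PiE (verts G) Q \<subseteq> embeddings G H"
  shows "contains H F"
proof -
  obtain \<psi> where \<psi>: "\<psi> ` verts F \<subseteq> verts G" "\<And>e. e \<in> edges F \<Longrightarrow> \<psi> ` e \<in> edges G"
    using col by (auto simp: colorable_def homomorphism_def)
  have "\<forall>i\<in>verts G. \<exists>g. g ` verts F \<subseteq> Q i \<and> inj_on g (verts F)"
  proof
    fix i assume i: "i \<in> verts G"
    have "finite (Q i)" using Q[OF i] by (intro card_ge_0_finite) simp
    moreover have "card (verts F) \<le> card (Q i)" using Q[OF i] by simp
    ultimately show "\<exists>g. g ` verts F \<subseteq> Q i \<and> inj_on g (verts F)"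
      using card_le_inj[OF rgraphD(1)[OF F]] by blast
  qed
  then obtain g where g: "\<forall>i\<in>verts G. g i ` verts F \<subseteq> Q i \<and> inj_on (g i) (verts F)"
    using bchoice[of "verts G" "\<lambda>i g. g ` verts F \<subseteq> Q i \<and> inj_on g (verts F)"] by blast
  have "\<forall>i\<in>verts G. \<exists>q. q \<in> Q i"
  proof
    fix i assume "i \<in> verts G"
    then have "card (Q i) \<noteq> 0" using Q by simp
    then have "Q i \<noteq> {}" by auto
    then show "\<exists>q. q \<in> Q i" by blast
  qed
  then obtain q where q: "\<forall>i\<in>verts G. q i \<in> Q i" using bchoice[of "verts G" "\<lambda>i q. q \<in> Q i"] by blast
  define \<phi> where "\<phi> w = g (\<psi> w) w" for w
  have gQ: "g i w \<in> Q i" if "i \<in> verts G" "w \<in> verts F" for i w using g that by blast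
  have \<phi>Q: "\<phi> w \<in> Q (\<psi> w)" if "w \<in> verts F" for w using gQ[of "\<psi> w" w] \<psi>(1) that by (auto simp: \<phi>_def)
  have emb: "inj_on f (verts G)" "\<And>e. e \<in> edges G \<Longrightarrow> f ` e \<in> edges H" if "f \<in> PiE (verts G) Q" for f
    using box that by (auto simp: embeddings_def homomorphism_def)
  have "inj_on \<phi> (verts F)"
  proof (rule inj_onI, rule ccontr)
    fix w w' assume w: "w \<in> verts F" "w' \<in> verts F" "\<phi> w = \<phi> w'" "w \<noteq> w'"
    then have i: "\<psi> w \<in> verts G" "\<psi> w' \<in> verts G" using \<psi>(1) by auto
    show False
    proof (cases "\<psi> w = \<psi> w'")
      case True
      then have "g (\<psi> w) w = g (\<psi> w) w'" using w(3) by (simp add: \<phi>_def)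
      then show False using g i(1) w by (metis inj_onD)
    next
      case False
      \<comment> \<open>If \<open>w\<close> and \<open>w'\<close> had the same image, this choice
        from the box would take it at two different vertices of \<open>G\<close>.\<close>
      define f where "f i = (if i \<in> verts G then if i = \<psi> w \<or> i = \<psi> w' then \<phi> w else q i else undefined)" for i
      have "f \<in> PiE (verts G) Q"
        using \<phi>Q[OF w(1)] \<phi>Q[OF w(2)] w(3) q by (auto simp: f_def)
      then have "inj_on f (verts G)" by (rule emb)
      moreover have "f (\<psi> w) = f (\<psi> w')" using i by (simp add: f_def)
      ultimately show False using i False by (metis inj_onD)
    qed
  qed
  moreover have "\<phi> ` verts F \<subseteq> verts H"
  proof
    fix y assume "y \<in> \<phi> ` verts F"
    then obtain w where w: "w \<in> verts F" "y = \<phi> w" by blast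
    have "\<psi> w \<in> verts G" using \<psi>(1) w(1) by blast
    then show "y \<in> verts H" using Q \<phi>Q[OF w(1)] w(2) by blast
  qed
  moreover have "\<phi> ` e \<in> edges H" if e: "e \<in> edges F" for e
  proof -
    have eF: "e \<subseteq> verts F" "finite e" "card e = r" using rgraphD[OF F] e by auto
    have "card (\<psi> ` e) = card e" using rgraphD(4)[OF G \<psi>(2)[OF e]] eF(3) by simp
    then have inj: "inj_on \<psi> e" using eF(2) by (rule eq_card_imp_inj_on[rotated])
    \<comment> \<open>Since \<open>e\<close> and its image in \<open>G\<close> both have
      \<open>r\<close> elements, the coloring is injective on \<open>e\<close>, so one choice from
      the box can realise \<open>\<phi>\<close> on all of \<open>e\<close>.\<close>
    define f where "f i = (if i \<in> verts G then if i \<in> \<psi> ` e then \<phi> (inv_into e \<psi> i) else q i else undefined)" for i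
    have f\<psi>: "f (\<psi> w) = \<phi> w" if "w \<in> e" for w
      using that inj eF(1) \<psi>(1) by (auto simp: f_def)
    have "f \<in> PiE (verts G) Q"
    proof (rule PiE_I)
      fix i assume i: "i \<in> verts G"
      show "f i \<in> Q i"
      proof (cases "i \<in> \<psi> ` e")
        case True
        then obtain w where w: "w \<in> e" "i = \<psi> w" by blast
        then show ?thesis using f\<psi>[OF w(1)] \<phi>Q[of w] eF(1) by auto
      next
        case False
        then show ?thesis using i q by (simp add: f_def)
      qed
    qed (simp add: f_def)
    then have "f ` \<psi> ` e \<in> edges H" using emb(2) \<psi>(2)[OF e] by blast
    moreover have "f ` \<psi> ` e = \<phi> ` e" using f\<psi> by (simp add: image_image)
    ultimately show ?thesis by simp
  qed
  ultimately show ?thesis unfolding contains_def homomorphism_def by blast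
qed

text \<open>Otherwise the embeddings, viewed as tuples, are dense enough to contain a box, and
  \<open>contains_of_box\<close> finds \<open>F\<close>.\<close>

lemma few_embeddings:
  assumes G: "rgraph r G" and F: "rgraph r F" and col: "colorable F G" and \<delta>: "0 < \<delta>"
  shows "\<exists>N. \<forall>H :: 'v hgraph. rgraph r H \<longrightarrow> N \<le> order_of H \<longrightarrow> \<not> contains H F \<longrightarrow>
     real (card (embeddings G H)) \<le> \<delta> * real (order_of H) ^ order_of G"
proof -
  obtain N where N: "\<forall>(V :: 'v set) A. finite V \<longrightarrow> N \<le> card V \<longrightarrow> A \<subseteq> (verts G \<rightarrow>\<^sub>E V) \<longrightarrow>
    \<delta> * real (card V) ^ card (verts G) \<le> real (card A) \<longrightarrow>
    (\<exists>Q. (\<forall>i\<in>verts G. Q i \<subseteq> V \<and> card (Q i) = Suc (card (verts F))) \<and> PiE (verts G) Q \<subseteq> A)"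
    using dense_contains_box[OF rgraphD(1)[OF G], of "Suc (card (verts F))", rule_format, OF _ \<delta>] by auto
  show ?thesis
  proof (rule exI[of _ N], intro allI impI, rule ccontr)
    fix H :: "'v hgraph"
    assume H: "rgraph r H" "N \<le> order_of H" "\<not> contains H F"
      and "\<not> real (card (embeddings G H)) \<le> \<delta> * real (order_of H) ^ order_of G"
    then have dense: "\<delta> * real (card (verts H)) ^ card (verts G) \<le> real (card (embeddings G H))"
      by (simp add: order_of_def)
    have sub: "embeddings G H \<subseteq> (verts G \<rightarrow>\<^sub>E verts H)" by (auto simp: embeddings_def)
    obtain Q where "\<forall>i\<in>verts G. Q i \<subseteq> verts H \<and> card (Q i) = Suc (card (verts F))"
      "PiE (verts G) Q \<subseteq> embeddings G H"
      using N[rule_format, OF rgraphD(1)[OF H(1)] H(2)[unfolded order_of_def] sub dense] by (elim exE conjE)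
    then have "contains H F" by (intro contains_of_box[OF G F col]) auto
    then show False using H(3) by simp
  qed
qed

text \<open>Each bad \<open>m\<close>-set is the image of an embedding of a graph on
  \<open>{..<m}\<close> containing some \<open>F'\<close> in \<open>\<F>'\<close>. Through
  \<open>F'\<close> that graph receives a homomorphism from some \<open>F\<close> in
  \<open>\<F>\<close>, so it has few embeddings into an \<open>\<F>\<close>-free graph; and there
  are finitely many such graphs.\<close>

lemma few_nonfree_subsets:
  fixes \<F> \<F>' :: "nat hgraph set"
  assumes rg: "\<forall>F\<in>\<F>. rgraph r F" "\<forall>F\<in>\<F>'. rgraph r F" and hom: "\<F>' \<le>hom \<F>" and \<delta>: "0 < \<delta>" and m: "0 < m"
  shows "\<exists>N. \<forall>H :: nat hgraph. rgraph r H \<longrightarrow> free \<F> H \<longrightarrow> N \<le> order_of H \<longrightarrow>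
    real (card {M. M \<subseteq> verts H \<and> card M = m \<and> \<not> free \<F>' (induced H M)}) \<le> \<delta> * real (order_of H choose m)"
proof -
  let ?I = "{..<m}"
  define \<G> where "\<G> = {G :: nat hgraph. verts G = ?I \<and> rgraph r G \<and> \<not> free \<F>' G}"
  have fin\<G>: "finite \<G>"
  proof (rule finite_subset)
    show "\<G> \<subseteq> HGraph ?I ` Pow (Pow ?I)"
    proof
      fix G assume "G \<in> \<G>"
      then have "G = HGraph ?I (edges G)" "edges G \<in> Pow (Pow ?I)"
        by (auto simp: \<G>_def rgraph_def intro: hgraph.expand)
      then show "G \<in> HGraph ?I ` Pow (Pow ?I)" by blast
    qed
  qed simp
  \<comment> \<open>\<open>m ^ m\<close> converts \<open>n ^ m\<close> into
    \<open>n choose m\<close>; the number of patterns, plus one in case \<open>\<G>\<close> is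
    empty, absorbs the union bound.\<close>
  define \<delta>' where "\<delta>' = \<delta> / (real m ^ m * (real (card \<G>) + 1))"
  have \<delta>': "0 < \<delta>'" using \<delta> m by (simp add: \<delta>'_def)
  have "\<forall>G\<in>\<G>. \<exists>N. \<forall>H :: nat hgraph. rgraph r H \<longrightarrow> free \<F> H \<longrightarrow> N \<le> order_of H \<longrightarrow>
     real (card (embeddings G H)) \<le> \<delta>' * real (order_of H) ^ m"
  proof
    fix G assume G: "G \<in> \<G>"
    then have rG: "rgraph r G" "order_of G = m" by (auto simp: \<G>_def order_of_def)
    obtain F' where F': "F' \<in> \<F>'" "contains G F'" using G by (auto simp: \<G>_def free_def)
    obtain F where F: "F \<in> \<F>" "colorable F F'" using hom F'(1) by (auto simp: hom_le_def)
    obtain f where f: "homomorphism f F' G" using F'(2) by (auto simp: contains_def)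
    obtain g where g: "homomorphism g F F'" using F(2) by (auto simp: colorable_def)
    have "homomorphism (f \<circ> g) F G" using f g unfolding homomorphism_def image_comp[symmetric] by blast
    then have "colorable F G" by (auto simp: colorable_def)
    from few_embeddings[OF rG(1) _ this \<delta>', where 'v = nat] obtain N where
      N: "\<forall>H :: nat hgraph. rgraph r H \<longrightarrow> N \<le> order_of H \<longrightarrow> \<not> contains H F \<longrightarrow>
        real (card (embeddings G H)) \<le> \<delta>' * real (order_of H) ^ order_of G"
      using rg(1) F(1) by blast
    show "\<exists>N. \<forall>H :: nat hgraph. rgraph r H \<longrightarrow> free \<F> H \<longrightarrow> N \<le> order_of H \<longrightarrow>
      real (card (embeddings G H)) \<le> \<delta>' * real (order_of H) ^ m"
    proof (rule exI[of _ N], intro allI impI)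
      fix H :: "nat hgraph" assume H: "rgraph r H" "free \<F> H" "N \<le> order_of H"
      have "\<not> contains H F" using H(2) F(1) by (simp add: free_def)
      then show "real (card (embeddings G H)) \<le> \<delta>' * real (order_of H) ^ m"
        using N[rule_format, OF H(1,3)] rG(2) by simp
    qed
  qed
  then obtain Nf where Nf: "\<forall>G\<in>\<G>. \<forall>H :: nat hgraph. rgraph r H \<longrightarrow> free \<F> H \<longrightarrow> Nf G \<le> order_of H \<longrightarrow>
     real (card (embeddings G H)) \<le> \<delta>' * real (order_of H) ^ m"
    by (rule bchoice[THEN exE])
  let ?N = "m + (\<Sum>G\<in>\<G>. Nf G)"
  show ?thesis
  proof (rule exI[of _ ?N], intro allI impI)
    fix H :: "nat hgraph" assume H: "rgraph r H" "free \<F> H" "?N \<le> order_of H"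
    let ?n = "order_of H" and ?bad = "{M. M \<subseteq> verts H \<and> card M = m \<and> \<not> free \<F>' (induced H M)}"
    have fin: "finite (verts H)" using rgraphD(1)[OF H(1)] .
    have "?bad \<subseteq> (\<Union>G\<in>\<G>. (\<lambda>\<phi>. \<phi> ` ?I) ` embeddings G H)"
    proof
      fix M assume "M \<in> ?bad"
      then have M: "M \<subseteq> verts H" "card M = m" "\<not> free \<F>' (induced H M)" by auto
      have finM: "finite M" using M(1) fin by (rule finite_subset)
      obtain b where b: "bij_betw b {0..<m} M" using ex_bij_betw_nat_finite[OF finM] M(2) by auto
      define \<phi> where "\<phi> = restrict b ?I"
      have \<phi>: "inj_on \<phi> ?I" "\<phi> ` ?I = M"
        using b by (auto simp: \<phi>_def bij_betw_def atLeast0LessThan inj_on_def)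
      \<comment> \<open>The pullback of \<open>H\<close> along \<open>\<phi>\<close>. The inverse of
        \<open>\<phi>\<close> passes badness from \<open>M\<close> to \<open>G\<close>, while
        \<open>\<phi>\<close> itself is the embedding that gets counted.\<close>
      define G where "G = HGraph ?I {e. e \<subseteq> ?I \<and> \<phi> ` e \<in> edges H}"
      have rG: "rgraph r G"
      proof -
        have "card e = r" if "e \<subseteq> ?I" "\<phi> ` e \<in> edges H" for e
          using rgraphD(4)[OF H(1) that(2)] card_image[OF inj_on_subset[OF \<phi>(1) that(1)]] by simp
        then show ?thesis by (auto simp: rgraph_def G_def)
      qed
      have "contains G (induced H M)"
        unfolding contains_def homomorphism_def
      proof (intro exI[of _ "inv_into ?I \<phi>"] conjI ballI)
        show "inj_on (inv_into ?I \<phi>) (verts (induced H M))" using \<phi>(2) by (simp add: inj_on_inv_into)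
        show "inv_into ?I \<phi> ` verts (induced H M) \<subseteq> verts G"
          using \<phi>(2) inv_into_into[of _ \<phi> ?I] by (auto simp: G_def)
        fix e assume "e \<in> edges (induced H M)"
        then have e: "e \<in> edges H" "e \<subseteq> \<phi> ` ?I" using \<phi>(2) by auto
        have "\<phi> ` inv_into ?I \<phi> ` e = e" using e(2) by (rule image_inv_into_cancel[OF refl])
        moreover have "inv_into ?I \<phi> ` e \<subseteq> ?I" using e(2) inv_into_into[of _ \<phi> ?I] by blast
        ultimately show "inv_into ?I \<phi> ` e \<in> edges G" using e(1) by (simp add: G_def)
      qed
      then have "\<not> free \<F>' G" using M(3) free_subgraph[OF rg(2)] by blast
      then have "G \<in> \<G>" using rG by (simp add: \<G>_def G_def)
      moreover have "\<phi> \<in> embeddings G H"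
        using \<phi> M(1) by (auto simp: embeddings_def homomorphism_def G_def \<phi>_def)
      ultimately show "M \<in> (\<Union>G\<in>\<G>. (\<lambda>\<phi>. \<phi> ` ?I) ` embeddings G H)" using \<phi>(2) by blast
    qed
    moreover have finE: "finite (embeddings G H)" if "G \<in> \<G>" for G
    proof -
      have "embeddings G H \<subseteq> (verts G \<rightarrow>\<^sub>E verts H)" by (auto simp: embeddings_def)
      moreover have "finite (verts G \<rightarrow>\<^sub>E verts H)" using that fin by (intro finite_PiE) (auto simp: \<G>_def)
      ultimately show ?thesis by (rule finite_subset)
    qed
    ultimately have "card ?bad \<le> card (\<Union>G\<in>\<G>. (\<lambda>\<phi>. \<phi> ` ?I) ` embeddings G H)"
      using fin\<G> by (intro card_mono) auto
    also have "\<dots> \<le> (\<Sum>G\<in>\<G>. card ((\<lambda>\<phi>. \<phi> ` ?I) ` embeddings G H))" using fin\<G> by (rule card_UN_le)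
    also have "\<dots> \<le> (\<Sum>G\<in>\<G>. card (embeddings G H))" using finE by (intro sum_mono card_image_le)
    finally have "real (card ?bad) \<le> real (\<Sum>G\<in>\<G>. card (embeddings G H))" by (rule of_nat_mono)
    also have "\<dots> = (\<Sum>G\<in>\<G>. real (card (embeddings G H)))" by simp
    also have "\<dots> \<le> (\<Sum>G\<in>\<G>. \<delta>' * real ?n ^ m)"
    proof (rule sum_mono)
      fix G assume G: "G \<in> \<G>"
      have "Nf G \<le> (\<Sum>G\<in>\<G>. Nf G)" using fin\<G> G by (intro member_le_sum) auto
      then have "Nf G \<le> ?n" using H(3) by simp
      then show "real (card (embeddings G H)) \<le> \<delta>' * real ?n ^ m" using Nf G H(1,2) by blast
    qed
    also have "\<dots> = real (card \<G>) * (\<delta>' * real ?n ^ m)" by simp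
    also have "\<dots> \<le> (real (card \<G>) + 1) * (\<delta>' * real ?n ^ m)" using \<delta>' by (intro mult_right_mono) auto
    also have "\<dots> = \<delta> * (real ?n / real m) ^ m"
    proof -
      have "real (card \<G>) + 1 \<noteq> 0" using of_nat_0_le_iff[of "card \<G>", where 'a = real] by linarith
      then show ?thesis using m by (simp add: \<delta>'_def power_divide)
    qed
    also have "\<dots> \<le> \<delta> * real (?n choose m)"
      using \<delta> H(3) binomial_ge_n_over_k_pow_k[of m ?n, where 'a = real] by (intro mult_left_mono) auto
    finally show "real (card ?bad) \<le> \<delta> * real (?n choose m)" .
  qed
qed


subsection \<open>Transferring stability\<close>

lemma close_to_mono:
  assumes "close_to \<HH> \<gamma> H" "\<gamma> \<le> \<gamma>'"
  shows "close_to \<HH> \<gamma>' H"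
proof -
  obtain W where W: "W \<subseteq> verts H" "real (card (verts H - W)) \<le> \<gamma> * real (order_of H)" "induced H W \<in> \<HH>"
    using assms(1) by (auto simp: close_to_def)
  have "\<gamma> * real (order_of H) \<le> \<gamma>' * real (order_of H)" using assms(2) by (intro mult_right_mono) auto
  then show ?thesis unfolding close_to_def using W by (intro exI[of _ W]) auto
qed

context tp_setting
begin

text \<open>On average the density does not decrease and the proportion of \<open>m\<close>-sets in \<open>B\<close> is unchanged.\<close>

lemma vertex_deletion_potential:
  assumes H: "rgraph r H" and S: "S \<subseteq> verts H" "r < card S" "m < card S"
    and B: "finite B" "\<And>M. M \<in> B \<Longrightarrow> card M = m"
  shows "\<exists>v\<in>S. density (induced H S) - 2 * (real (card {M \<in> B. M \<subseteq> S}) / real (card S choose m))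
     \<le> density (induced H (S - {v})) - 2 * (real (card {M \<in> B. M \<subseteq> S - {v}}) / real (card (S - {v}) choose m))"
proof (rule ccontr)
  let ?k = "card S"
  define c where "c S = real (card {M \<in> B. M \<subseteq> S}) / real (card S choose m)" for S
  assume no: "\<not> ?thesis"
  then have less: "density (induced H (S - {v})) - 2 * c (S - {v}) < density (induced H S) - 2 * c S"
    if "v \<in> S" for v using that no unfolding c_def by force
  have fin: "finite S" using S(1) rgraphD(1)[OF H] by (rule finite_subset)
  have ne: "S \<noteq> {}" using S(2) by auto
  have "(\<Sum>v\<in>S. density (induced H (S - {v})) - 2 * c (S - {v})) < (\<Sum>v\<in>S. density (induced H S) - 2 * c S)"
    using less fin ne by (intro sum_strict_mono) auto
  then have "(\<Sum>v\<in>S. density (induced H (S - {v}))) - 2 * (\<Sum>v\<in>S. c (S - {v}))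
      < real ?k * density (induced H S) - 2 * (real ?k * c S)"
    by (simp add: sum_subtractf sum_distrib_left right_diff_distrib)
  moreover have "real ?k * density (induced H S) \<le> (\<Sum>v\<in>S. density (induced H (S - {v})))"
    using sum_density_remove[OF rgraph_induced[OF H S(1)]] S(2)
    by (simp add: order_of_def induced_induced)
  moreover have "(\<Sum>v\<in>S. c (S - {v})) = real ?k * c S"
  proof -
    have "(\<Sum>v\<in>S. card {M \<in> {M \<in> B. M \<subseteq> S}. v \<notin> M}) = (\<Sum>M\<in>{M \<in> B. M \<subseteq> S}. card {v \<in> S. v \<notin> M})"
      using fin B(1) by (intro sum_card_swap) auto
    also have "\<dots> = (\<Sum>M\<in>{M \<in> B. M \<subseteq> S}. ?k - m)"
    proof (rule sum.cong[OF refl])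
      fix M assume "M \<in> {M \<in> B. M \<subseteq> S}"
      then have M: "M \<subseteq> S" "card M = m" using B(2) by auto
      have "{v \<in> S. v \<notin> M} = S - M" by blast
      then show "card {v \<in> S. v \<notin> M} = ?k - m"
        using M fin by (simp add: card_Diff_subset finite_subset)
    qed
    finally have sum: "(\<Sum>v\<in>S. card {M \<in> {M \<in> B. M \<subseteq> S}. v \<notin> M}) = card {M \<in> B. M \<subseteq> S} * (?k - m)" by simp
    have eq: "{M \<in> B. M \<subseteq> S - {v}} = {M \<in> {M \<in> B. M \<subseteq> S}. v \<notin> M}" for v by blast
    have "(\<Sum>v\<in>S. c (S - {v})) = (\<Sum>v\<in>S. real (card {M \<in> {M \<in> B. M \<subseteq> S}. v \<notin> M}) / real ((?k - 1) choose m))"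
      using fin by (intro sum.cong) (simp_all only: c_def eq card_Diff_singleton)
    also have "\<dots> = real (\<Sum>v\<in>S. card {M \<in> {M \<in> B. M \<subseteq> S}. v \<notin> M}) / real ((?k - 1) choose m)"
      by (simp only: sum_divide_distrib of_nat_sum)
    also have "\<dots> = real (card {M \<in> B. M \<subseteq> S}) * (real (?k - m) / real ((?k - 1) choose m))"
      by (simp only: sum of_nat_mult times_divide_eq_right)
    also have "real (?k - m) / real ((?k - 1) choose m) = real ?k / real (?k choose m)"
    proof -
      have "real (?k - m) * real (?k choose m) = real ?k * real ((?k - 1) choose m)"
        using arg_cong[OF binomial_absorb_comp[of ?k m], of real] by (simp only: of_nat_mult)
      moreover have "0 < real (?k choose m)" "0 < real ((?k - 1) choose m)"
        using S(3) by (auto simp: zero_less_binomial)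
      ultimately show ?thesis by (simp add: field_simps)
    qed
    finally show ?thesis by (simp add: c_def)
  qed
  ultimately show False by linarith
qed

text \<open>The deletion chain is hidden in an induction on the number \<open>d\<close> of vertices
  beyond \<open>m\<close>: a set with potential at least that of the whole vertex set contains one
  with one vertex less and the same property, and closeness is inherited upwards. Density near
  \<open>L\<close> feeds \<open>bootstrap\<close> for \<open>\<F>\<close> at every larger size; at
  size \<open>m\<close> it is compared with \<open>L'\<close>.\<close>

lemma degree_stable_transfer:
  fixes \<F> \<F>' \<HH> :: "nat hgraph set"
  assumes lim: "tp_limit r t p \<F> L" and lim': "tp_limit r t p \<F>' L'" and LL': "L' \<le> L"
    and hom: "\<F>' \<le>hom \<F>" and her: "hereditary r \<HH>"
    and bl: "blowup_invariant r \<F>'" and st: "symmetrized_stable r \<F>' \<HH>"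
    and ext: "vertex_extendable r t p \<F> \<HH>" and ext': "vertex_extendable r t p \<F>' \<HH>"
  shows "degree_stable r t p \<F> \<HH>"
proof -
  interpret F: tp_limit r t p \<F> L by (rule lim)
  interpret F': tp_limit r t p \<F>' L' by (rule lim')
  obtain \<gamma>0 where \<gamma>0: "0 < \<gamma>0" and boot: "\<forall>\<gamma>>0. \<exists>\<epsilon>>0. \<exists>N. \<forall>H :: nat hgraph. rgraph r H \<longrightarrow> free \<F> H \<longrightarrow> N \<le> order_of H \<longrightarrow>
     (1 - \<epsilon>) * L \<le> density H \<longrightarrow> close_to \<HH> \<gamma>0 H \<longrightarrow>
     close_to \<HH> \<gamma> H \<and> ((1 - \<epsilon>) * exdeg_tp r t p (order_of H) \<F> \<le> min_tp_degree t p H \<longrightarrow> H \<in> \<HH>)"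
    using F.bootstrap[OF her ext] by (elim exE conjE)
  \<comment> \<open>Half the radius, so that one more missing vertex is still within
    \<open>\<gamma>0\<close>.\<close>
  define \<gamma> where "\<gamma> = \<gamma>0 / 2"
  have \<gamma>: "0 < \<gamma>" "\<gamma> \<le> \<gamma>0" using \<gamma>0 by (auto simp: \<gamma>_def)
  obtain \<epsilon>1 N1 where \<epsilon>1: "0 < \<epsilon>1" and up: "\<forall>H :: nat hgraph. rgraph r H \<longrightarrow> free \<F> H \<longrightarrow> N1 \<le> order_of H \<longrightarrow>
     (1 - \<epsilon>1) * L \<le> density H \<longrightarrow> close_to \<HH> \<gamma>0 H \<longrightarrow>
     close_to \<HH> \<gamma> H \<and> ((1 - \<epsilon>1) * exdeg_tp r t p (order_of H) \<F> \<le> min_tp_degree t p H \<longrightarrow> H \<in> \<HH>)"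
    using boot[rule_format, OF \<gamma>(1)] by (elim exE conjE)
  obtain \<epsilon>2 N2 where \<epsilon>2: "0 < \<epsilon>2" and base: "\<forall>H :: nat hgraph. rgraph r H \<longrightarrow> free \<F>' H \<longrightarrow> N2 \<le> order_of H \<longrightarrow>
     (1 - \<epsilon>2) * L' \<le> density H \<longrightarrow> close_to \<HH> \<gamma> H"
    using F'.close_to_of_symmetrized_stable[OF her ext' bl st \<gamma>(1)] by (elim exE conjE)
  define \<epsilon> where "\<epsilon> = min 1 (min (\<epsilon>1 / 2) (\<epsilon>2 / 2))"
  have \<epsilon>: "0 < \<epsilon>" "\<epsilon> \<le> 1" "2 * \<epsilon> \<le> \<epsilon>1" "2 * \<epsilon> \<le> \<epsilon>2" using \<epsilon>1 \<epsilon>2 by (auto simp: \<epsilon>_def min_def)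
  \<comment> \<open>All thresholds must hold already at the bottom of the chain;
    \<open>2 / \<gamma>0\<close> makes a single vertex cost at most
    \<open>\<gamma> * m\<close>.\<close>
  define m where "m = N1 + N2 + r + nat \<lceil>2 / \<gamma>0\<rceil> + 1"
  have m: "N1 \<le> m" "N2 \<le> m" "r < m" "0 < m" "2 / \<gamma>0 \<le> real m" unfolding m_def by linarith+
  \<comment> \<open>\<open>2 * \<delta> \<le> 1 / 2\<close> separates good from bad sets at order
    \<open>m\<close>; \<open>2 * \<delta> \<le> \<epsilon> * L'\<close> makes the loss of density
    along the chain at most another \<open>\<epsilon>\<close> of the limit.\<close>
  define \<delta> where "\<delta> = min (1 / 4) (\<epsilon> * L' / 2)"
  have \<delta>: "0 < \<delta>" "2 * \<delta> \<le> 1 / 2" "2 * \<delta> \<le> \<epsilon> * L'" 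
  proof -
    show "0 < \<delta>" using \<epsilon>(1) F'.L_pos by (simp add: \<delta>_def)
    have "\<delta> \<le> 1 / 4" "\<delta> \<le> \<epsilon> * L' / 2" unfolding \<delta>_def by (rule min.cobounded1, rule min.cobounded2)
    then show "2 * \<delta> \<le> 1 / 2" "2 * \<delta> \<le> \<epsilon> * L'" by linarith+
  qed
  obtain N3 where few: "\<forall>H :: nat hgraph. rgraph r H \<longrightarrow> free \<F> H \<longrightarrow> N3 \<le> order_of H \<longrightarrow>
    real (card {M. M \<subseteq> verts H \<and> card M = m \<and> \<not> free \<F>' (induced H M)}) \<le> \<delta> * real (order_of H choose m)"
    using few_nonfree_subsets[OF F.family F'.family hom \<delta>(1) m(4)] by (elim exE)
  have "H \<in> \<HH>" if H: "rgraph r H" "free \<F> H" and nN: "N3 + m \<le> order_of H"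
    and deg: "(1 - \<epsilon>) * exdeg_tp r t p (order_of H) \<F> \<le> min_tp_degree t p H" for H :: "nat hgraph"
  proof -
    let ?n = "order_of H"
    have n: "N3 \<le> ?n" "m \<le> ?n" "r \<le> ?n" using nN m by auto
    have fin: "finite (verts H)" using rgraphD(1)[OF H(1)] .
    define B where "B = {M. M \<subseteq> verts H \<and> card M = m \<and> \<not> free \<F>' (induced H M)}"
    have finB: "finite B" using fin by (auto simp: B_def)
    define c where "c S = real (card {M \<in> B. M \<subseteq> S}) / real (card S choose m)" for S
    have c0: "0 \<le> c S" for S by (simp add: c_def)
    \<comment> \<open>On an \<open>m\<close>-set, \<open>c\<close> is 0 or 1. The coefficient 2
      makes the potential of a bad one at most \<open>1 - 2 = - 1\<close>, below the starting value,
      which is at least \<open>- 1 / 2\<close>.\<close>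
    define \<Phi> where "\<Phi> S = density (induced H S) - 2 * c S" for S
    have "(1 - \<epsilon>) * L \<le> (1 - \<epsilon>) * ex_density ?n \<F>" using \<epsilon>(2) F.L_le[OF n(3)] by (intro mult_left_mono) auto
    also have "\<dots> \<le> density H" by (rule density_ge_of_min_degree[OF H(1) n(3) deg])
    finally have densH: "(1 - \<epsilon>) * L \<le> density H" .
    have cV: "c (verts H) \<le> \<delta>"
    proof -
      have "{M \<in> B. M \<subseteq> verts H} = B" by (auto simp: B_def)
      moreover have "real (card B) \<le> \<delta> * real (?n choose m)" unfolding B_def using few[rule_format, OF H n(1)] .
      moreover have "0 < real (?n choose m)" using n(2) by (simp add: zero_less_binomial)
      ultimately show ?thesis by (simp add: c_def order_of_def pos_divide_le_eq)
    qed
    have \<Phi>V: "(1 - \<epsilon>) * L - 2 * \<delta> \<le> \<Phi> (verts H)" "- 1 / 2 \<le> \<Phi> (verts H)"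
      using densH cV \<delta>(2) density_nonneg[of H] induced_verts[OF H(1)] by (auto simp: \<Phi>_def)
    have "S \<subseteq> verts H \<longrightarrow> card S = m + d \<longrightarrow> \<Phi> (verts H) \<le> \<Phi> S \<longrightarrow> close_to \<HH> \<gamma> (induced H S)" for d S
    proof (induction d arbitrary: S)
      case 0
      show ?case
      proof (intro impI)
        assume S: "S \<subseteq> verts H" "card S = m + 0" "\<Phi> (verts H) \<le> \<Phi> S"
        note rS = rgraph_induced[OF H(1) S(1)]
        have "S \<notin> B"
        proof
          assume "S \<in> B"
          then have "card {S} \<le> card {M \<in> B. M \<subseteq> S}" using finB by (intro card_mono) auto
          then have "1 \<le> c S" using S(2) by (simp add: c_def)
          moreover have "density (induced H S) \<le> 1" by (rule density_le_1[OF rS])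
          ultimately have "\<Phi> S \<le> - 1" by (simp add: \<Phi>_def)
          then show False using \<Phi>V(2) S(3) by linarith
        qed
        then have "free \<F>' (induced H S)" using S by (simp add: B_def)
        moreover have "(1 - \<epsilon>2) * L' \<le> density (induced H S)"
        proof -
          have "(1 - \<epsilon>2) * L' \<le> (1 - 2 * \<epsilon>) * L'" using \<epsilon>(4) F'.L_pos by (intro mult_right_mono) auto
          also have "\<dots> = (1 - \<epsilon>) * L' - \<epsilon> * L'" by (simp add: algebra_simps)
          also have "\<dots> \<le> (1 - \<epsilon>) * L - 2 * \<delta>" using \<delta>(3) LL' \<epsilon>(2) by (intro diff_mono mult_left_mono) auto
          also have "\<dots> \<le> density (induced H S)" using \<Phi>V(1) S(3) c0[of S] by (simp add: \<Phi>_def)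
          finally show ?thesis .
        qed
        ultimately show "close_to \<HH> \<gamma> (induced H S)"
          using base[rule_format, OF rS] m(2) S(2) by (simp add: order_of_def)
      qed
    next
      case (Suc d)
      show ?case
      proof (intro impI)
        assume S: "S \<subseteq> verts H" "card S = m + Suc d" "\<Phi> (verts H) \<le> \<Phi> S"
        note rS = rgraph_induced[OF H(1) S(1)]
        have finS: "finite S" using S(1) fin by (rule finite_subset)
        have kS: "r < card S" "m < card S" using m(3) S(2) by auto
        have "\<exists>v\<in>S. \<Phi> S \<le> \<Phi> (S - {v})"
          unfolding \<Phi>_def c_def
          by (rule vertex_deletion_potential[OF H(1) S(1) kS finB]) (simp add: B_def)
        then obtain v where v: "v \<in> S" "\<Phi> S \<le> \<Phi> (S - {v})" by blast
        have "S - {v} \<subseteq> verts H" "card (S - {v}) = m + d" "\<Phi> (verts H) \<le> \<Phi> (S - {v})"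
          using S v finS by auto
        then have "close_to \<HH> \<gamma> (induced H (S - {v}))" using Suc.IH by blast
        then obtain W where W: "W \<subseteq> S - {v}" "real (card (S - {v} - W)) \<le> \<gamma> * real (card (S - {v}))"
          "induced H W \<in> \<HH>"
          unfolding close_to_def by (auto simp: order_of_def induced_induced)
        have "close_to \<HH> \<gamma>0 (induced H S)"
          unfolding close_to_def
        proof (intro exI[of _ W] conjI)
          show "W \<subseteq> verts (induced H S)" using W(1) by auto
          show "induced (induced H S) W \<in> \<HH>" using W(1,3) by (simp add: induced_induced subset_iff)
          have "S - W = insert v (S - {v} - W)" using v(1) W(1) by blast
          then have "card (S - W) \<le> Suc (card (S - {v} - W))" using finS by (simp add: card_insert_if)
          then have "real (card (S - W)) \<le> real (card (S - {v} - W)) + 1" by linarith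
          also have "\<dots> \<le> \<gamma> * real (card S) + 1"
          proof -
            have "\<gamma> * real (card (S - {v})) \<le> \<gamma> * real (card S)"
              using \<gamma>(1) finS by (intro mult_left_mono of_nat_mono card_mono) auto
            then show ?thesis using W(2) by linarith
          qed
          also have "1 \<le> \<gamma> * real (card S)"
          proof -
            have "2 / \<gamma>0 \<le> real (card S)" using m(5) S(2) by simp
            then show ?thesis using \<gamma>0 by (simp add: \<gamma>_def field_simps)
          qed
          finally show "real (card (verts (induced H S) - W)) \<le> \<gamma>0 * real (order_of (induced H S))"
            by (simp add: \<gamma>_def order_of_def)
        qed
        moreover have "(1 - \<epsilon>1) * L \<le> density (induced H S)"
        proof -
          have "(1 - \<epsilon>1) * L \<le> (1 - 2 * \<epsilon>) * L" using \<epsilon>(3) F.L_pos by (intro mult_right_mono) auto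
          also have "\<dots> = (1 - \<epsilon>) * L - \<epsilon> * L" by (simp add: algebra_simps)
          also have "\<dots> \<le> (1 - \<epsilon>) * L - 2 * \<delta>"
            using \<delta>(3) mult_left_mono[OF LL', of \<epsilon>] \<epsilon>(1) by linarith
          also have "\<dots> \<le> density (induced H S)" using \<Phi>V(1) S(3) c0[of S] by (simp add: \<Phi>_def)
          finally show ?thesis .
        qed
        moreover have "N1 \<le> order_of (induced H S)" using m(1) S(2) by (simp add: order_of_def)
        ultimately show "close_to \<HH> \<gamma> (induced H S)"
          using up[rule_format, OF rS free_induced[OF F.family H(2) S(1)]] by blast
      qed
    qed
    from this[rule_format, OF order_refl, of "?n - m"]
    have "close_to \<HH> \<gamma> H" using n(2) induced_verts[OF H(1)] by (simp add: order_of_def)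
    then have "close_to \<HH> \<gamma>0 H" using \<gamma>(2) by (rule close_to_mono)
    moreover have "(1 - \<epsilon>1) * L \<le> density H"
    proof -
      have "(1 - \<epsilon>1) * L \<le> (1 - \<epsilon>) * L" using \<epsilon> F.L_pos by (intro mult_right_mono) auto
      then show ?thesis using densH by linarith
    qed
    moreover have "(1 - \<epsilon>1) * exdeg_tp r t p ?n \<F> \<le> min_tp_degree t p H"
    proof -
      have "(1 - \<epsilon>1) * exdeg_tp r t p ?n \<F> \<le> (1 - \<epsilon>) * exdeg_tp r t p ?n \<F>"
        using \<epsilon> F.exdeg_nonneg[OF n(3)] by (intro mult_right_mono) auto
      then show ?thesis using deg by linarith
    qed
    ultimately show ?thesis using up[rule_format, OF H] n(2) m(1) by simp
  qed
  then show ?thesis unfolding degree_stable_def using \<epsilon>(1)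
    by (intro exI[of _ \<epsilon>] conjI exI[of _ "N3 + m"]) auto
qed

end

theorem theorem3p9:
  fixes r t :: nat and p :: real
    and \<F> \<F>' \<HH> :: "nat hgraph set"
  assumes "1 \<le> t" and "t < r" and "1 \<le> p"
    and "\<forall>F\<in>\<F>. rgraph r F" and "\<forall>F\<in>\<F>'. rgraph r F"
    and "nondegenerate r \<F>" and "nondegenerate r \<F>'"
    and "\<F>' \<le>hom \<F>"
    and "\<forall>H\<in>\<HH>. rgraph r H \<and> free \<F>' H" and "hereditary r \<HH>"
    and "blowup_invariant r \<F>'"
    and "symmetrized_stable r \<F>' \<HH>"
  shows "(\<forall>n\<ge>1. {G \<in> \<HH>. order_of G = n} \<noteq> {} \<and>
            ex_tp r t p n \<F>' = Max (tp_norm t p ` {G \<in> \<HH>. order_of G = n}))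
       \<and> ((\<forall>H\<in>\<HH>. free \<F> H)
            \<and> vertex_extendable r t p \<F>' \<HH> \<and> vertex_extendable r t p \<F> \<HH>
          \<longrightarrow> degree_stable r t p \<F> \<HH>)"
proof -
  interpret tp_setting r t p using assms(1-3) by unfold_locales
  note part1 = ex_tp_eq_Max[OF assms(5,7,9,11,12)]
  have "degree_stable r t p \<F> \<HH>"
    if freeF: "\<forall>H\<in>\<HH>. free \<F> H"
      and ext: "vertex_extendable r t p \<F>' \<HH>" "vertex_extendable r t p \<F> \<HH>"
  proof -
    have member: "\<exists>G\<in>\<HH>. order_of G = n \<and> tp_norm t p G = ex_tp r t p n \<F>'" for n
    proof -
      have "{G \<in> \<HH>. order_of G = n} = {G. rgraph r G \<and> order_of G = n \<and> G \<in> \<HH>}" using assms(9) by auto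
      then have "finite (tp_norm t p ` {G \<in> \<HH>. order_of G = n})"
        using finite_tp_norm_values[of t p r n "\<lambda>G. G \<in> \<HH>"] by simp
      then have "ex_tp r t p n \<F>' \<in> tp_norm t p ` {G \<in> \<HH>. order_of G = n}"
        unfolding part1(2)[of n] using part1(1)[of n] by (intro Max_in) auto
      then show ?thesis by auto
    qed
    have ne: "{H :: nat hgraph. rgraph r H \<and> order_of H = n \<and> free \<F> H} \<noteq> {}" for n
      using member[of n] assms(9) freeF by blast
    \<comment> \<open>The extremal norm for \<open>\<F>'\<close> is attained in
      \<open>\<HH>\<close>, whose members also compete for the extremal norm of
      \<open>\<F>\<close>.\<close>
    have le: "ex_density n \<F>' \<le> ex_density n \<F>" for n
    proof -
      obtain G where G: "G \<in> \<HH>" "order_of G = n" "tp_norm t p G = ex_tp r t p n \<F>'" using member by blast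
      have "tp_norm t p G \<le> ex_tp r t p (order_of G) \<F>" using G(1) assms(9) freeF by (intro tp_norm_le_ex) auto
      then show ?thesis unfolding ex_density_def using G by (intro divide_right_mono complete_norm_nonneg) simp
    qed
    obtain c where c: "0 < c" "\<forall>n\<ge>r. c \<le> ex_density n \<F>'"
      using nondegenerate_ex_density[OF assms(7,5)] by blast
    have r1: "1 \<le> r" using assms(1,2) by simp
    obtain L' where L': "c \<le> L'" "\<forall>n\<ge>r. L' \<le> ex_density n \<F>'" "\<forall>\<eta>>0. \<exists>N. \<forall>n\<ge>N. ex_density n \<F>' \<le> L' + \<eta>"
      using ex_density_limit[OF assms(5) nondegenerate_free_graphs[OF assms(7) r1 assms(5)], of c] c(2) by blast
    \<comment> \<open>With \<open>L'\<close> itself as the lower bound in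
      \<open>ex_density_limit\<close>, both \<open>L' \<le> L\<close> and the positivity of
      \<open>L\<close> follow.\<close>
    have "L' \<le> ex_density n \<F>" if "r \<le> n" for n using L'(2) le[of n] that by (meson order_trans)
    then obtain L where L: "L' \<le> L" "\<forall>n\<ge>r. L \<le> ex_density n \<F>" "\<forall>\<eta>>0. \<exists>N. \<forall>n\<ge>N. ex_density n \<F> \<le> L + \<eta>"
      using ex_density_limit[OF assms(4) ne, of L'] by blast
    have "tp_limit r t p \<F>' L'" using assms(5) L' c(1) by unfold_locales auto
    moreover have "tp_limit r t p \<F> L" using assms(4) L L' c(1) by unfold_locales auto
    ultimately show ?thesis
      using degree_stable_transfer[OF _ _ L(1) assms(8,10,11,12) ext(2,1)] by blast
  qed
  then show ?thesis using part1 by blast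
qed

end
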